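(* It is NP-hard to decide whether a given digraph with maximum degree $6$ is $2$-colorable.
   Context: Digraphs are loopless and have no parallel arcs, but digons are allowed. The degree of a vertex is its in-degree plus its out-degree. A digraph is $2$-colorable if its vertices can be colored with $2$ colors so that each color class induces an acyclic subdigraph. *)

theory Defs
  imports
    "Graph_Theory.Pair_Digraph"
    "Graph_Theory.Digraph_Component"
    "HOL-Computational_Algebra.Polynomial"
begin

section \<open>Multi-tape Turing machines\<close>

text \<open>
  States and tape symbols are initial segments of the naturals. State 0 is the initial state and
  state 1 the accepting state; symbol 0 is the blank, symbols 1 and 2 stand for the input bits
  \<^const>\<open>False\<close> and \<^const>\<open>True\<close>. Tapes are infinite in both directions.
  The transition table maps a state and the list of scanned symbols to the set of possible
  actions, an action being a new state together with a written symbol and a head move for each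
  tape; a machine halts when there is no possible action.
\<close>

datatype move = Left | Stay | Right

record tm =
  tm_tapes :: nat
  tm_syms :: nat
  tm_states :: nat
  tm_trans :: "nat \<Rightarrow> nat list \<Rightarrow> (nat \<times> (nat \<times> move) list) set"

definition tm_wf :: "tm \<Rightarrow> bool" where
  "tm_wf M \<longleftrightarrow> tm_tapes M \<ge> 1 \<and> tm_syms M \<ge> 3 \<and> tm_states M \<ge> 2 \<and>
    (\<forall>q ss. q < tm_states M \<and> length ss = tm_tapes M \<and> set ss \<subseteq> {..<tm_syms M} \<longrightarrow>
      (\<forall>(q', acts) \<in> tm_trans M q ss.
        q' < tm_states M \<and> length acts = tm_tapes M \<and> fst ` set acts \<subseteq> {..<tm_syms M}))"

definition tm_deterministic :: "tm \<Rightarrow> bool" where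
  "tm_deterministic M \<longleftrightarrow>
    (\<forall>q ss. \<forall>a \<in> tm_trans M q ss. \<forall>b \<in> tm_trans M q ss. a = b)"

text \<open>A tape is its contents together with the head position.\<close>

type_synonym tape = "(int \<Rightarrow> nat) \<times> int"
type_synonym config = "nat \<times> tape list"

fun read_tape :: "tape \<Rightarrow> nat" where
  "read_tape (w, i) = w i"

fun move_head :: "move \<Rightarrow> int \<Rightarrow> int" where
  "move_head Left i = i - 1"
| "move_head Stay i = i"
| "move_head Right i = i + 1"

fun act_tape :: "nat \<times> move \<Rightarrow> tape \<Rightarrow> tape" where
  "act_tape (s, d) (w, i) = (w(i := s), move_head d i)"

definition tm_step :: "tm \<Rightarrow> config \<Rightarrow> config \<Rightarrow> bool" where
  "tm_step M c c' \<longleftrightarrow>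
    (\<exists>(q', acts) \<in> tm_trans M (fst c) (map read_tape (snd c)).
      c' = (q', map2 act_tape acts (snd c)))"

definition tm_halted :: "tm \<Rightarrow> config \<Rightarrow> bool" where
  "tm_halted M c \<longleftrightarrow> (\<nexists>c'. tm_step M c c')"

definition contents :: "bool list \<Rightarrow> int \<Rightarrow> nat" where
  "contents x i =
    (if 0 \<le> i \<and> i < int (length x) then (if x ! nat i then 2 else 1) else 0)"

definition tm_init :: "tm \<Rightarrow> bool list \<Rightarrow> config" where
  "tm_init M x = (0, (contents x, 0) # replicate (tm_tapes M - 1) (contents [], 0))"

section \<open>NP and polynomial-time reductions\<close>

text \<open>
  Time bounds are polynomials with natural coefficients in the input length. Every computation
  path of a nondeterministic machine must respect the bound, and the input is accepted iff some
  path halts in the accepting state.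
\<close>

definition NP :: "bool list set set" where
  "NP = {L. \<exists>M (p :: nat poly). tm_wf M \<and>
    (\<forall>x c t. (tm_step M ^^ t) (tm_init M x) c \<longrightarrow> t \<le> poly p (length x)) \<and>
    (\<forall>x. x \<in> L \<longleftrightarrow> (\<exists>c. (tm_step M)\<^sup>*\<^sup>* (tm_init M x) c \<and> tm_halted M c \<and> fst c = 1))}"

text \<open>The last tape is the output tape.\<close>

definition poly_time_computable :: "(bool list \<Rightarrow> bool list) \<Rightarrow> bool" where
  "poly_time_computable f \<longleftrightarrow> (\<exists>M (p :: nat poly). tm_wf M \<and> tm_deterministic M \<and>
    (\<forall>x. \<exists>t c. t \<le> poly p (length x) \<and> (tm_step M ^^ t) (tm_init M x) c \<and> tm_halted M c \<and>
      fst (last (snd c)) = contents (f x)))"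

text \<open>
  A decision problem consists of a set \<open>I\<close> of instances, written as bit strings by means of an
  injective encoding \<open>enc\<close>, and a property \<open>P\<close> of instances that has to be decided. It is NP-hard
  if every language in NP is polynomial-time many-one reducible to it; reductions only
  produce encodings of elements of \<open>I\<close>.
\<close>

definition NP_hard :: "('a \<Rightarrow> bool list) \<Rightarrow> 'a set \<Rightarrow> ('a \<Rightarrow> bool) \<Rightarrow> bool" where
  "NP_hard enc I P \<longleftrightarrow>
    (\<forall>L \<in> NP. \<exists>f. poly_time_computable f \<and>
      (\<forall>x. \<exists>G \<in> I. f x = enc G \<and> (x \<in> L \<longleftrightarrow> P G)))"

section \<open>Digraphs\<close>

definition vertex_degree :: "('a, 'b) pre_digraph \<Rightarrow> 'a \<Rightarrow> nat" where
  "vertex_degree G v = in_degree G v + out_degree G v"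

text \<open>Inserting 0 only matters for the digraph without vertices.\<close>

definition max_degree :: "('a, 'b) pre_digraph \<Rightarrow> nat" where
  "max_degree G = Max (insert 0 (vertex_degree G ` verts G))"

definition acyclic_digraph :: "('a, 'b) pre_digraph \<Rightarrow> bool" where
  "acyclic_digraph G \<longleftrightarrow> (\<nexists>p. pre_digraph.cycle G p)"

definition colorable :: "nat \<Rightarrow> ('a, 'b) pre_digraph \<Rightarrow> bool" where
  "colorable k G \<longleftrightarrow> (\<exists>col :: 'a \<Rightarrow> nat. (\<forall>v \<in> verts G. col v < k) \<and>
    (\<forall>i < k. acyclic_digraph (G \<restriction> {v \<in> verts G. col v = i})))"

text \<open>
  As inputs of algorithms, digraphs have vertices \<open>0, \<dots>, n - 1\<close> and are
  given by the rows of their adjacency matrix. Arcs are pairs of vertices, so there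
  are no parallel arcs.
\<close>

definition input_digraphs :: "nat pair_pre_digraph set" where
  "input_digraphs = {G. pair_digraph G \<and> (\<exists>n. pverts G = {..<n})}"

definition adjacency_string :: "nat pair_pre_digraph \<Rightarrow> bool list" where
  "adjacency_string G = (let n = card (pverts G) in
    map (\<lambda>e. e \<in> parcs G) (List.product [0..<n] [0..<n]))"

lemma inj_on_adjacency_string: "inj_on adjacency_string input_digraphs"
proof (rule inj_onI)
  fix G H
  assume G: "G \<in> input_digraphs" and H: "H \<in> input_digraphs"
    and eq: "adjacency_string G = adjacency_string H"
  obtain n where n: "pverts G = {..<n}" and Gd: "pair_digraph G"
    using G by (auto simp: input_digraphs_def)
  obtain m where m: "pverts H = {..<m}" and Hd: "pair_digraph H"
    using H by (auto simp: input_digraphs_def)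
  have "n * n = m * m"
    using arg_cong[OF eq, of length] by (simp add: adjacency_string_def Let_def n m)
  then have nm: "n = m"
    by (metis power2_eq_square power2_eq_iff_nonneg zero_le)
  have "e \<in> parcs G \<longleftrightarrow> e \<in> parcs H" if "e \<in> {..<n} \<times> {..<n}" for e
    using eq that by (auto simp: adjacency_string_def Let_def n m nm)
  moreover have "parcs G \<subseteq> {..<n} \<times> {..<n}"
    using pair_wf_digraph.in_arcsD1[of G] pair_wf_digraph.in_arcsD2[of G] Gd n
    by (auto simp: pair_digraph_def pair_fin_digraph_def)
  moreover have "parcs H \<subseteq> {..<n} \<times> {..<n}"
    using pair_wf_digraph.in_arcsD1[of H] pair_wf_digraph.in_arcsD2[of H] Hd m nm
    by (auto simp: pair_digraph_def pair_fin_digraph_def)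
  ultimately have "parcs G = parcs H" by blast
  then show "G = H" using n m nm by simp
qed

end

theory Submission
  imports Defs "HOL-Library.Countable"
begin

text \<open>
  A run of a nondeterministic machine on an input of length \<open>n\<close> is laid out as a grid of cells, row
  \<open>t\<close> being the tapes at time \<open>t\<close>. The current transition is broadcast along its row and head moves
  are signalled across cell borders, so that correctness becomes a constraint between the four
  sides of each cell, whose contents are binary words. Rows are glued to one another, so the cells
  form a single sequence in which cell \<open>s\<close> is adjacent to \<open>s + 1\<close> and \<open>s + W\<close>.

  Every bit becomes a path of digons, along which the two colours alternate. A forbidden assignment
  \<open>a\<close> of the bits of a cell becomes a directed cycle that visits, for every bit, one vertex of its
  path, chosen by parity such that the cycle is monochromatic iff the bits agree with \<open>a\<close> or with
  the complement of \<open>a\<close>. Equality of the words on a common side joins the ends of two paths by a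
  digon. A vertex lies on at most two digons and one of these cycles, so its degree is at most 6; and
  a monochromatic cycle contains no digon arc, so it is one of the disjoint clause cycles.

  Apart from the clause cycles inside a cell, which are determined by its kind (border, first row
  with a given input symbol, ordinary, last row), the arcs between two cells depend only on their
  distance in the sequence. The reduction therefore writes the adjacency matrix by sliding a fixed
  ruler, marked at the distances \<open>0\<close>, \<open>1\<close>, \<open>-1\<close>, \<open>W\<close>, \<open>-W\<close>, over the sequence of cells.
\<close>

section \<open>Colourings as acyclic relations\<close>

lemma (in wf_digraph) acyclic_digraph_iff: "acyclic_digraph G \<longleftrightarrow> acyclic (arcs_ends G)"
proof -
  have "(\<exists>p. cycle p) \<longleftrightarrow> (\<exists>u p. awalk u p u \<and> p \<noteq> [])"
    using closed_w_imp_cycle by (auto simp: closed_w_def cycle_def)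
  also have "\<dots> \<longleftrightarrow> (\<exists>u. u \<rightarrow>\<^sup>+ u)"
    by (simp add: reachable1_awalk)
  finally show ?thesis
    by (simp add: acyclic_digraph_def acyclic_def)
qed

definition monochromatic :: "('a \<Rightarrow> 'c) \<Rightarrow> 'a rel \<Rightarrow> 'a rel" where
  "monochromatic col r = {(v, w) \<in> r. col v = col w}"

lemma trancl_monochromatic:
  "(u, w) \<in> (monochromatic col r)\<^sup>+ \<Longrightarrow> (u, w) \<in> {(v, w) \<in> r. col v = col u \<and> col w = col u}\<^sup>+"
proof (induction rule: trancl_induct)
  case (base w)
  then show ?case by (auto simp: monochromatic_def)
next
  case (step w w')
  have "col w = col u" using step.IH by (auto dest: tranclD2)
  then have "(w, w') \<in> {(v, w) \<in> r. col v = col u \<and> col w = col u}"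
    using step.hyps(2) by (auto simp: monochromatic_def)
  with step.IH show ?case by (rule trancl_into_trancl)
qed

lemma acyclic_monochromatic_iff:
  "acyclic (monochromatic col r) \<longleftrightarrow> (\<forall>i. acyclic {(v, w) \<in> r. col v = i \<and> col w = i})"
proof
  assume "acyclic (monochromatic col r)"
  then show "\<forall>i. acyclic {(v, w) \<in> r. col v = i \<and> col w = i}"
    by (auto simp: monochromatic_def intro: acyclic_subset)
next
  assume "\<forall>i. acyclic {(v, w) \<in> r. col v = i \<and> col w = i}"
  then show "acyclic (monochromatic col r)"
    using trancl_monochromatic by (fastforce simp: acyclic_def)
qed

lemma (in wf_digraph) colorable_iff_acyclic:
  "colorable k G \<longleftrightarrow>
    (\<exists>col. (\<forall>v \<in> verts G. col v < k) \<and> acyclic (monochromatic col (arcs_ends G)))"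
proof -
  have "(\<forall>i < k. acyclic_digraph (G \<restriction> {v \<in> verts G. col v = i})) \<longleftrightarrow>
      acyclic (monochromatic col (arcs_ends G))" if col: "\<forall>v \<in> verts G. col v < k" for col
  proof -
    define class_arcs where "class_arcs i = {(v, w) \<in> arcs_ends G. col v = i \<and> col w = i}" for i
    have "acyclic_digraph (G \<restriction> {v \<in> verts G. col v = i}) \<longleftrightarrow> acyclic (class_arcs i)" for i
    proof -
      have "arcs_ends (G \<restriction> {v \<in> verts G. col v = i}) = class_arcs i"
        by (auto simp: arcs_ends_conv image_iff class_arcs_def)
      then show ?thesis
        by (simp add: wf_digraph.acyclic_digraph_iff[OF wellformed_induce_subgraph])
    qed
    moreover have "acyclic (class_arcs i)" if "\<not> i < k" for i
    proof -
      have "class_arcs i = {}" using col that by (auto simp: class_arcs_def dest: adj_in_verts)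
      then show ?thesis by (simp add: acyclic_def)
    qed
    ultimately show ?thesis
      unfolding acyclic_monochromatic_iff class_arcs_def[symmetric] by blast
  qed
  then show ?thesis unfolding colorable_def by auto
qed

lemma (in pair_wf_digraph) colorable_2_iff:
  "colorable 2 (with_proj G) \<longleftrightarrow> (\<exists>col :: 'a \<Rightarrow> bool. acyclic (monochromatic col (parcs G)))"
proof
  assume "colorable 2 (with_proj G)"
  then obtain col :: "'a \<Rightarrow> nat" where col: "\<forall>v \<in> pverts G. col v < 2"
    and acyc: "acyclic (monochromatic col (parcs G))"
    by (auto simp: colorable_iff_acyclic)
  have "monochromatic (\<lambda>v. col v = 1) (parcs G) \<subseteq> monochromatic col (parcs G)"
  proof
    fix e assume "e \<in> monochromatic (\<lambda>v. col v = 1) (parcs G)"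
    then obtain v w where "e = (v, w)" "(v, w) \<in> parcs G" "(col v = 1) = (col w = 1)"
      by (auto simp: monochromatic_def)
    moreover from this have "col v < 2" "col w < 2" using col by (auto dest: in_arcsD1 in_arcsD2)
    ultimately show "e \<in> monochromatic col (parcs G)" by (auto simp: monochromatic_def)
  qed
  with acyc show "\<exists>col :: 'a \<Rightarrow> bool. acyclic (monochromatic col (parcs G))"
    by (blast intro: acyclic_subset)
next
  assume "\<exists>col :: 'a \<Rightarrow> bool. acyclic (monochromatic col (parcs G))"
  then obtain col :: "'a \<Rightarrow> bool" where "acyclic (monochromatic col (parcs G))" by blast
  moreover have "monochromatic (\<lambda>v. of_bool (col v) :: nat) (parcs G) = monochromatic col (parcs G)"
    by (auto simp: monochromatic_def of_bool_def split: if_splits)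
  ultimately show "colorable 2 (with_proj G)"
    unfolding colorable_iff_acyclic
    by (intro exI[of _ "\<lambda>v. of_bool (col v)"]) (auto simp: of_bool_def)
qed

lemma not_acyclicE:
  assumes "\<not> acyclic r"
  obtains X where "X \<noteq> {}" "\<And>v. v \<in> X \<Longrightarrow> \<exists>w \<in> X. (v, w) \<in> r"
proof -
  obtain u where u: "(u, u) \<in> r\<^sup>+" using assms by (auto simp: acyclic_def)
  show thesis
  proof (rule that[of "{v. (v, u) \<in> r\<^sup>+}"])
    show "{v. (v, u) \<in> r\<^sup>+} \<noteq> {}" using u by blast
  next
    fix v assume "v \<in> {v. (v, u) \<in> r\<^sup>+}"
    then obtain w where "(v, w) \<in> r" "(w, u) \<in> r\<^sup>*" by (auto dest: tranclD)
    moreover from this have "(w, u) \<in> r\<^sup>+" using u by (metis rtranclD)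
    ultimately show "\<exists>w \<in> {v. (v, u) \<in> r\<^sup>+}. (v, w) \<in> r" by blast
  qed
qed

lemma not_acyclicI:
  assumes "n > 0" and arcs: "\<And>i. i < n \<Longrightarrow> (f i, f (Suc i mod n)) \<in> r"
  shows "\<not> acyclic r"
proof -
  have "(f 0, f i) \<in> r\<^sup>*" if "i < n" for i
    using that
  proof (induction i)
    case (Suc i)
    then have "(f i, f (Suc i)) \<in> r" using arcs[of i] by simp
    with Suc show ?case by (auto intro: rtrancl_into_rtrancl)
  qed simp
  from this[of "n - 1"] have "(f 0, f 0) \<in> r\<^sup>+"
    using arcs[of "n - 1"] \<open>n > 0\<close> by (auto intro: rtrancl_into_trancl1)
  then show ?thesis by (auto simp: acyclic_def)
qed

definition bichromatic :: "('a \<Rightarrow> 'c) \<Rightarrow> 'a rel \<Rightarrow> bool" where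
  "bichromatic col r \<longleftrightarrow> (\<forall>v w. (v, w) \<in> r \<longrightarrow> col v \<noteq> col w)"

lemma bichromaticD: "bichromatic col r \<Longrightarrow> (v, w) \<in> r \<Longrightarrow> col v \<noteq> col w"
  by (simp add: bichromatic_def)

lemma acyclic_monochromatic_digons_iff:
  assumes A: "A = Restr (D \<union> D\<inverse> \<union> C) V"
  shows "acyclic (monochromatic col A) \<longleftrightarrow>
    bichromatic col (Restr D V) \<and> acyclic (monochromatic col (Restr C V))"
    (is "?acyclic \<longleftrightarrow> ?bichromatic \<and> ?acyclic_C")
proof
  assume acyc: ?acyclic
  have ?bichromatic
  proof (rule ccontr)
    assume "\<not> ?bichromatic"
    then obtain v w where "(v, w) \<in> monochromatic col A" "(w, v) \<in> monochromatic col A"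
      by (auto simp: A monochromatic_def bichromatic_def)
    then have "(v, v) \<in> (monochromatic col A)\<^sup>+" by (meson trancl.intros)
    with acyc show False by (auto simp: acyclic_def)
  qed
  moreover have ?acyclic_C
    using acyc by (rule acyclic_subset) (auto simp: A monochromatic_def)
  ultimately show "?bichromatic \<and> ?acyclic_C" ..
next
  assume bichromatic: "?bichromatic \<and> ?acyclic_C"
  have "monochromatic col A \<subseteq> monochromatic col (Restr C V)"
  proof
    fix e assume "e \<in> monochromatic col A"
    then obtain v w where "e = (v, w)" "(v, w) \<in> D \<union> D\<inverse> \<union> C" "v \<in> V" "w \<in> V" "col v = col w"
      by (auto simp: A monochromatic_def)
    moreover from this have "(v, w) \<notin> D" "(w, v) \<notin> D"
      using bichromatic bichromaticD[of col "Restr D V"] by fastforce+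
    ultimately show "e \<in> monochromatic col (Restr C V)"
      by (simp add: monochromatic_def)
  qed
  then show ?acyclic using bichromatic by (blast intro: acyclic_subset)
qed

section \<open>Degrees\<close>

lemma out_degree_with_proj: "out_degree (with_proj G) v = card (parcs G `` {v})"
  unfolding out_degree_def out_arcs_def
  by (rule bij_betw_same_card[of snd]) (auto simp: bij_betw_def inj_on_def image_iff)

lemma in_degree_with_proj: "in_degree (with_proj G) v = card ((parcs G)\<inverse> `` {v})"
  unfolding in_degree_def in_arcs_def
  by (rule bij_betw_same_card[of fst]) (auto simp: bij_betw_def inj_on_def image_iff)

lemma single_valued_card_Image_le:
  assumes "single_valued r"
  shows "finite (r `` {v})" "card (r `` {v}) \<le> 1"
proof -
  obtain w where "r `` {v} \<subseteq> {w}"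
    using assms by (cases "r `` {v} = {}") (auto simp: single_valued_def)
  then show "finite (r `` {v})" "card (r `` {v}) \<le> 1"
    using finite_subset card_mono[of "{w}"] by auto
qed

lemma card_Image_digons_le:
  assumes "A \<subseteq> D \<union> D\<inverse> \<union> C" "single_valued D" "single_valued (D\<inverse>)" "single_valued C"
  shows "finite (A `` {v})" "card (A `` {v}) \<le> 3"
proof -
  have sub: "A `` {v} \<subseteq> D `` {v} \<union> D\<inverse> `` {v} \<union> C `` {v}" using assms(1) by blast
  have fin: "finite (D `` {v} \<union> D\<inverse> `` {v} \<union> C `` {v})"
    using assms(2-4) by (simp add: single_valued_card_Image_le)
  show "finite (A `` {v})" using sub fin by (rule finite_subset)
  have "card (A `` {v}) \<le> card (D `` {v} \<union> D\<inverse> `` {v} \<union> C `` {v})"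
    using fin sub by (rule card_mono)
  also have "\<dots> \<le> card (D `` {v}) + card (D\<inverse> `` {v}) + card (C `` {v})"
    by (meson add_le_mono card_Un_le le_refl order_trans)
  also have "\<dots> \<le> 3"
    using single_valued_card_Image_le(2)[OF assms(2), of v]
      single_valued_card_Image_le(2)[OF assms(3), of v]
      single_valued_card_Image_le(2)[OF assms(4), of v] by linarith
  finally show "card (A `` {v}) \<le> 3" .
qed

lemma vertex_degree_digons_le:
  assumes arcs: "parcs G \<subseteq> D \<union> D\<inverse> \<union> C"
    and sv: "single_valued D" "single_valued (D\<inverse>)" "single_valued C" "single_valued (C\<inverse>)"
  shows "vertex_degree (with_proj G) v \<le> 6"
proof -
  have "(parcs G)\<inverse> \<subseteq> D \<union> D\<inverse> \<union> C\<inverse>" using arcs by blast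
  then have "card (parcs G `` {v}) \<le> 3" "card ((parcs G)\<inverse> `` {v}) \<le> 3"
    using arcs sv card_Image_digons_le(2) by metis+
  then show ?thesis
    by (simp add: vertex_degree_def out_degree_with_proj in_degree_with_proj)
qed

lemma vertex_degree_digons_eq:
  assumes arcs: "parcs G \<subseteq> D \<union> D\<inverse> \<union> C"
    and sv: "single_valued D" "single_valued (D\<inverse>)" "single_valued C" "single_valued (C\<inverse>)"
    and out: "{(v, w1), (v, w2), (v, w3)} \<subseteq> parcs G" "distinct [w1, w2, w3]"
    and inc: "{(u1, v), (u2, v), (u3, v)} \<subseteq> parcs G" "distinct [u1, u2, u3]"
  shows "vertex_degree (with_proj G) v = 6"
proof -
  have "(parcs G)\<inverse> \<subseteq> D \<union> D\<inverse> \<union> C\<inverse>" using arcs by blast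
  then have fin: "finite (parcs G `` {v})" "finite ((parcs G)\<inverse> `` {v})"
    using arcs sv card_Image_digons_le(1) by metis+
  have "card {w1, w2, w3} \<le> card (parcs G `` {v})" "card {u1, u2, u3} \<le> card ((parcs G)\<inverse> `` {v})"
    by (rule card_mono; use fin out(1) inc(1) in auto)+
  then have "vertex_degree (with_proj G) v \<ge> 6"
    using out inc by (simp add: vertex_degree_def out_degree_with_proj in_degree_with_proj)
  with vertex_degree_digons_le[OF arcs sv, of v] show ?thesis by simp
qed

section \<open>The digraph of a sequence of cells\<close>

definition path_len :: "nat \<Rightarrow> nat" where
  "path_len m = 2 * 2 ^ (4 * m)"

definition cell_size :: "nat \<Rightarrow> nat" where
  "cell_size m = 4 * m * path_len m"

text \<open>
  A cell has \<open>4 m\<close> Boolean variables, \<open>m\<close> for each of its sides left, right, bottom, top;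
  \<open>vertex m s b j\<close> is the \<open>j\<close>-th vertex on the path of digons of variable \<open>b\<close> of cell \<open>s\<close>.
\<close>

definition vertex :: "nat \<Rightarrow> nat \<Rightarrow> nat \<Rightarrow> nat \<Rightarrow> nat" where
  "vertex m s b j = s * cell_size m + (b * path_len m + j)"

text \<open>
  Every assignment \<open>a\<close> owns two consecutive vertices of each path; since the colours alternate
  along the path, the parity of the chosen one tells whether the variable agrees with \<open>a\<close>.
\<close>

definition clause_pos :: "nat \<Rightarrow> nat \<Rightarrow> nat" where
  "clause_pos a b = 2 * a + of_bool (bit a b)"

definition digons :: "nat \<Rightarrow> nat \<Rightarrow> nat rel" where
  "digons m W =
    {(vertex m s b j, vertex m s b (Suc j)) | s b j. b < 4 * m \<and> Suc j < path_len m} \<union>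
    {(vertex m s (m + i) (path_len m - 1), vertex m (s + 1) i 0) | s i. i < m} \<union>
    {(vertex m s (3 * m + i) (path_len m - 1), vertex m (s + W) (2 * m + i) 0) | s i. i < m}"

definition clause_arcs :: "nat \<Rightarrow> ('c \<Rightarrow> (nat \<Rightarrow> bool) \<Rightarrow> bool) \<Rightarrow> 'c list \<Rightarrow> nat rel" where
  "clause_arcs m ok cs =
    {(vertex m s b (clause_pos a b), vertex m s b' (clause_pos a b')) | s a b b'.
      \<not> ok (cs ! s) (bit a) \<and> a < 2 ^ (4 * m) \<and> b < 4 * m \<and> b' = Suc b mod (4 * m)}"

definition grid_digraph ::
  "nat \<Rightarrow> ('c \<Rightarrow> (nat \<Rightarrow> bool) \<Rightarrow> bool) \<Rightarrow> nat \<Rightarrow> 'c list \<Rightarrow> nat pair_pre_digraph" where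
  "grid_digraph m ok W cs = (let V = {..<length cs * cell_size m} in
    \<lparr> pverts = V, parcs = Restr (digons m W \<union> (digons m W)\<inverse> \<union> clause_arcs m ok cs) V \<rparr>)"

lemma pverts_grid_digraph: "pverts (grid_digraph m ok W cs) = {..<length cs * cell_size m}"
  and parcs_grid_digraph: "parcs (grid_digraph m ok W cs) =
    Restr (digons m W \<union> (digons m W)\<inverse> \<union> clause_arcs m ok cs) {..<length cs * cell_size m}"
  by (simp_all add: grid_digraph_def Let_def)

lemma mult_add_less_mult:
  fixes i j k n :: nat
  assumes "i < n" "j < k"
  shows "i * k + j < n * k"
proof -
  have "i * k + j < Suc i * k" using assms(2) by simp
  also have "\<dots> \<le> n * k" using assms(1) by (intro mult_le_mono1) simp
  finally show ?thesis .
qed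

lemma mult_add_eq_iff:
  fixes i j k i' j' :: nat
  assumes "j < k" "j' < k"
  shows "i * k + j = i' * k + j' \<longleftrightarrow> i = i' \<and> j = j'"
proof
  assume eq: "i * k + j = i' * k + j'"
  show "i = i' \<and> j = j'"
    using arg_cong[OF eq, of "\<lambda>n. n div k"] arg_cong[OF eq, of "\<lambda>n. n mod k"] assms by simp
qed simp

lemma path_len_pos: "0 < path_len m"
  and odd_path_len_minus_1: "odd (path_len m - 1)"
  by (simp_all add: path_len_def)

lemma clause_pos_less: "a < 2 ^ (4 * m) \<Longrightarrow> clause_pos a b < path_len m"
  by (simp add: clause_pos_def path_len_def of_bool_def)

lemma clause_pos_eqD: "clause_pos a b = clause_pos a' b' \<Longrightarrow> a = a'"
  by (auto simp: clause_pos_def of_bool_def split: if_splits)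

lemma even_clause_pos: "even (clause_pos a b) \<longleftrightarrow> \<not> bit a b"
  by (simp add: clause_pos_def)

lemma vertex_offset_less: "b < 4 * m \<Longrightarrow> j < path_len m \<Longrightarrow> b * path_len m + j < cell_size m"
  unfolding cell_size_def by (rule mult_add_less_mult)

lemma vertex_eq_iff:
  assumes "b < 4 * m" "j < path_len m" "b' < 4 * m" "j' < path_len m"
  shows "vertex m s b j = vertex m s' b' j' \<longleftrightarrow> s = s' \<and> b = b' \<and> j = j'"
  using assms by (auto simp: vertex_def mult_add_eq_iff vertex_offset_less)

lemma vertex_less_iff:
  assumes "b < 4 * m" "j < path_len m"
  shows "vertex m s b j < S * cell_size m \<longleftrightarrow> s < S"
proof
  assume "vertex m s b j < S * cell_size m"
  then have "s * cell_size m < S * cell_size m" unfolding vertex_def by linarith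
  then show "s < S" by simp
qed (simp add: vertex_def mult_add_less_mult vertex_offset_less[OF assms])

lemma digons_pathI:
    "b < 4 * m \<Longrightarrow> Suc j < path_len m \<Longrightarrow> (vertex m s b j, vertex m s b (Suc j)) \<in> digons m W"
  and digons_rightI:
    "i < m \<Longrightarrow> (vertex m s (m + i) (path_len m - 1), vertex m (s + 1) i 0) \<in> digons m W"
  and digons_topI:
    "i < m \<Longrightarrow> (vertex m s (3 * m + i) (path_len m - 1), vertex m (s + W) (2 * m + i) 0) \<in> digons m W"
  unfolding digons_def by blast+

lemma clause_arcsI:
  "\<not> ok (cs ! s) (bit a) \<Longrightarrow> a < 2 ^ (4 * m) \<Longrightarrow> b < 4 * m \<Longrightarrow>
    (vertex m s b (clause_pos a b),
      vertex m s (Suc b mod (4 * m)) (clause_pos a (Suc b mod (4 * m)))) \<in> clause_arcs m ok cs"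
  unfolding clause_arcs_def by blast

lemma digonsE:
  assumes "(v, w) \<in> digons m W"
  obtains (path) s b j where "b < 4 * m" "Suc j < path_len m"
      "v = vertex m s b j" "w = vertex m s b (Suc j)"
    | (right) s i where "i < m" "v = vertex m s (m + i) (path_len m - 1)" "w = vertex m (s + 1) i 0"
    | (top) s i where "i < m" "v = vertex m s (3 * m + i) (path_len m - 1)"
      "w = vertex m (s + W) (2 * m + i) 0"
  using assms by (auto simp: digons_def)

lemma clause_arcsE:
  assumes "(v, w) \<in> clause_arcs m ok cs"
  obtains s a b where "\<not> ok (cs ! s) (bit a)" "a < 2 ^ (4 * m)" "b < 4 * m"
    "v = vertex m s b (clause_pos a b)"
    "w = vertex m s (Suc b mod (4 * m)) (clause_pos a (Suc b mod (4 * m)))"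
  using assms by (auto simp: clause_arcs_def)

lemma single_valued_digons: "single_valued (digons m W)" "single_valued ((digons m W)\<inverse>)"
proof -
  have L: "0 < path_len m" "path_len m - 1 < path_len m" using path_len_pos by auto
  show "single_valued (digons m W)"
  proof (rule single_valuedI)
    fix v w w' assume "(v, w) \<in> digons m W" "(v, w') \<in> digons m W"
    then show "w = w'"
      using L by (elim digonsE) (auto simp: vertex_eq_iff)
  qed
  show "single_valued ((digons m W)\<inverse>)"
  proof (rule single_valuedI)
    fix v w w' assume "(v, w) \<in> (digons m W)\<inverse>" "(v, w') \<in> (digons m W)\<inverse>"
    then have "(w, v) \<in> digons m W" "(w', v) \<in> digons m W" by simp_all
    then show "w = w'"
      using L by (elim digonsE) (auto simp: vertex_eq_iff)
  qed
qed

lemma Suc_mod_eq_iff: "x < n \<Longrightarrow> y < n \<Longrightarrow> Suc x mod n = Suc y mod n \<longleftrightarrow> x = y"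
  by (cases "Suc x = n"; cases "Suc y = n") auto

lemma single_valued_clause_arcs:
  "single_valued (clause_arcs m ok cs)" "single_valued ((clause_arcs m ok cs)\<inverse>)"
proof -
  have less: "Suc b mod (4 * m) < 4 * m" if "b < 4 * m" for b using that by simp
  show "single_valued (clause_arcs m ok cs)"
  proof (rule single_valuedI)
    fix v w w' assume "(v, w) \<in> clause_arcs m ok cs" "(v, w') \<in> clause_arcs m ok cs"
    then show "w = w'"
      by (elim clause_arcsE) (auto simp: vertex_eq_iff clause_pos_less dest: clause_pos_eqD)
  qed
  show "single_valued ((clause_arcs m ok cs)\<inverse>)"
  proof (rule single_valuedI)
    fix v w w' assume "(v, w) \<in> (clause_arcs m ok cs)\<inverse>" "(v, w') \<in> (clause_arcs m ok cs)\<inverse>"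
    then have "(w, v) \<in> clause_arcs m ok cs" "(w', v) \<in> clause_arcs m ok cs" by simp_all
    then show "w = w'"
      using less
      by (elim clause_arcsE)
        (auto simp: vertex_eq_iff clause_pos_less Suc_mod_eq_iff simp del: mod_less_divisor
          dest: clause_pos_eqD)
  qed
qed

text \<open>
  The assumption on the assignment \<open>1\<close>, in which exactly variable \<open>0\<close> is true, makes sure that
  some vertex has degree \<open>6\<close>.
\<close>

locale grid =
  fixes m :: nat and ok :: "'c \<Rightarrow> (nat \<Rightarrow> bool) \<Rightarrow> bool" and W :: nat and cs :: "'c list"
  assumes m_pos: "m > 0" and W_ge: "W \<ge> 2" and cs_nonempty: "cs \<noteq> []"
    and ok_cong: "\<And>c y z. (\<And>b. b < 4 * m \<Longrightarrow> y b = z b) \<Longrightarrow> ok c y \<Longrightarrow> ok c z"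
    and ok_complement: "\<And>c y. ok c y \<Longrightarrow> ok c (\<lambda>b. \<not> y b)"
    and not_ok_1: "\<And>c. \<not> ok c (bit (1 :: nat))"
begin

abbreviation "L \<equiv> path_len m"
abbreviation "S \<equiv> length cs"
abbreviation "V \<equiv> {..<S * cell_size m}"
abbreviation "D \<equiv> digons m W"
abbreviation "C \<equiv> clause_arcs m ok cs"
abbreviation "G \<equiv> grid_digraph m ok W cs"

lemma path_len_ge: "L \<ge> 8"
proof -
  have "(2::nat) ^ 4 \<le> 2 ^ (4 * m)" using m_pos by (intro power_increasing) auto
  then show ?thesis by (simp add: path_len_def)
qed

lemma digons_irrefl: "(v, v) \<notin> D"
  using path_len_pos[of m] W_ge by (auto elim!: digonsE simp: vertex_eq_iff)

lemma clause_arcs_irrefl: "(v, v) \<notin> C"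
proof
  assume "(v, v) \<in> C"
  then obtain s a b where "a < 2 ^ (4 * m)" "b < 4 * m" "v = vertex m s b (clause_pos a b)"
    "v = vertex m s (Suc b mod (4 * m)) (clause_pos a (Suc b mod (4 * m)))"
    by (elim clause_arcsE) metis
  moreover from this have "b = Suc b mod (4 * m)"
    using m_pos by (simp add: vertex_eq_iff clause_pos_less)
  ultimately show False using m_pos by (cases "Suc b = 4 * m") auto
qed

lemma pair_digraph_G: "pair_digraph G"
proof
  show "fst e \<in> pverts G" "snd e \<in> pverts G" if "e \<in> parcs G" for e
    using that by (auto simp: parcs_grid_digraph pverts_grid_digraph)
  show "finite (pverts G)" by (simp add: pverts_grid_digraph)
  show "finite (parcs G)"
    by (rule finite_subset[of _ "V \<times> V"]) (auto simp: parcs_grid_digraph)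
  show "fst e \<noteq> snd e" if "e \<in> parcs G" for e
    using that digons_irrefl clause_arcs_irrefl by (cases e) (auto simp: parcs_grid_digraph)
qed

lemma input_digraph_G: "G \<in> input_digraphs"
  using pair_digraph_G by (auto simp: input_digraphs_def pverts_grid_digraph)

lemma vertex_degree_G_eq_6: "vertex_degree (with_proj G) (vertex m 0 1 2) = 6"
proof (rule vertex_degree_digons_eq[OF _ single_valued_digons single_valued_clause_arcs])
  have less: "0 < S" "(1::nat) < 4 * m" "2 < 4 * m" "0 < 4 * m" "1 < L" "2 < L" "3 < L"
    using m_pos cs_nonempty path_len_ge by auto
  have "(vertex m 0 1 1, vertex m 0 1 2) \<in> D" "(vertex m 0 1 2, vertex m 0 1 3) \<in> D"
    using digons_pathI[of 1 m 1] digons_pathI[of 1 m 2] less by (simp_all add: numeral_eq_Suc)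
  moreover have "(vertex m 0 0 3, vertex m 0 1 2) \<in> C" "(vertex m 0 1 2, vertex m 0 2 2) \<in> C"
  proof -
    have "clause_pos 1 0 = 3" "clause_pos 1 1 = 2" "clause_pos 1 2 = 2"
      by (simp_all add: clause_pos_def bit_1_iff del: One_nat_def)
    moreover have "(1 :: nat) < 2 ^ (4 * m)" using m_pos by (intro one_less_power) auto
    moreover have "Suc 0 mod (4 * m) = 1" "Suc 1 mod (4 * m) = 2" using less by auto
    ultimately show "(vertex m 0 0 3, vertex m 0 1 2) \<in> C" "(vertex m 0 1 2, vertex m 0 2 2) \<in> C"
      using clause_arcsI[of ok cs 0 1 m 0] clause_arcsI[of ok cs 0 1 m 1] not_ok_1 less
      by (simp_all only: not_False_eq_True)
  qed
  ultimately show "{(vertex m 0 1 2, vertex m 0 1 1), (vertex m 0 1 2, vertex m 0 1 3),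
      (vertex m 0 1 2, vertex m 0 2 2)} \<subseteq> parcs G"
    "{(vertex m 0 1 1, vertex m 0 1 2), (vertex m 0 1 3, vertex m 0 1 2),
      (vertex m 0 0 3, vertex m 0 1 2)} \<subseteq> parcs G"
    using less by (simp_all add: parcs_grid_digraph vertex_less_iff)
  show "distinct [vertex m 0 1 1, vertex m 0 1 3, vertex m 0 2 2]"
    "distinct [vertex m 0 1 1, vertex m 0 1 3, vertex m 0 0 3]"
    using less by (simp_all add: vertex_eq_iff)
qed (auto simp: parcs_grid_digraph)

lemma max_degree_G: "max_degree (with_proj G) = 6"
  unfolding max_degree_def
proof (rule Max_eqI)
  show "finite (insert 0 (vertex_degree (with_proj G) ` verts (with_proj G)))"
    by (simp add: pverts_grid_digraph)
  show "d \<le> 6" if "d \<in> insert 0 (vertex_degree (with_proj G) ` verts (with_proj G))" for d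
    using that vertex_degree_digons_le[OF _ single_valued_digons single_valued_clause_arcs,
      of G m W m ok cs]
    by (auto simp: parcs_grid_digraph)
  have "vertex m 0 1 2 \<in> verts (with_proj G)"
    using m_pos cs_nonempty path_len_ge by (simp add: pverts_grid_digraph vertex_less_iff)
  then show "6 \<in> insert 0 (vertex_degree (with_proj G) ` verts (with_proj G))"
    using vertex_degree_G_eq_6 by (metis imageI insertI2)
qed

definition sides_match :: "(nat \<Rightarrow> nat \<Rightarrow> bool) \<Rightarrow> bool" where
  "sides_match x \<longleftrightarrow> (\<forall>i < m.
    (\<forall>s. s + 1 < S \<longrightarrow> x s (m + i) = x (s + 1) i) \<and>
    (\<forall>s. s + W < S \<longrightarrow> x s (3 * m + i) = x (s + W) (2 * m + i)))"

definition alternates :: "(nat \<Rightarrow> nat \<Rightarrow> bool) \<Rightarrow> (nat \<Rightarrow> bool) \<Rightarrow> bool" where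
  "alternates x col \<longleftrightarrow>
    (\<forall>s < S. \<forall>b < 4 * m. \<forall>j < L. col (vertex m s b j) = (x s b \<noteq> odd j))"

lemma exists_alternating: "\<exists>col. alternates x col"
proof -
  define col where "col v =
    (let k = v mod cell_size m in x (v div cell_size m) (k div L) \<noteq> odd (k mod L))" for v
  have "col (vertex m s b j) = (x s b \<noteq> odd j)" if "b < 4 * m" "j < L" for s b j
    using that vertex_offset_less[OF that] by (simp add: col_def vertex_def Let_def)
  then show ?thesis unfolding alternates_def by blast
qed

lemma last_position: "0 < L" "L - 1 < L" "odd (L - 1)"
  using path_len_pos odd_path_len_minus_1 by simp_all

lemma bichromatic_if_alternates:
  assumes x: "alternates x col" "sides_match x"
  shows "bichromatic col (Restr D V)"
  unfolding bichromatic_def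
proof (intro allI impI)
  fix v w assume "(v, w) \<in> Restr D V"
  then have "(v, w) \<in> D" and V: "v \<in> V" "w \<in> V" by simp_all
  from this(1) show "col v \<noteq> col w"
    using x last_position V
    by (cases rule: digonsE) (simp_all add: alternates_def sides_match_def vertex_less_iff)
qed

lemma alternates_if_bichromatic:
  assumes bichromatic: "bichromatic col (Restr D V)"
  defines "x \<equiv> \<lambda>s b. col (vertex m s b 0)"
  shows "alternates x col"
  unfolding alternates_def
proof (intro allI impI)
  fix s b j assume s: "s < S" and b: "b < 4 * m" and "j < L"
  from this(3) show "col (vertex m s b j) = (x s b \<noteq> odd j)"
  proof (induction j)
    case 0
    then show ?case by (simp add: x_def)
  next
    case (Suc j)
    then have "(vertex m s b j, vertex m s b (Suc j)) \<in> Restr D V"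
      using s b by (simp add: digons_pathI vertex_less_iff)
    then have "col (vertex m s b j) \<noteq> col (vertex m s b (Suc j))"
      using bichromatic by (rule bichromaticD[rotated])
    then show ?case using Suc by auto
  qed
qed

lemma sides_match_if_bichromatic:
  assumes bichromatic: "bichromatic col (Restr D V)" and x: "alternates x col"
  shows "sides_match x"
  unfolding sides_match_def
proof (intro allI impI conjI)
  fix i s assume "i < m" "s + 1 < S"
  then have "col (vertex m s (m + i) (L - 1)) \<noteq> col (vertex m (s + 1) i 0)"
    using digons_rightI[of i m s W] last_position
    by (intro bichromaticD[OF bichromatic]) (simp add: vertex_less_iff)
  then show "x s (m + i) = x (s + 1) i"
    using x last_position \<open>i < m\<close> \<open>s + 1 < S\<close> by (simp add: alternates_def)
next
  fix i s assume "i < m" "s + W < S"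
  then have "col (vertex m s (3 * m + i) (L - 1)) \<noteq> col (vertex m (s + W) (2 * m + i) 0)"
    using digons_topI[of i m s W] last_position
    by (intro bichromaticD[OF bichromatic]) (simp add: vertex_less_iff)
  then show "x s (3 * m + i) = x (s + W) (2 * m + i)"
    using x last_position \<open>i < m\<close> \<open>s + W < S\<close> by (simp add: alternates_def)
qed

lemma bichromatic_digons_iff:
  "bichromatic col (Restr D V) \<longleftrightarrow> (\<exists>x. alternates x col \<and> sides_match x)"
  using bichromatic_if_alternates alternates_if_bichromatic sides_match_if_bichromatic by blast

lemma monochromatic_clause_cycle:
  assumes x: "alternates x col" and s: "s < S" and bad: "\<not> ok (cs ! s) (x s)"
  shows "\<not> acyclic (monochromatic col (Restr C V))"
proof (rule not_acyclicI)
  define a :: nat where "a = horner_sum of_bool 2 (map (x s) [0..<4 * m])"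
  have bit_a: "bit a b = x s b" if "b < 4 * m" for b
    using that by (simp add: a_def bit_horner_sum_bit_iff)
  have a: "a < 2 ^ (4 * m)"
    unfolding a_def using horner_sum_of_bool_2_less[of "map (x s) [0..<4 * m]"] by simp
  have bad_a: "\<not> ok (cs ! s) (bit a)"
    using bad ok_cong[of "bit a" "x s"] bit_a by blast
  show "0 < 4 * m" using m_pos by simp
  fix b assume b: "b < 4 * m"
  let ?f = "\<lambda>b. vertex m s b (clause_pos a b)"
  have next_b: "Suc b mod (4 * m) < 4 * m" using m_pos by simp
  have "(?f b, ?f (Suc b mod (4 * m))) \<in> C"
    using bad_a a b by (rule clause_arcsI)
  moreover have "\<not> col (?f b)" if "b < 4 * m" for b
    using x s that a bit_a by (simp add: alternates_def clause_pos_less even_clause_pos)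
  ultimately show "(?f b, ?f (Suc b mod (4 * m))) \<in> monochromatic col (Restr C V)"
    using b next_b s a
    by (simp add: monochromatic_def vertex_less_iff clause_pos_less del: mod_less_divisor)
qed

lemma closed_clause_arcs_contain_cycle:
  assumes closed: "\<And>v. v \<in> X \<Longrightarrow> \<exists>w \<in> X. (v, w) \<in> monochromatic col (Restr C V)" and "X \<noteq> {}"
  obtains s a e where "s < S" "\<not> ok (cs ! s) (bit a)" "a < 2 ^ (4 * m)"
    "\<And>b. b < 4 * m \<Longrightarrow> col (vertex m s b (clause_pos a b)) = e"
proof -
  obtain v w where "v \<in> X" "(v, w) \<in> C" "v \<in> V"
    using closed \<open>X \<noteq> {}\<close> by (fastforce simp: monochromatic_def)
  moreover from this(2) obtain s a b where a: "\<not> ok (cs ! s) (bit a)" "a < 2 ^ (4 * m)"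
    and b: "b < 4 * m" "v = vertex m s b (clause_pos a b)" by (auto elim: clause_arcsE)
  ultimately have s: "s < S" by (simp add: vertex_less_iff clause_pos_less)
  have orbit: "let w = vertex m s ((b + i) mod (4 * m)) (clause_pos a ((b + i) mod (4 * m)))
      in w \<in> X \<and> col w = col v" for i
  proof (induction i)
    case 0
    then show ?case using \<open>v \<in> X\<close> b by simp
  next
    case (Suc i)
    let ?w = "\<lambda>i. vertex m s ((b + i) mod (4 * m)) (clause_pos a ((b + i) mod (4 * m)))"
    obtain u where u: "u \<in> X" "(?w i, u) \<in> C" "col (?w i) = col u"
      using closed[of "?w i"] Suc by (auto simp: monochromatic_def Let_def)
    have "(?w i, ?w (Suc i)) \<in> C"
      using clause_arcsI[where ok = ok, OF a, of "(b + i) mod (4 * m)"] m_pos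
      by (simp add: mod_Suc_eq)
    then have "u = ?w (Suc i)"
      using u(2) single_valued_clause_arcs(1) by (metis single_valuedD)
    then show ?case using u Suc by (simp add: Let_def)
  qed
  show thesis
  proof (rule that[OF s a])
    fix b' assume "b' < 4 * m"
    then have "(b + (b' + (4 * m - b))) mod (4 * m) = b'" using b by simp
    then show "col (vertex m s b' (clause_pos a b')) = col v"
      using orbit[of "b' + (4 * m - b)"] by (simp add: Let_def)
  qed
qed

lemma acyclic_clause_arcs_iff:
  assumes x: "alternates x col"
  shows "acyclic (monochromatic col (Restr C V)) \<longleftrightarrow> (\<forall>s < S. ok (cs ! s) (x s))"
proof
  assume "acyclic (monochromatic col (Restr C V))"
  then show "\<forall>s < S. ok (cs ! s) (x s)" using monochromatic_clause_cycle[OF x] by blast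
next
  assume ok: "\<forall>s < S. ok (cs ! s) (x s)"
  show "acyclic (monochromatic col (Restr C V))"
  proof (rule ccontr)
    assume "\<not> acyclic (monochromatic col (Restr C V))"
    then obtain X where "X \<noteq> {}" "\<And>v. v \<in> X \<Longrightarrow> \<exists>w \<in> X. (v, w) \<in> monochromatic col (Restr C V)"
      by (elim not_acyclicE) blast
    then obtain s a e where s: "s < S" and a: "\<not> ok (cs ! s) (bit a)" "a < 2 ^ (4 * m)"
      and col: "\<And>b. b < 4 * m \<Longrightarrow> col (vertex m s b (clause_pos a b)) = e"
      using closed_clause_arcs_contain_cycle by metis
    have bit_a: "(if e then \<not> x s b else x s b) = bit a b" if "b < 4 * m" for b
      using x s a(2) that col[OF that]
      by (auto simp: alternates_def clause_pos_less even_clause_pos)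
    have "ok (cs ! s) (\<lambda>b. if e then \<not> x s b else x s b)"
      using ok s ok_complement by (cases e) simp_all
    then have "ok (cs ! s) (bit a)" by (rule ok_cong[rotated]) (rule bit_a)
    with a(1) show False ..
  qed
qed

theorem colorable_2_grid_digraph_iff:
  "colorable 2 (with_proj G) \<longleftrightarrow> (\<exists>x. sides_match x \<and> (\<forall>s < S. ok (cs ! s) (x s)))"
proof -
  interpret pair_digraph G by (rule pair_digraph_G)
  have "colorable 2 (with_proj G) \<longleftrightarrow> (\<exists>col :: nat \<Rightarrow> bool.
      bichromatic col (Restr D V) \<and> acyclic (monochromatic col (Restr C V)))"
    unfolding colorable_2_iff acyclic_monochromatic_digons_iff[OF parcs_grid_digraph] ..
  also have "\<dots> \<longleftrightarrow> (\<exists>x. sides_match x \<and> (\<forall>s < S. ok (cs ! s) (x s)))"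
    unfolding bichromatic_digons_iff
    using exists_alternating acyclic_clause_arcs_iff by blast
  finally show ?thesis .
qed

end

section \<open>Tilings of a sequence of cells\<close>

definition is_tiling ::
  "('c \<Rightarrow> 'h \<Rightarrow> 'h \<Rightarrow> 'v \<Rightarrow> 'v \<Rightarrow> bool) \<Rightarrow> nat \<Rightarrow> 'c list \<Rightarrow> (nat \<Rightarrow> 'h) \<Rightarrow> (nat \<Rightarrow> 'v) \<Rightarrow> bool" where
  "is_tiling T W cs E U \<longleftrightarrow>
    (\<forall>s < length cs. T (cs ! s) (E s) (E (s + 1)) (U s) (U (s + W)))"

lemma exists_tilingI:
  assumes tile: "\<And>s. s < length cs \<Longrightarrow> T (cs ! s) (l s) (r s) (d s) (u s)"
    and right: "\<And>s. s + 1 < length cs \<Longrightarrow> r s = l (s + 1)"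
    and top: "\<And>s. s + W < length cs \<Longrightarrow> u s = d (s + W)"
  shows "\<exists>E U. is_tiling T W cs E U"
proof -
  define E where "E s = (if s < length cs then l s else r (s - 1))" for s
  define U where "U s = (if s < length cs then d s else u (s - W))" for s
  have "T (cs ! s) (E s) (E (s + 1)) (U s) (U (s + W))" if "s < length cs" for s
  proof -
    have "E s = l s" "E (s + 1) = r s" "U s = d s" "U (s + W) = u s"
      using that right[of s] top[of s] by (auto simp: E_def U_def)
    then show ?thesis using tile[OF that] by simp
  qed
  then show ?thesis unfolding is_tiling_def by blast
qed

text \<open>
  Bit \<open>0\<close> of every word \<open>2 * k\<close> is 0, so it tells the reference colour \<open>e\<close>; complementing
  all bits of a cell by \<open>e\<close> accounts for the symmetry between the two colours.
\<close>

definition encodes :: "nat \<Rightarrow> bool \<Rightarrow> nat \<Rightarrow> (nat \<Rightarrow> bool) \<Rightarrow> bool" where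
  "encodes m e k y \<longleftrightarrow> (\<forall>i < m. y i = (bit (2 * k) i \<noteq> e))"

lemma encodes_cong: "(\<And>i. i < m \<Longrightarrow> y i = z i) \<Longrightarrow> encodes m e k y \<longleftrightarrow> encodes m e k z"
  by (auto simp: encodes_def)

lemma encodes_complement: "encodes m e k y \<Longrightarrow> encodes m (\<not> e) k (\<lambda>i. \<not> y i)"
  by (auto simp: encodes_def)

lemma encodes_0: "encodes m e k y \<Longrightarrow> 0 < m \<Longrightarrow> y 0 = e"
  by (auto simp: encodes_def bit_0)

lemma encodes_code_eq:
  assumes "encodes m e k y" "encodes m e k' z" and "\<And>i. i < m \<Longrightarrow> y i = z i"
    and "2 * k < 2 ^ m" "2 * k' < 2 ^ m"
  shows "k = k'"
proof -
  have "bit (2 * k) i = bit (2 * k') i" if "i < m" for i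
    using assms(1-3) that by (auto simp: encodes_def)
  then have "take_bit m (2 * k) = take_bit m (2 * k')"
    by (intro bit_eqI) (auto simp: bit_take_bit_iff)
  then show ?thesis using assms(4,5) by (simp add: take_bit_nat_eq_self)
qed

definition tile_bits ::
  "('c \<Rightarrow> 'h::countable \<Rightarrow> 'h \<Rightarrow> 'v::countable \<Rightarrow> 'v \<Rightarrow> bool) \<Rightarrow> nat \<Rightarrow> 'c \<Rightarrow> (nat \<Rightarrow> bool) \<Rightarrow> bool"
where
  "tile_bits T m c y \<longleftrightarrow> (\<exists>e l r d u. T c l r d u \<and>
    encodes m e (to_nat l) y \<and> encodes m e (to_nat r) (\<lambda>i. y (m + i)) \<and>
    encodes m e (to_nat d) (\<lambda>i. y (2 * m + i)) \<and> encodes m e (to_nat u) (\<lambda>i. y (3 * m + i)))"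

lemma tile_bits_cong:
  assumes "\<And>b. b < 4 * m \<Longrightarrow> y b = z b"
  shows "tile_bits T m c y \<longleftrightarrow> tile_bits T m c z"
proof -
  have "encodes m e k (\<lambda>i. y (n * m + i)) \<longleftrightarrow> encodes m e k (\<lambda>i. z (n * m + i))" if "n < 4" for e k n
  proof (rule encodes_cong)
    fix i assume "i < m"
    then show "y (n * m + i) = z (n * m + i)" using that by (intro assms mult_add_less_mult)
  qed
  from this[of 0] this[of 1] this[of 2] this[of 3] show ?thesis
    unfolding tile_bits_def by simp
qed

lemma tile_bits_complement:
  assumes "tile_bits T m c y"
  shows "tile_bits T m c (\<lambda>b. \<not> y b)"
  using assms encodes_complement unfolding tile_bits_def by blast

lemma not_tile_bits_1:
  assumes "0 < m"
  shows "\<not> tile_bits T m c (bit (1 :: nat))"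
proof
  assume "tile_bits T m c (bit (1 :: nat))"
  then obtain e k k' where "encodes m e k (bit (1 :: nat))"
    "encodes m e k' (\<lambda>i. bit (1 :: nat) (m + i))"
    unfolding tile_bits_def by blast
  then have "bit (1 :: nat) 0 = e" "bit (1 :: nat) m = e"
    using encodes_0 assms by fastforce+
  then show False using assms by (simp add: bit_1_iff del: One_nat_def)
qed

lemma grid_tile_bits:
  assumes "0 < m" "2 \<le> W" "cs \<noteq> []"
  shows "grid m (tile_bits T m) W cs"
proof
  show "tile_bits T m c z" if "\<And>b. b < 4 * m \<Longrightarrow> y b = z b" "tile_bits T m c y" for c y z
    using tile_bits_cong[of m y z T c] that by simp
qed (use assms tile_bits_complement not_tile_bits_1 in simp_all)

lemma tile_bitsE:
  assumes "tile_bits T m c y" "0 < m"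
  obtains l r d u where "T c l r d u" "y m = y 0"
    "encodes m (y 0) (to_nat l) y" "encodes m (y 0) (to_nat r) (\<lambda>i. y (m + i))"
    "encodes m (y 0) (to_nat d) (\<lambda>i. y (2 * m + i))"
    "encodes m (y 0) (to_nat u) (\<lambda>i. y (3 * m + i))"
proof -
  obtain e l r d u where tile: "T c l r d u" "encodes m e (to_nat l) y"
    "encodes m e (to_nat r) (\<lambda>i. y (m + i))" "encodes m e (to_nat d) (\<lambda>i. y (2 * m + i))"
    "encodes m e (to_nat u) (\<lambda>i. y (3 * m + i))"
    using assms(1) unfolding tile_bits_def by blast
  have "e = y 0" "y m = e" using encodes_0[OF tile(2)] encodes_0[OF tile(3)] assms(2) by simp_all
  then show thesis using tile by (intro that) simp_all
qed

locale tile_encoding =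
  fixes T :: "'c \<Rightarrow> 'h::countable \<Rightarrow> 'h \<Rightarrow> 'v::countable \<Rightarrow> 'v \<Rightarrow> bool" and m :: nat
  assumes m_pos: "0 < m"
    and code_less: "T c l r d u \<Longrightarrow> 2 * to_nat l < 2 ^ m \<and> 2 * to_nat r < 2 ^ m \<and>
      2 * to_nat d < 2 ^ m \<and> 2 * to_nat u < 2 ^ m"
begin

lemma sides_match_if_tiling:
  assumes W: "2 \<le> W" "cs \<noteq> []" and tiling: "is_tiling T W cs E U"
  shows "\<exists>x. grid.sides_match m W cs x \<and> (\<forall>s < length cs. tile_bits T m (cs ! s) (x s))"
proof -
  interpret grid m "tile_bits T m" W cs using m_pos W by (rule grid_tile_bits)
  define x where "x s b = (if b < m then bit (2 * to_nat (E s)) b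
    else if b < 2 * m then bit (2 * to_nat (E (s + 1))) (b - m)
    else if b < 3 * m then bit (2 * to_nat (U s)) (b - 2 * m)
    else bit (2 * to_nat (U (s + W))) (b - 3 * m))" for s b
  have "encodes m False (to_nat (E s)) (x s)"
    "encodes m False (to_nat (E (s + 1))) (\<lambda>i. x s (m + i))"
    "encodes m False (to_nat (U s)) (\<lambda>i. x s (2 * m + i))"
    "encodes m False (to_nat (U (s + W))) (\<lambda>i. x s (3 * m + i))" for s
    by (auto simp: encodes_def x_def)
  then have "tile_bits T m (cs ! s) (x s)" if "s < length cs" for s
    using tiling that unfolding is_tiling_def tile_bits_def by blast
  moreover have "sides_match x" by (auto simp: sides_match_def x_def)
  ultimately show ?thesis by blast
qed

lemma reference_colour_const:
  assumes W: "2 \<le> W" "cs \<noteq> []"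
    and match: "grid.sides_match m W cs x" and bits: "\<forall>s < length cs. tile_bits T m (cs ! s) (x s)"
  shows "s < length cs \<Longrightarrow> x s 0 = x 0 0"
proof (induction s)
  case (Suc s)
  interpret grid m "tile_bits T m" W cs using m_pos W by (rule grid_tile_bits)
  have "x (Suc s) 0 = x s m"
    using match Suc.prems m_pos by (force simp: sides_match_def)
  moreover have "tile_bits T m (cs ! s) (x s)" using bits Suc.prems by simp
  then have "x s m = x s 0" using m_pos by (rule tile_bitsE)
  ultimately show ?case using Suc by simp
qed simp

lemma tiling_if_sides_match:
  assumes W: "2 \<le> W" "cs \<noteq> []"
    and match: "grid.sides_match m W cs x" and bits: "\<forall>s < length cs. tile_bits T m (cs ! s) (x s)"
  shows "\<exists>E U. is_tiling T W cs E U"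
proof -
  interpret grid m "tile_bits T m" W cs using m_pos W by (rule grid_tile_bits)
  define e where "e = x 0 0"
  have "\<exists>l r d u. T (cs ! s) l r d u \<and> encodes m e (to_nat l) (x s) \<and>
      encodes m e (to_nat r) (\<lambda>i. x s (m + i)) \<and> encodes m e (to_nat d) (\<lambda>i. x s (2 * m + i)) \<and>
      encodes m e (to_nat u) (\<lambda>i. x s (3 * m + i))" if "s < length cs" for s
  proof -
    have "tile_bits T m (cs ! s) (x s)" using bits that by simp
    then show ?thesis
      unfolding e_def reference_colour_const[OF W match bits that, symmetric]
      using m_pos by (elim tile_bitsE) blast+
  qed
  then obtain l r d u where tile: "T (cs ! s) (l s) (r s) (d s) (u s)"
    and enc: "encodes m e (to_nat (l s)) (x s)" "encodes m e (to_nat (r s)) (\<lambda>i. x s (m + i))"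
      "encodes m e (to_nat (d s)) (\<lambda>i. x s (2 * m + i))"
      "encodes m e (to_nat (u s)) (\<lambda>i. x s (3 * m + i))" if "s < length cs" for s
    by metis
  note short = code_less[OF tile]
  show ?thesis
  proof (rule exists_tilingI[where T = T and l = l and r = r and d = d and u = u])
    show "T (cs ! s) (l s) (r s) (d s) (u s)" if "s < length cs" for s using that by (rule tile)
  next
    fix s assume s: "s + 1 < length cs"
    then have "x s (m + i) = x (s + 1) i" if "i < m" for i
      using match that by (simp add: sides_match_def)
    then have "to_nat (r s) = to_nat (l (s + 1))"
      using s short[of s] short[of "s + 1"]
      by (intro encodes_code_eq[OF enc(2)[of s] enc(1)[of "s + 1"]]) simp_all
    then show "r s = l (s + 1)" by simp
  next
    fix s assume s: "s + W < length cs"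
    then have "x s (3 * m + i) = x (s + W) (2 * m + i)" if "i < m" for i
      using match that by (simp add: sides_match_def)
    then have "to_nat (u s) = to_nat (d (s + W))"
      using s short[of s] short[of "s + W"]
      by (intro encodes_code_eq[OF enc(4)[of s] enc(3)[of "s + W"]]) simp_all
    then show "u s = d (s + W)" by simp
  qed
qed

theorem colorable_2_iff_tiling:
  assumes "2 \<le> W" "cs \<noteq> []"
  shows "colorable 2 (with_proj (grid_digraph m (tile_bits T m) W cs)) \<longleftrightarrow>
    (\<exists>E U. is_tiling T W cs E U)"
  unfolding grid.colorable_2_grid_digraph_iff[OF grid_tile_bits[OF m_pos assms]]
  using sides_match_if_tiling[OF assms] tiling_if_sides_match[OF assms] by blast

end

lemma exists_code_length:
  fixes A :: "nat set"
  assumes "finite A"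
  obtains m where "0 < m" "\<And>k. k \<in> A \<Longrightarrow> 2 * k < 2 ^ m"
proof -
  obtain n where n: "\<And>k. k \<in> A \<Longrightarrow> k < n" using assms finite_nat_set_iff_bounded by metis
  show thesis
  proof (rule that[of "Suc n"])
    fix k assume "k \<in> A"
    then have "k < 2 ^ n" using n less_exp order.strict_trans by blast
    then show "2 * k < 2 ^ Suc n" by simp
  qed simp
qed

lemma exists_tile_encoding:
  fixes T :: "'c \<Rightarrow> 'h::countable \<Rightarrow> 'h \<Rightarrow> 'v::countable \<Rightarrow> 'v \<Rightarrow> bool"
  assumes "finite H" "finite Q"
    and tiles: "\<And>c l r d u. T c l r d u \<Longrightarrow> l \<in> H \<and> r \<in> H \<and> d \<in> Q \<and> u \<in> Q"
  shows "\<exists>m. tile_encoding T m"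
proof -
  have "finite (to_nat ` H \<union> to_nat ` Q)" using assms(1,2) by simp
  then obtain m where "0 < m" and m: "\<And>k. k \<in> to_nat ` H \<union> to_nat ` Q \<Longrightarrow> 2 * k < 2 ^ m"
    by (rule exists_code_length) blast
  have "tile_encoding T m"
  proof
    show "2 * to_nat l < 2 ^ m \<and> 2 * to_nat r < 2 ^ m \<and> 2 * to_nat d < 2 ^ m \<and> 2 * to_nat u < 2 ^ m"
      if "T c l r d u" for c l r d u
      using tiles[OF that] m by simp
  qed fact
  then show ?thesis ..
qed

section \<open>Runs of Turing machines\<close>

abbreviation scanned :: "config \<Rightarrow> nat list" where
  "scanned c \<equiv> map read_tape (snd c)"

definition accepts :: "tm \<Rightarrow> bool list \<Rightarrow> bool" where
  "accepts M x \<longleftrightarrow> (\<exists>c. (tm_step M)\<^sup>*\<^sup>* (tm_init M x) c \<and> tm_halted M c \<and> fst c = 1)"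

definition halts_before :: "tm \<Rightarrow> bool list \<Rightarrow> nat \<Rightarrow> bool" where
  "halts_before M x N \<longleftrightarrow> (\<forall>c t. (tm_step M ^^ t) (tm_init M x) c \<longrightarrow> t < N)"

lemma read_tape_eq: "read_tape tp = fst tp (snd tp)"
  by (cases tp) simp

lemma act_tape_eq: "act_tape a tp = ((fst tp)(snd tp := fst a), move_head (snd a) (snd tp))"
  by (cases tp; cases a) simp

lemma tm_halted_iff: "tm_halted M c \<longleftrightarrow> tm_trans M (fst c) (scanned c) = {}"
  by (auto simp: tm_halted_def tm_step_def)

lemma tm_stepI:
  "(q', acts) \<in> tm_trans M (fst c) (scanned c) \<Longrightarrow> tm_step M c (q', map2 act_tape acts (snd c))"
  by (auto simp: tm_step_def)

lemma tm_stepE: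
  assumes "tm_step M c c'"
  obtains q' acts where "(q', acts) \<in> tm_trans M (fst c) (scanned c)"
    "c' = (q', map2 act_tape acts (snd c))"
  using assms by (auto simp: tm_step_def)

definition valid_config :: "tm \<Rightarrow> config \<Rightarrow> bool" where
  "valid_config M c \<longleftrightarrow> fst c < tm_states M \<and> length (snd c) = tm_tapes M \<and>
    (\<forall>tp \<in> set (snd c). \<forall>i. fst tp i < tm_syms M)"

lemma valid_config_init: "tm_wf M \<Longrightarrow> valid_config M (tm_init M x)"
  by (auto simp: valid_config_def tm_init_def tm_wf_def contents_def set_replicate_conv_if)

lemma scanned_valid:
  "valid_config M c \<Longrightarrow> set (scanned c) \<subseteq> {..<tm_syms M} \<and> length (scanned c) = tm_tapes M"
  by (auto simp: valid_config_def read_tape_eq)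

lemma action_valid:
  assumes "tm_wf M" "valid_config M c" "(q', acts) \<in> tm_trans M (fst c) (scanned c)"
  shows "q' < tm_states M \<and> length acts = tm_tapes M \<and> fst ` set acts \<subseteq> {..<tm_syms M}"
proof -
  have "fst c < tm_states M" using assms(2) by (simp add: valid_config_def)
  then show ?thesis
    using assms scanned_valid[OF assms(2)] unfolding tm_wf_def by blast
qed

lemma tm_step_valid:
  assumes wf: "tm_wf M" and c: "valid_config M c" and step: "tm_step M c c'"
  shows "valid_config M c'"
proof -
  obtain q' acts where act: "(q', acts) \<in> tm_trans M (fst c) (scanned c)"
    and c': "c' = (q', map2 act_tape acts (snd c))"
    using step by (rule tm_stepE)
  note valid = action_valid[OF wf c act]
  have "fst tp i < tm_syms M" if tp: "tp \<in> set (snd c')" for tp i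
  proof -
    from tp obtain a tp' where a: "(a, tp') \<in> set (zip acts (snd c))" "tp = act_tape a tp'"
      by (auto simp: c')
    then have "a \<in> set acts" "tp' \<in> set (snd c)" by (auto dest: set_zip_leftD set_zip_rightD)
    then show ?thesis using valid c by (auto simp: a(2) act_tape_eq valid_config_def)
  qed
  then show ?thesis using valid c by (simp add: c' valid_config_def)
qed

lemma abs_move_head_le: "\<bar>move_head d i\<bar> \<le> \<bar>i\<bar> + 1"
  by (cases d) auto

lemma abs_head_le:
  "(tm_step M ^^ t) (tm_init M x) c \<Longrightarrow> tp \<in> set (snd c) \<Longrightarrow> \<bar>snd tp\<bar> \<le> int t"
proof (induction t arbitrary: c tp)
  case 0
  then show ?case by (auto simp: tm_init_def)
next
  case (Suc t)
  then obtain c0 where c0: "(tm_step M ^^ t) (tm_init M x) c0" "tm_step M c0 c" by auto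
  from c0(2) obtain q' acts where "c = (q', map2 act_tape acts (snd c0))" by (rule tm_stepE)
  then obtain a tp' where a: "(a, tp') \<in> set (zip acts (snd c0))" "tp = act_tape a tp'"
    using Suc.prems(2) by auto
  then have "\<bar>snd tp'\<bar> \<le> int t" using Suc.IH[OF c0(1)] set_zip_rightD by metis
  then show ?case using abs_move_head_le[of "snd a" "snd tp'"] by (simp add: a(2) act_tape_eq)
qed

definition keep :: "nat list \<Rightarrow> (nat \<times> move) list" where
  "keep ss = map (\<lambda>s. (s, Stay)) ss"

lemma length_keep [simp]: "length (keep ss) = length ss"
  by (simp add: keep_def)

lemma fst_set_keep [simp]: "fst ` set (keep ss) = set ss"
  by (simp add: keep_def image_image)

lemma map2_act_tape_keep [simp]: "map2 act_tape (keep (map read_tape ts)) ts = ts"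
  by (rule nth_equalityI) (auto simp: keep_def act_tape_eq read_tape_eq)

definition padded :: "tm \<Rightarrow> tm" where
  "padded M = M\<lparr>tm_trans := \<lambda>q ss.
    if q = 1 \<and> tm_trans M q ss = {} then {(1, keep ss)} else tm_trans M q ss\<rparr>"

lemma padded_simps [simp]:
  "tm_tapes (padded M) = tm_tapes M" "tm_syms (padded M) = tm_syms M"
  "tm_states (padded M) = tm_states M" "tm_init (padded M) = tm_init M"
  "valid_config (padded M) = valid_config M"
  by (auto simp: padded_def tm_init_def valid_config_def fun_eq_iff)

lemma tm_wf_padded: "tm_wf M \<Longrightarrow> tm_wf (padded M)"
  unfolding tm_wf_def by (auto simp: padded_def split: if_splits)

lemma tm_step_padded_iff:
  "tm_step (padded M) c c' \<longleftrightarrow> tm_step M c c' \<or> tm_halted M c \<and> fst c = 1 \<and> c' = c"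
proof (cases "tm_halted M c \<and> fst c = 1")
  case True
  then have "tm_trans (padded M) (fst c) (scanned c) = {(1, keep (scanned c))}"
    by (auto simp: padded_def tm_halted_iff)
  moreover have "c = (1, snd c)" using True by (metis prod.collapse)
  ultimately show ?thesis
    using True by (auto simp: tm_step_def tm_halted_iff)
next
  case False
  then have "tm_trans (padded M) (fst c) (scanned c) = tm_trans M (fst c) (scanned c)"
    by (auto simp: padded_def tm_halted_iff)
  then show ?thesis using False by (auto simp: tm_step_def)
qed

lemma padded_reachable_valid:
  assumes "tm_wf M" "(tm_step (padded M))\<^sup>*\<^sup>* (tm_init M x) c"
  shows "valid_config M c"
  using assms(2)
proof (induction rule: rtranclp_induct)
  case base
  show ?case using assms(1) by (rule valid_config_init)
next
  case (step c c')
  then show ?case using tm_step_valid[OF tm_wf_padded[OF assms(1)], of c c'] by simp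
qed

lemma rtranclp_padded: "(tm_step (padded M))\<^sup>*\<^sup>* c c' \<Longrightarrow> (tm_step M)\<^sup>*\<^sup>* c c'"
  by (induction rule: rtranclp_induct)
    (auto simp: tm_step_padded_iff intro: rtranclp.rtrancl_into_rtrancl)

lemma padded_reachable_heads:
  assumes bound: "halts_before M x N"
    and "(tm_step (padded M))\<^sup>*\<^sup>* (tm_init M x) c" and tp: "tp \<in> set (snd c)"
  shows "\<bar>snd tp\<bar> < int N"
proof -
  obtain t where t: "(tm_step M ^^ t) (tm_init M x) c"
    using rtranclp_padded[OF assms(2)] rtranclp_imp_relpowp by fast
  then show ?thesis using bound abs_head_le[OF t tp] unfolding halts_before_def by fastforce
qed

lemma acceptsE_padded_run:
  assumes bound: "halts_before M x N" and "accepts M x"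
  obtains f where "f 0 = tm_init M x" "\<And>t. tm_step (padded M) (f t) (f (Suc t))"
    "\<And>t. N \<le> t \<Longrightarrow> tm_halted M (f t) \<and> fst (f t) = 1"
proof -
  obtain c n where c: "(tm_step M ^^ n) (tm_init M x) c" "tm_halted M c" "fst c = 1"
    using assms(2) by (auto simp: accepts_def rtranclp_power)
  then obtain g where g: "g 0 = tm_init M x" "g n = c" "\<And>i. i < n \<Longrightarrow> tm_step M (g i) (g (Suc i))"
    by (auto simp: relpowp_fun_conv)
  have "n < N" using bound c(1) unfolding halts_before_def by blast
  show thesis
  proof (rule that[of "\<lambda>t. g (min t n)"])
    show "tm_step (padded M) (g (min t n)) (g (min (Suc t) n))" for t
      using g c by (cases "t < n") (auto simp: tm_step_padded_iff min_def)
    show "tm_halted M (g (min t n)) \<and> fst (g (min t n)) = 1" if "N \<le> t" for t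
      using that \<open>n < N\<close> c g(2) by (simp add: min_absorb2)
  qed (simp add: g(1))
qed

section \<open>Rows of tiles\<close>

type_synonym hmsg = "(nat \<times> nat list \<times> nat \<times> (nat \<times> move) list) \<times> (bool \<times> bool) list"
type_synonym vmsg = "nat \<times> (nat \<times> bool) list"

text \<open>
  The horizontal message at the left border of a tape position announces the transition of the
  current step (state, scanned symbols, new state, actions) and, for every tape, whether the head
  crosses this border to the right and whether it crosses it to the left. The vertical message
  consists of the state and, for every tape, the symbol at that position and whether the head is
  there.
\<close>

definition tape_msg :: "tape \<Rightarrow> int \<Rightarrow> nat \<times> bool" where
  "tape_msg tp p = (fst tp p, snd tp = p)"

definition crossing :: "tape \<Rightarrow> move \<Rightarrow> int \<Rightarrow> bool \<times> bool" where
  "crossing tp d p = (snd tp = p - 1 \<and> d = Right, snd tp = p \<and> d = Left)"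

definition tape_ok ::
  "nat \<Rightarrow> nat \<times> move \<Rightarrow> bool \<times> bool \<Rightarrow> bool \<times> bool \<Rightarrow> nat \<times> bool \<Rightarrow> nat \<times> bool \<Rightarrow> bool" where
  "tape_ok s a l r d u \<longleftrightarrow>
    (if snd d then fst d = s \<and> fst u = fst a \<and> (fst r \<longleftrightarrow> snd a = Right) \<and> (snd l \<longleftrightarrow> snd a = Left)
     else fst u = fst d \<and> \<not> fst r \<and> \<not> snd l) \<and>
    (snd u \<longleftrightarrow> snd d \<and> snd a = Stay \<or> fst l \<or> snd r)"

lemma tape_ok_crossing:
  "tape_ok (read_tape tp) a (crossing tp (snd a) p) (crossing tp (snd a) (p + 1))
    (tape_msg tp p) (tape_msg (act_tape a tp) p)"
  by (cases "snd a") (auto simp: tape_ok_def crossing_def tape_msg_def act_tape_eq read_tape_eq)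

lemma tape_ok_scanned: "tape_ok s a l r (tape_msg tp (snd tp)) u \<Longrightarrow> s = read_tape tp"
  by (simp add: tape_ok_def tape_msg_def read_tape_eq)

lemma tape_row_crossings:
  assumes ok: "\<And>p. a \<le> p \<Longrightarrow> p \<le> b \<Longrightarrow> tape_ok s act (e p) (e (p + 1)) (tape_msg tp p) (u p)"
    and head: "a \<le> snd tp" "snd tp \<le> b"
    and borders: "e a = (False, False)" "e (b + 1) = (False, False)"
    and p: "a \<le> p" "p \<le> b + 1"
  shows "e p = crossing tp (snd act) p"
proof (rule prod_eqI)
  show "fst (e p) = fst (crossing tp (snd act) p)"
  proof (cases "p = a")
    case True
    then show ?thesis using borders(1) head by (simp add: crossing_def)
  next
    case False
    then show ?thesis
      using ok[of "p - 1"] p by (auto simp: tape_ok_def tape_msg_def crossing_def split: if_splits)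
  qed
  show "snd (e p) = snd (crossing tp (snd act) p)"
  proof (cases "p = b + 1")
    case True
    then show ?thesis using borders(2) head by (simp add: crossing_def)
  next
    case False
    then show ?thesis
      using ok[of p] p by (auto simp: tape_ok_def tape_msg_def crossing_def split: if_splits)
  qed
qed

lemma tape_row_step:
  assumes ok: "\<And>p. a \<le> p \<Longrightarrow> p \<le> b \<Longrightarrow> tape_ok s act (e p) (e (p + 1)) (tape_msg tp p) (u p)"
    and head: "a \<le> snd tp" "snd tp \<le> b"
    and borders: "e a = (False, False)" "e (b + 1) = (False, False)"
  shows "\<And>p. a \<le> p \<Longrightarrow> p \<le> b \<Longrightarrow> u p = tape_msg (act_tape act tp) p"
    and "a \<le> snd (act_tape act tp) \<and> snd (act_tape act tp) \<le> b"
proof -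
  have e: "e p = crossing tp (snd act) p" if "a \<le> p" "p \<le> b + 1" for p
    using tape_row_crossings[of a b s act e tp u p] ok head borders that by blast
  show "u p = tape_msg (act_tape act tp) p" if p: "a \<le> p" "p \<le> b" for p
    using ok[OF p] e[of p] e[of "p + 1"] p
    by (cases "snd act"; intro prod_eqI)
      (auto simp: tape_ok_def tape_msg_def crossing_def act_tape_eq split: if_splits)
  show "a \<le> snd (act_tape act tp) \<and> snd (act_tape act tp) \<le> b"
    using e[of a] e[of "b + 1"] borders head
    by (cases "snd act") (auto simp: crossing_def act_tape_eq)
qed

definition normal_tile :: "tm \<Rightarrow> hmsg \<Rightarrow> hmsg \<Rightarrow> vmsg \<Rightarrow> vmsg \<Rightarrow> bool" where
  "normal_tile M l r d u \<longleftrightarrow> fst r = fst l \<and> (case fst l of (q, ss, q', acts) \<Rightarrow>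
    fst d = q \<and> fst u = q' \<and> (q', acts) \<in> tm_trans M q ss \<and>
    (\<forall>j < tm_tapes M. tape_ok (ss ! j) (acts ! j) (snd l ! j) (snd r ! j) (snd d ! j) (snd u ! j)))"

definition no_cross :: "tm \<Rightarrow> hmsg \<Rightarrow> bool" where
  "no_cross M h \<longleftrightarrow> (\<forall>j < tm_tapes M. snd h ! j = (False, False))"

definition hmsgs :: "tm \<Rightarrow> hmsg set" where
  "hmsgs M = ({..<tm_states M} \<times> {ss. set ss \<subseteq> {..<tm_syms M} \<and> length ss = tm_tapes M} \<times>
    {..<tm_states M} \<times>
    {acts. set acts \<subseteq> {..<tm_syms M} \<times> {Left, Stay, Right} \<and> length acts = tm_tapes M}) \<times>
    {cs. set cs \<subseteq> UNIV \<and> length cs = tm_tapes M}"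

definition vmsgs :: "tm \<Rightarrow> vmsg set" where
  "vmsgs M = {..<tm_states M} \<times> {ds. set ds \<subseteq> {..<tm_syms M} \<times> UNIV \<and> length ds = tm_tapes M}"

lemma finite_hmsgs: "finite (hmsgs M)"
  unfolding hmsgs_def by (intro finite_cartesian_product finite_lists_length_eq) auto

lemma finite_vmsgs: "finite (vmsgs M)"
  unfolding vmsgs_def by (intro finite_cartesian_product finite_lists_length_eq) auto

definition cell_msg :: "config \<Rightarrow> int \<Rightarrow> vmsg" where
  "cell_msg c p = (fst c, map (\<lambda>tp. tape_msg tp p) (snd c))"

definition announce :: "config \<Rightarrow> nat \<Rightarrow> (nat \<times> move) list \<Rightarrow> int \<Rightarrow> hmsg" where
  "announce c q' acts p = ((fst c, scanned c, q', acts),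
      map2 (\<lambda>tp a. crossing tp (snd a) p) (snd c) acts)"

lemma cell_msg_in_vmsgs: "valid_config M c \<Longrightarrow> cell_msg c p \<in> vmsgs M"
  by (auto simp: cell_msg_def vmsgs_def valid_config_def tape_msg_def)

lemma announce_in_hmsgs:
  assumes "valid_config M c"
    "q' < tm_states M \<and> length acts = tm_tapes M \<and> fst ` set acts \<subseteq> {..<tm_syms M}"
  shows "announce c q' acts p \<in> hmsgs M"
proof -
  have "d \<in> {Left, Stay, Right}" for d by (cases d) auto
  then have "set acts \<subseteq> {..<tm_syms M} \<times> {Left, Stay, Right}" using assms(2) by fastforce
  then show ?thesis
    using assms scanned_valid[OF assms(1)] by (auto simp: announce_def hmsgs_def valid_config_def)
qed

lemma normal_tile_announce:
  assumes "length (snd c) = tm_tapes M" "length acts = tm_tapes M"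
    and "(q', acts) \<in> tm_trans M (fst c) (scanned c)"
  shows "normal_tile M (announce c q' acts p) (announce c q' acts (p + 1))
    (cell_msg c p) (cell_msg (q', map2 act_tape acts (snd c)) p)"
  using assms tape_ok_crossing by (simp add: normal_tile_def announce_def cell_msg_def)

lemma no_cross_announce:
  assumes "length (snd c) = tm_tapes M" "length acts = tm_tapes M"
    and heads: "\<And>tp. tp \<in> set (snd c) \<Longrightarrow> a < snd tp \<and> snd tp < b"
  shows "no_cross M (announce c q' acts a)" "no_cross M (announce c q' acts (b + 1))"
proof -
  have "a < snd (snd c ! j) \<and> snd (snd c ! j) < b" if "j < tm_tapes M" for j
    using heads that assms(1) by simp
  then show "no_cross M (announce c q' acts a)" "no_cross M (announce c q' acts (b + 1))"
    using assms by (fastforce simp: no_cross_def announce_def crossing_def)+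
qed

definition heads_within :: "int \<Rightarrow> int \<Rightarrow> config \<Rightarrow> bool" where
  "heads_within a b c \<longleftrightarrow> (\<forall>tp \<in> set (snd c). a \<le> snd tp \<and> snd tp \<le> b)"

lemma normal_tile_cell_msgD:
  assumes "normal_tile M l r (cell_msg c p) u" "fst l = (q, ss, q', acts)"
    and "length (snd c) = tm_tapes M"
  shows "fst c = q" "fst u = q'" "(q', acts) \<in> tm_trans M q ss"
    and "\<And>j. j < tm_tapes M \<Longrightarrow>
      tape_ok (ss ! j) (acts ! j) (snd l ! j) (snd r ! j) (tape_msg (snd c ! j) p) (snd u ! j)"
  using assms by (auto simp: normal_tile_def cell_msg_def)

lemma row_announcement:
  assumes len: "length (snd c) = tm_tapes M" and heads: "heads_within a b c" and ab: "a \<le> b"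
    and msgs: "e a \<in> hmsgs M"
    and tiles: "\<And>p. a \<le> p \<Longrightarrow> p \<le> b \<Longrightarrow> normal_tile M (e p) (e (p + 1)) (cell_msg c p) (u p)"
  obtains q' acts where "(q', acts) \<in> tm_trans M (fst c) (scanned c)" "length acts = tm_tapes M"
    "\<And>p. a \<le> p \<Longrightarrow> p \<le> b + 1 \<Longrightarrow> fst (e p) = (fst c, scanned c, q', acts)"
proof -
  obtain q ss q' acts where ea: "fst (e a) = (q, ss, q', acts)" by (metis prod_cases4)
  have const: "fst (e p) = (q, ss, q', acts)" if "a \<le> p" "p \<le> b + 1" for p
    using that
  proof (induction p rule: int_ge_induct)
    case (step p)
    then show ?case using tiles[of p] by (simp add: normal_tile_def)
  qed (simp add: ea)
  note tile = normal_tile_cell_msgD[OF tiles const len]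
  have lens: "length ss = tm_tapes M" "length acts = tm_tapes M"
    using msgs ea by (auto simp: hmsgs_def mem_Times_iff)
  have "ss = scanned c"
  proof (rule nth_equalityI)
    fix j assume "j < length ss"
    then have j: "j < tm_tapes M" using lens by simp
    then have "a \<le> snd (snd c ! j)" "snd (snd c ! j) \<le> b"
      using heads len by (simp_all add: heads_within_def)
    then show "ss ! j = scanned c ! j"
      using tape_ok_scanned[OF tile(4)[OF _ _ _ _ j]] j len by simp
  qed (simp add: lens len)
  then show thesis using that[of q' acts] tile(1,3)[of a] ab const lens by simp
qed

lemma normal_row_tape:
  assumes len: "length (snd c) = tm_tapes M" and heads: "heads_within a b c"
    and tiles: "\<And>p. a \<le> p \<Longrightarrow> p \<le> b \<Longrightarrow> normal_tile M (e p) (e (p + 1)) (cell_msg c p) (u p)"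
    and borders: "no_cross M (e a)" "no_cross M (e (b + 1))"
    and const: "\<And>p. a \<le> p \<Longrightarrow> p \<le> b + 1 \<Longrightarrow> fst (e p) = (q, ss, q', acts)"
    and j: "j < tm_tapes M"
  shows "\<And>p. a \<le> p \<Longrightarrow> p \<le> b \<Longrightarrow> snd (u p) ! j = tape_msg (act_tape (acts ! j) (snd c ! j)) p"
    and "a \<le> snd (act_tape (acts ! j) (snd c ! j)) \<and> snd (act_tape (acts ! j) (snd c ! j)) \<le> b"
proof -
  have ok: "tape_ok (ss ! j) (acts ! j) (snd (e p) ! j) (snd (e (p + 1)) ! j)
      (tape_msg (snd c ! j) p) (snd (u p) ! j)" if "a \<le> p" "p \<le> b" for p
    using normal_tile_cell_msgD(4)[OF tiles const len j] that by simp
  have head: "a \<le> snd (snd c ! j)" "snd (snd c ! j) \<le> b"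
    using heads j len by (auto simp: heads_within_def)
  have border: "snd (e a) ! j = (False, False)" "snd (e (b + 1)) ! j = (False, False)"
    using borders j by (auto simp: no_cross_def)
  show "\<And>p. a \<le> p \<Longrightarrow> p \<le> b \<Longrightarrow> snd (u p) ! j = tape_msg (act_tape (acts ! j) (snd c ! j)) p"
    "a \<le> snd (act_tape (acts ! j) (snd c ! j)) \<and> snd (act_tape (acts ! j) (snd c ! j)) \<le> b"
    using tape_row_step[where e = "\<lambda>p. snd (e p) ! j" and u = "\<lambda>p. snd (u p) ! j",
      OF ok head border]
    by simp_all
qed

lemma row_step:
  assumes len: "length (snd c) = tm_tapes M" and heads: "heads_within a b c" and ab: "a \<le> b"
    and msgs: "e a \<in> hmsgs M" "\<And>p. a \<le> p \<Longrightarrow> p \<le> b \<Longrightarrow> u p \<in> vmsgs M"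
    and tiles: "\<And>p. a \<le> p \<Longrightarrow> p \<le> b \<Longrightarrow> normal_tile M (e p) (e (p + 1)) (cell_msg c p) (u p)"
    and borders: "no_cross M (e a)" "no_cross M (e (b + 1))"
  obtains c' where "tm_step M c c'" "length (snd c') = tm_tapes M" "heads_within a b c'"
    "\<And>p. a \<le> p \<Longrightarrow> p \<le> b \<Longrightarrow> u p = cell_msg c' p"
proof -
  obtain q' acts where act: "(q', acts) \<in> tm_trans M (fst c) (scanned c)" "length acts = tm_tapes M"
    and const: "\<And>p. a \<le> p \<Longrightarrow> p \<le> b + 1 \<Longrightarrow> fst (e p) = (fst c, scanned c, q', acts)"
    using row_announcement[OF len heads ab msgs(1) tiles] by blast
  note tape_row = normal_row_tape[OF len heads tiles borders const]
  define c' where "c' = (q', map2 act_tape acts (snd c))"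
  have len': "length (snd c') = tm_tapes M" using len act(2) by (simp add: c'_def)
  have tape: "snd c' ! j = act_tape (acts ! j) (snd c ! j)" if "j < tm_tapes M" for j
    using that len act(2) by (simp add: c'_def)
  show thesis
  proof
    show "tm_step M c c'" unfolding c'_def using act(1) by (rule tm_stepI)
    show "length (snd c') = tm_tapes M" by (rule len')
    show "heads_within a b c'"
      unfolding heads_within_def using tape_row(2) tape len' by (metis in_set_conv_nth)
    fix p assume p: "a \<le> p" "p \<le> b"
    have "fst (u p) = q'" using tiles[OF p] const[of p] p by (simp add: normal_tile_def)
    moreover have "snd (u p) = map (\<lambda>tp. tape_msg tp p) (snd c')"
      using msgs(2)[OF p] len' tape tape_row(1)[OF _ _ _ _ _ p]
      by (intro nth_equalityI) (auto simp: vmsgs_def)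
    ultimately show "u p = cell_msg c' p" by (simp add: cell_msg_def c'_def prod_eq_iff)
  qed
qed

section \<open>Computations as tilings\<close>

datatype cell_class = Border | Inner | Final | Initial nat bool

definition tile :: "tm \<Rightarrow> cell_class \<Rightarrow> hmsg \<Rightarrow> hmsg \<Rightarrow> vmsg \<Rightarrow> vmsg \<Rightarrow> bool" where
  "tile M c l r d u \<longleftrightarrow> l \<in> hmsgs M \<and> r \<in> hmsgs M \<and> d \<in> vmsgs M \<and> u \<in> vmsgs M \<and>
    (if c = Border then no_cross M l \<and> no_cross M r else normal_tile (padded M) l r d u) \<and>
    (c = Final \<longrightarrow> fst (fst l) = 1 \<and> tm_trans M 1 (fst (snd (fst l))) = {}) \<and>
    (\<forall>a h. c = Initial a h \<longrightarrow> d = (0, (a, h) # replicate (tm_tapes M - 1) (0, h)))"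

definition class_at :: "nat \<Rightarrow> bool list \<Rightarrow> nat \<Rightarrow> int \<Rightarrow> cell_class" where
  "class_at N x t p =
    (if t = 0 then Initial (contents x p) (p = 0) else if t = N + 1 then Final else Inner)"

definition space_time_tiling ::
  "tm \<Rightarrow> nat \<Rightarrow> bool list \<Rightarrow> (nat \<Rightarrow> int \<Rightarrow> hmsg) \<Rightarrow> (nat \<Rightarrow> int \<Rightarrow> vmsg) \<Rightarrow> bool" where
  "space_time_tiling M N x H U \<longleftrightarrow>
    (\<forall>t < N + 2. \<forall>p \<in> {- int N..int N}.
      tile M (class_at N x t p) (H t p) (H t (p + 1)) (U t p) (U (Suc t) p)) \<and>
    (\<forall>t < N + 2. no_cross M (H t (- int N))) \<and>
    (\<forall>t < N + 1. no_cross M (H t (int N + 1)))"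

lemma messages_padded [simp]:
  "hmsgs (padded M) = hmsgs M" "vmsgs (padded M) = vmsgs M" "no_cross (padded M) = no_cross M"
  by (simp_all add: hmsgs_def vmsgs_def no_cross_def fun_eq_iff)

lemma tile_class_at:
  assumes "tile M (class_at N x t p) l r d u"
  shows "normal_tile (padded M) l r d u" "l \<in> hmsgs M" "u \<in> vmsgs M"
proof -
  have "class_at N x t p \<noteq> Border" by (simp add: class_at_def)
  then show "normal_tile (padded M) l r d u" "l \<in> hmsgs M" "u \<in> vmsgs M"
    using assms by (simp_all add: tile_def)
qed

lemma space_time_tilingD:
  assumes "space_time_tiling M N x H U"
  shows "t < N + 2 \<Longrightarrow> - int N \<le> p \<Longrightarrow> p \<le> int N \<Longrightarrow>
      tile M (class_at N x t p) (H t p) (H t (p + 1)) (U t p) (U (Suc t) p)"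
    and "t < N + 2 \<Longrightarrow> no_cross M (H t (- int N))" "t < N + 1 \<Longrightarrow> no_cross M (H t (int N + 1))"
  using assms by (simp_all add: space_time_tiling_def)

lemma cell_msg_init:
  "cell_msg (tm_init M x) p = (0, (contents x p, p = 0) # replicate (tm_tapes M - 1) (0, p = 0))"
  by (auto simp: cell_msg_def tape_msg_def tm_init_def contents_def)

lemma space_time_tiling_row:
  assumes wf: "tm_wf M" and tiling: "space_time_tiling M N x H U" and "t < N + 2"
  shows "\<exists>c. (tm_step (padded M))\<^sup>*\<^sup>* (tm_init M x) c \<and> length (snd c) = tm_tapes M \<and>
    heads_within (- int N) (int N) c \<and> (\<forall>p \<in> {- int N..int N}. U t p = cell_msg c p)"
  using assms(3)
proof (induction t)
  case 0
  have "U 0 p = cell_msg (tm_init M x) p" if "p \<in> {- int N..int N}" for p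
  proof -
    have "tile M (Initial (contents x p) (p = 0)) (H 0 p) (H 0 (p + 1)) (U 0 p) (U 1 p)"
      using space_time_tilingD(1)[OF tiling, of 0 p] that by (simp add: class_at_def)
    then show ?thesis unfolding cell_msg_init by (simp add: tile_def)
  qed
  then show ?case
    using wf by (intro exI[of _ "tm_init M x"]) (auto simp: tm_init_def tm_wf_def heads_within_def)
next
  case (Suc t)
  then obtain c where c: "(tm_step (padded M))\<^sup>*\<^sup>* (tm_init M x) c" "length (snd c) = tm_tapes M"
    "heads_within (- int N) (int N) c" "\<forall>p \<in> {- int N..int N}. U t p = cell_msg c p" by auto
  have tiles: "normal_tile (padded M) (H t p) (H t (p + 1)) (cell_msg c p) (U (Suc t) p)"
    "H t p \<in> hmsgs M" "U (Suc t) p \<in> vmsgs M" if "- int N \<le> p" "p \<le> int N" for p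
  proof -
    have "tile M (class_at N x t p) (H t p) (H t (p + 1)) (cell_msg c p) (U (Suc t) p)"
      using space_time_tilingD(1)[OF tiling, of t p] that c(4) Suc.prems by simp
    from tile_class_at[OF this]
    show "normal_tile (padded M) (H t p) (H t (p + 1)) (cell_msg c p) (U (Suc t) p)"
      "H t p \<in> hmsgs M" "U (Suc t) p \<in> vmsgs M" .
  qed
  have borders: "no_cross M (H t (- int N))" "no_cross M (H t (int N + 1))"
    using space_time_tilingD(2,3)[OF tiling, of t] Suc.prems by simp_all
  obtain c' where "tm_step (padded M) c c'" "length (snd c') = tm_tapes M"
    "heads_within (- int N) (int N) c'" "\<And>p. - int N \<le> p \<Longrightarrow> p \<le> int N \<Longrightarrow> U (Suc t) p = cell_msg c' p"
    by (rule row_step[of c "padded M" "- int N" "int N" "H t" "U (Suc t)"])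
      (use c(2,3) tiles borders in simp_all)
  then show ?case
    using c(1) by (intro exI[of _ c']) (auto intro: rtranclp.rtrancl_into_rtrancl)
qed

theorem accepts_if_space_time_tiling:
  assumes wf: "tm_wf M" and tiling: "space_time_tiling M N x H U"
  shows "accepts M x"
proof -
  obtain c where c: "(tm_step (padded M))\<^sup>*\<^sup>* (tm_init M x) c" "length (snd c) = tm_tapes M"
    "heads_within (- int N) (int N) c" "\<forall>p \<in> {- int N..int N}. U (N + 1) p = cell_msg c p"
    using space_time_tiling_row[OF assms, of "N + 1"] by auto
  have tile: "tile M Final (H (N + 1) p) (H (N + 1) (p + 1)) (cell_msg c p) (U (N + 2) p)"
    if "- int N \<le> p" "p \<le> int N" for p
    using space_time_tilingD(1)[OF tiling, of "N + 1" p] that c(4) by (simp add: class_at_def)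
  obtain q' acts where "fst (H (N + 1) 0) = (fst c, scanned c, q', acts)"
  proof (rule row_announcement[of c "padded M" "- int N" "int N" "H (N + 1)" "U (N + 2)"])
    show "normal_tile (padded M) (H (N + 1) p) (H (N + 1) (p + 1)) (cell_msg c p) (U (N + 2) p)"
      if "- int N \<le> p" "p \<le> int N" for p
      using tile[OF that] by (simp add: tile_def)
    show "H (N + 1) (- int N) \<in> hmsgs (padded M)" using tile[of "- int N"] by (simp add: tile_def)
  qed (use c(2,3) in auto)
  with tile[of 0] have "tm_halted M c" "fst c = 1"
    by (simp_all add: tile_def tm_halted_iff)
  then show ?thesis using rtranclp_padded[OF c(1)] unfolding accepts_def by blast
qed

lemma space_time_tiling_if_accepts:
  assumes wf: "tm_wf M" and bound: "halts_before M x N"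
    and "accepts M x"
  shows "\<exists>H U. space_time_tiling M N x H U"
proof -
  obtain f where f0: "f 0 = tm_init M x" and step: "\<And>t. tm_step (padded M) (f t) (f (Suc t))"
    and halt: "\<And>t. N \<le> t \<Longrightarrow> tm_halted M (f t) \<and> fst (f t) = 1"
    using acceptsE_padded_run[of M x N] bound \<open>accepts M x\<close> by metis
  have reach: "(tm_step (padded M))\<^sup>*\<^sup>* (tm_init M x) (f t)" for t
    by (induction t) (auto simp: f0 intro: step rtranclp.rtrancl_into_rtrancl)
  note valid = padded_reachable_valid[OF wf reach]
  have len: "length (snd (f t)) = tm_tapes M" for t
    using valid by (simp add: valid_config_def)
  have "\<exists>q acts. (q, acts) \<in> tm_trans (padded M) (fst (f t)) (scanned (f t)) \<and>
      f (Suc t) = (q, map2 act_tape acts (snd (f t)))" for t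
    using step[of t] by (rule tm_stepE) blast
  then obtain q acts where act: "\<And>t. (q t, acts t) \<in> tm_trans (padded M) (fst (f t))
      (scanned (f t))"
    and f_Suc: "\<And>t. f (Suc t) = (q t, map2 act_tape (acts t) (snd (f t)))" by metis
  have act_valid: "q t < tm_states M \<and> length (acts t) = tm_tapes M \<and>
      fst ` set (acts t) \<subseteq> {..<tm_syms M}"
    for t using action_valid[OF tm_wf_padded[OF wf] _ act] valid by simp
  have heads: "- int N < snd tp \<and> snd tp < int N" if "tp \<in> set (snd (f t))" for t tp
    using padded_reachable_heads[OF bound reach that] by linarith
  define H where "H t = announce (f t) (q t) (acts t)" for t
  define U where "U t = cell_msg (f t)" for t
  have "normal_tile (padded M) (H t p) (H t (p + 1)) (U t p) (U (Suc t) p)" for t p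
    unfolding H_def U_def f_Suc using normal_tile_announce act act_valid len by simp
  moreover have "H t p \<in> hmsgs M" "U t p \<in> vmsgs M" for t p
    unfolding H_def U_def using announce_in_hmsgs cell_msg_in_vmsgs valid act_valid by simp_all
  moreover have "no_cross M (H t (- int N))" "no_cross M (H t (int N + 1))" for t
    unfolding H_def using no_cross_announce[OF len _ heads] act_valid by simp_all
  moreover have "fst (fst (H (N + 1) p)) = 1" "tm_trans M 1 (fst (snd (fst (H (N + 1) p)))) = {}"
    for p
    using halt[of "N + 1"] by (auto simp: H_def announce_def tm_halted_iff)
  moreover have "U 0 p = (0, (contents x p, p = 0) # replicate (tm_tapes M - 1) (0, p = 0))" for p
    by (simp add: U_def f0 cell_msg_init)
  ultimately have "space_time_tiling M N x H U"
    by (simp add: space_time_tiling_def tile_def class_at_def)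
  then show ?thesis by blast
qed

definition cell_classes :: "nat \<Rightarrow> bool list \<Rightarrow> cell_class list" where
  "cell_classes N x =
    concat (map (\<lambda>t. Border # map (class_at N x t) [- int N..int N]) [0..<N + 2])"

lemma nth_concat_same_length:
  assumes "\<forall>r \<in> set rs. length r = W" "t < length rs" "i < W"
  shows "concat rs ! (t * W + i) = rs ! t ! i"
  using assms
proof (induction rs arbitrary: t)
  case (Cons r rs)
  show ?case
  proof (cases t)
    case 0
    then show ?thesis using Cons.prems by (simp add: nth_append)
  next
    case (Suc t')
    have "\<not> W + (t' * W + i) < W" by simp
    then show ?thesis
      using Cons.prems Cons.IH[of t'] Suc by (simp add: nth_append add.assoc)
  qed
qed simp

lemma length_cell_classes: "length (cell_classes N x) = (N + 2) * (2 * N + 2)"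
proof -
  have "length [- int N..int N] = 2 * N + 1" by (simp add: nat_add_distrib nat_mult_distrib)
  then have "length (cell_classes N x) = sum_list (map (\<lambda>_. 2 * N + 2) [0..<N + 2])"
    unfolding cell_classes_def length_concat map_map comp_def by simp
  then show ?thesis by (simp add: sum_list_triv)
qed

lemma nth_cell_classes:
  assumes "t < N + 2" "i < 2 * N + 2"
  shows "cell_classes N x ! (t * (2 * N + 2) + i) =
    (if i = 0 then Border else class_at N x t (int i - int N - 1))"
proof -
  have "cell_classes N x ! (t * (2 * N + 2) + i) =
      map (\<lambda>t. Border # map (class_at N x t) [- int N..int N]) [0..<N + 2] ! t ! i"
    unfolding cell_classes_def by (rule nth_concat_same_length) (use assms in auto)
  also have "\<dots> = (Border # map (class_at N x t) [- int N..int N]) ! i"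
    using assms(1) by (simp del: upt_Suc)
  finally show ?thesis using assms(2) by (cases i) (auto simp: algebra_simps)
qed

text \<open>
  The cells of row \<open>t\<close> are followed by the border cell of row \<open>t + 1\<close>, so that the message at the
  right end of a row is also the one at the left side of the next border.
\<close>

locale row_layout =
  fixes M :: tm and N :: nat and x :: "bool list" and W :: nat
  assumes W: "W = 2 * N + 2"
begin

lemma W_pos: "0 < W"
  by (simp add: W)

lemma length_classes: "length (cell_classes N x) = (N + 2) * W"
  by (simp add: length_cell_classes W)

lemma nth_classes:
  "t < N + 2 \<Longrightarrow> i < W \<Longrightarrow>
    cell_classes N x ! (t * W + i) = (if i = 0 then Border else class_at N x t (int i - int N - 1))"
  using nth_cell_classes[of t N i x] by (simp add: W)

lemma space_time_tiling_if_tiling: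
  assumes tiling: "is_tiling (tile M) W (cell_classes N x) E U"
  shows "\<exists>H V. space_time_tiling M N x H V"
proof -
  define pos where "pos t p = t * W + nat (p + int N + 1)" for t p
  have tile: "tile M (if i = 0 then Border else class_at N x t (int i - int N - 1))
      (E (t * W + i)) (E (t * W + i + 1)) (U (t * W + i)) (U (t * W + i + W))"
    if "t < N + 2" "i < W" for t i
    using tiling[unfolded is_tiling_def length_classes, rule_format, OF mult_add_less_mult[OF that]]
    unfolding nth_classes[OF that] .
  have "tile M (class_at N x t p) (E (pos t p)) (E (pos t (p + 1))) (U (pos t p))
      (U (pos (Suc t) p))"
    if "t < N + 2" "- int N \<le> p" "p \<le> int N" for t p
  proof -
    define i where "i = nat (p + int N + 1)"
    have i: "i < W" "i \<noteq> 0" "int i - int N - 1 = p" using that by (auto simp: i_def W)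
    have "nat (p + 1 + int N + 1) = i + 1" using that by (simp add: i_def)
    then have "pos t p = t * W + i" "pos t (p + 1) = t * W + i + 1" "pos (Suc t) p = t * W + i + W"
      by (simp_all add: pos_def i_def)
    then show ?thesis using tile[OF that(1) i(1)] i(2,3) by simp
  qed
  moreover have "no_cross M (E (pos t (- int N)))" if "t < N + 2" for t
    using tile[OF that W_pos] by (simp add: pos_def tile_def)
  moreover have "no_cross M (E (pos t (int N + 1)))" if "t < N + 1" for t
  proof -
    have "nat (int N + 1 + int N + 1) = W" by (simp add: W)
    then have "pos t (int N + 1) = Suc t * W" by (simp add: pos_def)
    then show ?thesis using tile[OF _ W_pos, of "Suc t"] that by (simp add: tile_def)
  qed
  ultimately have "space_time_tiling M N x (\<lambda>t p. E (pos t p)) (\<lambda>t p. U (pos t p))"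
    by (simp add: space_time_tiling_def)
  then show ?thesis by blast
qed

definition row :: "nat \<Rightarrow> nat" where "row s = s div W"
definition col :: "nat \<Rightarrow> int" where "col s = int (s mod W) - int N - 1"

lemma row_col_above: "row (s + W) = Suc (row s)" "col (s + W) = col s"
  using W_pos by (simp_all add: row_def col_def)

lemma row_col_Suc:
  assumes "Suc s mod W \<noteq> 0"
  shows "row (Suc s) = row s" "col (Suc s) = col s + 1"
  using assms by (auto simp: row_def col_def div_Suc mod_Suc split: if_splits)

lemma row_col_Suc_border:
  assumes "Suc s mod W = 0"
  shows "row (Suc s) = Suc (row s)" "col s = int N"
proof -
  have "Suc (s mod W) = W" using assms by (simp add: mod_Suc split: if_splits)
  then show "col s = int N" unfolding col_def using W by linarith
  show "row (Suc s) = Suc (row s)" using assms by (simp add: row_def div_Suc)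
qed

lemma border_tile:
  assumes tiling: "space_time_tiling M N x H V" and t: "t < N + 2"
  shows "tile M Border (H (t - 1) (int N + 1)) (H t (- int N)) (V t (- int N))
      (V (Suc t) (- int N))"
proof -
  have "no_cross M (H (t - 1) (int N + 1))" "no_cross M (H t (- int N))"
    using space_time_tilingD(2,3)[OF tiling] t by simp_all
  then show ?thesis
    using space_time_tilingD(1)[OF tiling, of "t - 1" "int N"]
      space_time_tilingD(1)[OF tiling t, of "- int N"] t
    by (auto simp: tile_def)
qed

lemma tiling_if_space_time_tiling:
  assumes tiling: "space_time_tiling M N x H V"
  shows "\<exists>E U. is_tiling (tile M) W (cell_classes N x) E U"
proof -
  define l where "l s = (if s mod W = 0 then H (row s - 1) (int N + 1) else H (row s) (col s))"
    for s
  define v where "v t p = V t (max (- int N) p)" for t p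
  show ?thesis
  proof (rule exists_tilingI[where l = l and d = "\<lambda>s. v (row s) (col s)"
        and r = "\<lambda>s. H (row s) (col s + 1)" and u = "\<lambda>s. v (Suc (row s)) (col s)"])
    fix s assume "s < length (cell_classes N x)"
    then have row: "row s < N + 2"
      unfolding row_def length_classes by (rule less_mult_imp_div_less)
    have class_s: "cell_classes N x ! s =
        (if s mod W = 0 then Border else class_at N x (row s) (col s))"
      using nth_classes[OF row, of "s mod W"] W_pos unfolding row_def col_def by simp
    show "tile M (cell_classes N x ! s) (l s) (H (row s) (col s + 1)) (v (row s) (col s))
        (v (Suc (row s)) (col s))"
    proof (cases "s mod W = 0")
      case True
      then have "col s + 1 = - int N" "v t (col s) = V t (- int N)" for t
        by (simp_all add: col_def v_def)
      then show ?thesis using border_tile[OF tiling row] True by (simp add: class_s l_def)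
    next
      case False
      have "s mod W < W" using W_pos by simp
      then have "- int N \<le> col s" "col s \<le> int N" using False W unfolding col_def by linarith+
      then show ?thesis
        using space_time_tilingD(1)[OF tiling row] False
        by (simp add: class_s l_def v_def max_absorb2)
    qed
  next
    fix s
    show "H (row s) (col s + 1) = l (s + 1)"
      using row_col_Suc[of s] row_col_Suc_border[of s] by (simp add: l_def)
    show "v (Suc (row s)) (col s) = v (row (s + W)) (col (s + W))"
      by (simp add: row_col_above)
  qed
qed

end

theorem tiling_iff_accepts:
  assumes "tm_wf M" "halts_before M x N"
  shows "(\<exists>E U. is_tiling (tile M) (2 * N + 2) (cell_classes N x) E U) \<longleftrightarrow> accepts M x"
proof -
  interpret row_layout M N x "2 * N + 2" by unfold_locales simp
  have "(\<exists>E U. is_tiling (tile M) (2 * N + 2) (cell_classes N x) E U) \<longleftrightarrow>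
      (\<exists>H V. space_time_tiling M N x H V)"
    using space_time_tiling_if_tiling tiling_if_space_time_tiling by blast
  also have "\<dots> \<longleftrightarrow> accepts M x"
    using accepts_if_space_time_tiling[OF assms(1)] space_time_tiling_if_accepts[OF assms] by blast
  finally show ?thesis .
qed

instance move :: countable
  by countable_datatype

lemma exists_tile_encoding_machine: "\<exists>m. tile_encoding (tile M) m"
  by (rule exists_tile_encoding[OF finite_hmsgs[of M] finite_vmsgs[of M]]) (simp add: tile_def)

lemma cell_classes_nonempty: "cell_classes N x \<noteq> []"
  using length_cell_classes[of N x] by auto

definition computation_digraph :: "tm \<Rightarrow> nat \<Rightarrow> nat \<Rightarrow> bool list \<Rightarrow> nat pair_pre_digraph" where
  "computation_digraph M m N x =
    grid_digraph m (tile_bits (tile M) m) (2 * N + 2) (cell_classes N x)"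

lemma computation_digraph_degree_6:
  assumes "tile_encoding (tile M) m"
  shows "computation_digraph M m N x \<in> {G \<in> input_digraphs. max_degree (with_proj G) = 6}"
proof -
  have "grid m (tile_bits (tile M) m) (2 * N + 2) (cell_classes N x)"
    using tile_encoding.m_pos[OF assms] cell_classes_nonempty by (intro grid_tile_bits) simp_all
  then show ?thesis
    by (simp add: computation_digraph_def grid.input_digraph_G grid.max_degree_G)
qed

lemma colorable_2_computation_digraph_iff:
  assumes "tile_encoding (tile M) m" "tm_wf M" "halts_before M x N"
  shows "colorable 2 (with_proj (computation_digraph M m N x)) \<longleftrightarrow> accepts M x"
  using tile_encoding.colorable_2_iff_tiling[OF assms(1) _ cell_classes_nonempty]
    tiling_iff_accepts[OF assms(2,3)]
  by (simp add: computation_digraph_def)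

section \<open>A structured language for tape machines\<close>

datatype instr = IWrite nat nat | IMove nat move | IBranch nat nat nat | IJump nat

fun instr_action :: "nat \<Rightarrow> nat list \<Rightarrow> instr \<Rightarrow> nat \<times> (nat \<times> move) list" where
  "instr_action q ss (IWrite j s) = (Suc q, (keep ss)[j := (s, Stay)])"
| "instr_action q ss (IMove j d) = (Suc q, (keep ss)[j := (ss ! j, d)])"
| "instr_action q ss (IBranch j s n) = (if ss ! j = s then n else Suc q, keep ss)"
| "instr_action q ss (IJump n) = (n, keep ss)"

fun instr_sym :: "instr \<Rightarrow> nat" where
  "instr_sym (IWrite j s) = s"
| "instr_sym _ = 0"

fun instr_target :: "instr \<Rightarrow> nat" where
  "instr_target (IBranch j s n) = n"
| "instr_target (IJump n) = n"
| "instr_target _ = 0"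

definition machine :: "nat \<Rightarrow> instr list \<Rightarrow> tm" where
  "machine k P = \<lparr> tm_tapes = k, tm_syms = 3 + sum_list (map instr_sym P),
    tm_states = 2 + length P + sum_list (map instr_target P),
    tm_trans = (\<lambda>q ss. if q < length P then {instr_action q ss (P ! q)} else {}) \<rparr>"

lemma fst_set_keep_update: "fst ` set ((keep ss)[j := (s, d)]) = set (ss[j := s])"
proof -
  have "map fst ((keep ss)[j := (s, d)]) = ss[j := s]"
    by (simp add: map_update keep_def comp_def)
  then show ?thesis by (metis list.set_map)
qed

lemma instr_action_valid:
  assumes "set ss \<subseteq> A" "instr_sym i \<in> A"
  shows "fst (instr_action q ss i) \<le> Suc q + instr_target i"
    and "length (snd (instr_action q ss i)) = length ss"
    and "fst ` set (snd (instr_action q ss i)) \<subseteq> A"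
  using assms by (cases i; simp add: fst_set_keep_update set_update_subsetI)+

lemma tm_wf_machine:
  assumes "k \<ge> 1"
  shows "tm_wf (machine k P)"
proof -
  let ?M = "machine k P"
  have "q' < tm_states ?M \<and> length acts = tm_tapes ?M \<and> fst ` set acts \<subseteq> {..<tm_syms ?M}"
    if ss: "length ss = tm_tapes ?M" "set ss \<subseteq> {..<tm_syms ?M}"
      and act: "(q', acts) \<in> tm_trans ?M q ss" for q ss q' acts
  proof -
    have q: "q < length P" "instr_action q ss (P ! q) = (q', acts)"
      using act by (auto simp: machine_def split: if_splits)
    have bounds: "instr_sym (P ! q) \<le> sum_list (map instr_sym P)"
      "instr_target (P ! q) \<le> sum_list (map instr_target P)"
      using q(1) by (auto intro!: member_le_sum_list)
    then have "instr_sym (P ! q) \<in> {..<tm_syms ?M}" by (simp add: machine_def)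
    from instr_action_valid[OF ss(2) this, of q] show ?thesis
      using q bounds ss(1) by (simp add: machine_def)
  qed
  moreover have "tm_tapes ?M \<ge> 1" "tm_syms ?M \<ge> 3" "tm_states ?M \<ge> 2"
    using assms by (simp_all add: machine_def)
  ultimately show ?thesis unfolding tm_wf_def by blast
qed

lemma tm_deterministic_machine: "tm_deterministic (machine k P)"
  by (auto simp: tm_deterministic_def machine_def)

type_synonym store = "nat \<Rightarrow> tape"

definition cfg :: "nat \<Rightarrow> nat \<Rightarrow> store \<Rightarrow> config" where
  "cfg k q \<sigma> = (q, map \<sigma> [0..<k])"

definition write_tape :: "nat \<Rightarrow> tape \<Rightarrow> tape" where
  "write_tape s = act_tape (s, Stay)"

definition move_tape :: "move \<Rightarrow> tape \<Rightarrow> tape" where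
  "move_tape d tp = act_tape (read_tape tp, d) tp"

lemma write_tape_simp [simp]: "write_tape s (w, i) = (w(i := s), i)"
  by (simp add: write_tape_def)

lemma move_tape_simp [simp]: "move_tape d (w, i) = (w, move_head d i)"
  by (simp add: move_tape_def)

lemma act_tape_read [simp]: "act_tape (read_tape tp, Stay) tp = tp"
  by (cases tp) simp

lemma map2_act_tape_keep_update:
  "map2 act_tape ((keep (map read_tape ts))[j := a]) ts = ts[j := act_tape a (ts ! j)]"
proof (rule nth_equalityI)
  fix i assume "i < length (map2 act_tape ((keep (map read_tape ts))[j := a]) ts)"
  then have "i < length ts" by simp
  then show "map2 act_tape ((keep (map read_tape ts))[j := a]) ts ! i =
      ts[j := act_tape a (ts ! j)] ! i"
    by (cases "i = j") (auto simp: keep_def)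
qed simp

lemma map_upt_update: "(map \<sigma> [0..<k])[j := y] = map (\<sigma>(j := y)) [0..<k]"
  by (rule nth_equalityI) (auto simp: nth_list_update)

lemma machine_stepI:
  assumes "q < length P" "P ! q = i" "instr_action q (map read_tape (map \<sigma> [0..<k])) i = (q', acts)"
    "map2 act_tape acts (map \<sigma> [0..<k]) = map \<sigma>' [0..<k]"
  shows "tm_step (machine k P) (cfg k q \<sigma>) (cfg k q' \<sigma>')"
  using assms by (auto simp: tm_step_def machine_def cfg_def)

lemma machine_step_update:
  assumes "q < length P" "P ! q = i" "j < k"
    and "instr_action q (map read_tape (map \<sigma> [0..<k])) i =
      (Suc q, (keep (map read_tape (map \<sigma> [0..<k])))[j := a])"
  shows "tm_step (machine k P) (cfg k q \<sigma>) (cfg k (Suc q) (\<sigma>(j := act_tape a (\<sigma> j))))"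
proof (rule machine_stepI[OF assms(1,2,4)])
  show "map2 act_tape ((keep (map read_tape (map \<sigma> [0..<k])))[j := a]) (map \<sigma> [0..<k]) =
      map (\<sigma>(j := act_tape a (\<sigma> j))) [0..<k]"
    using assms(3) by (simp only: map2_act_tape_keep_update map_upt_update nth_map_upt) simp
qed

lemma machine_step_Write:
  assumes "q < length P" "P ! q = IWrite j s" "j < k"
  shows "tm_step (machine k P) (cfg k q \<sigma>) (cfg k (Suc q) (\<sigma>(j := write_tape s (\<sigma> j))))"
  unfolding write_tape_def using machine_step_update[OF assms] by simp

lemma machine_step_Move:
  assumes "q < length P" "P ! q = IMove j d" "j < k"
  shows "tm_step (machine k P) (cfg k q \<sigma>) (cfg k (Suc q) (\<sigma>(j := move_tape d (\<sigma> j))))"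
  unfolding move_tape_def using machine_step_update[OF assms] assms(3) by simp

lemma machine_step_Branch:
  assumes "q < length P" "P ! q = IBranch j s n" "j < k"
  shows "tm_step (machine k P) (cfg k q \<sigma>) (cfg k (if read_tape (\<sigma> j) = s then n else Suc q) \<sigma>)"
  by (rule machine_stepI[OF assms(1,2) _ map2_act_tape_keep]) (use assms in simp)

lemma machine_step_Jump:
  assumes "q < length P" "P ! q = IJump n"
  shows "tm_step (machine k P) (cfg k q \<sigma>) (cfg k n \<sigma>)"
  by (rule machine_stepI[OF assms _ map2_act_tape_keep]) simp

datatype com =
    Skip
  | Write nat nat
  | Move nat move
  | Seq com com (infixl \<open>;;\<close> 60)
  | IfSym nat nat com com
  | While nat com

inductive runs :: "com \<Rightarrow> store \<Rightarrow> nat \<Rightarrow> store \<Rightarrow> bool" where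
  runs_Skip: "runs Skip \<sigma> 0 \<sigma>"
| runs_Write: "runs (Write j s) \<sigma> 1 (\<sigma>(j := write_tape s (\<sigma> j)))"
| runs_Move: "runs (Move j d) \<sigma> 1 (\<sigma>(j := move_tape d (\<sigma> j)))"
| runs_Seq: "runs c \<sigma> a \<sigma>' \<Longrightarrow> runs d \<sigma>' b \<sigma>'' \<Longrightarrow> runs (c ;; d) \<sigma> (a + b) \<sigma>''"
| runs_IfSym_eq: "read_tape (\<sigma> j) = s \<Longrightarrow> runs c \<sigma> b \<sigma>' \<Longrightarrow> runs (IfSym j s c d) \<sigma> (1 + b) \<sigma>'"
| runs_IfSym_neq: "read_tape (\<sigma> j) \<noteq> s \<Longrightarrow> runs d \<sigma> b \<sigma>' \<Longrightarrow>
    runs (IfSym j s c d) \<sigma> (1 + (b + 1)) \<sigma>'"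
| runs_While_blank: "read_tape (\<sigma> j) = 0 \<Longrightarrow> runs (While j c) \<sigma> 1 \<sigma>"
| runs_While_nonblank: "read_tape (\<sigma> j) \<noteq> 0 \<Longrightarrow> runs c \<sigma> a \<sigma>' \<Longrightarrow> runs (While j c) \<sigma>' b \<sigma>'' \<Longrightarrow>
    runs (While j c) \<sigma> (1 + (a + (1 + b))) \<sigma>''"
| runs_weaken_time: "runs c \<sigma> b \<sigma>' \<Longrightarrow> b \<le> b' \<Longrightarrow> runs c \<sigma> b' \<sigma>'"

fun code_len :: "com \<Rightarrow> nat" where
  "code_len Skip = 0"
| "code_len (Write j s) = 1"
| "code_len (Move j d) = 1"
| "code_len (c ;; d) = code_len c + code_len d"
| "code_len (IfSym j s c d) = code_len c + code_len d + 2"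
| "code_len (While j c) = code_len c + 2"

fun compile :: "com \<Rightarrow> nat \<Rightarrow> instr list" where
  "compile Skip pc = []"
| "compile (Write j s) pc = [IWrite j s]"
| "compile (Move j d) pc = [IMove j d]"
| "compile (c ;; d) pc = compile c pc @ compile d (pc + code_len c)"
| "compile (IfSym j s c d) pc =
    [IBranch j s (pc + 1 + code_len d + 1)] @ compile d (pc + 1) @
    [IJump (pc + 1 + code_len d + 1 + code_len c)] @ compile c (pc + 1 + code_len d + 1)"
| "compile (While j c) pc =
    [IBranch j 0 (pc + 1 + code_len c + 1)] @ compile c (pc + 1) @ [IJump pc]"

fun uses_tapes :: "nat \<Rightarrow> com \<Rightarrow> bool" where
  "uses_tapes k Skip \<longleftrightarrow> True"
| "uses_tapes k (Write j s) \<longleftrightarrow> j < k"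
| "uses_tapes k (Move j d) \<longleftrightarrow> j < k"
| "uses_tapes k (c ;; d) \<longleftrightarrow> uses_tapes k c \<and> uses_tapes k d"
| "uses_tapes k (IfSym j s c d) \<longleftrightarrow> j < k \<and> uses_tapes k c \<and> uses_tapes k d"
| "uses_tapes k (While j c) \<longleftrightarrow> j < k \<and> uses_tapes k c"

lemma length_compile [simp]: "length (compile c pc) = code_len c"
  by (induction c arbitrary: pc) auto

definition code_at :: "instr list \<Rightarrow> nat \<Rightarrow> instr list \<Rightarrow> bool" where
  "code_at P pc is \<longleftrightarrow> (\<exists>as bs. P = as @ is @ bs \<and> length as = pc)"

lemma code_at_append:
  "code_at P pc (is @ js) \<longleftrightarrow> code_at P pc is \<and> code_at P (pc + length is) js"
proof
  assume "code_at P pc (is @ js)"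
  then obtain as bs where "P = as @ is @ js @ bs" "length as = pc"
    by (auto simp: code_at_def)
  moreover from this have "P = (as @ is) @ js @ bs" "length (as @ is) = pc + length is" by simp_all
  ultimately show "code_at P pc is \<and> code_at P (pc + length is) js"
    unfolding code_at_def by blast
next
  assume "code_at P pc is \<and> code_at P (pc + length is) js"
  then obtain as bs as' bs' where split: "P = as @ is @ bs" "length as = pc"
    "P = as' @ js @ bs'" "length as' = pc + length is"
    unfolding code_at_def by blast
  then have "(as @ is) @ bs = as' @ js @ bs'" "length (as @ is) = length as'" by simp_all
  then have "bs = js @ bs'" using append_eq_append_conv by blast
  then show "code_at P pc (is @ js)"
    unfolding code_at_def using split(1,2) by auto
qed

lemma code_at_Cons: "code_at P pc (i # is) \<longleftrightarrow> pc < length P \<and> P ! pc = i \<and> code_at P (Suc pc) is"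
proof -
  have "code_at P pc [i] \<longleftrightarrow> pc < length P \<and> P ! pc = i"
  proof
    assume "pc < length P \<and> P ! pc = i"
    then have "P = take pc P @ [i] @ drop (Suc pc) P" "length (take pc P) = pc"
      using id_take_nth_drop[of pc P] by auto
    then show "code_at P pc [i]" unfolding code_at_def by blast
  qed (auto simp: code_at_def)
  then show ?thesis using code_at_append[of P pc "[i]" "is"] by simp
qed

lemma code_at_Nil: "code_at P pc [] \<longleftrightarrow> pc \<le> length P"
proof
  assume "pc \<le> length P"
  then have "P = take pc P @ [] @ drop pc P" "length (take pc P) = pc" by simp_all
  then show "code_at P pc []" unfolding code_at_def by blast
qed (auto simp: code_at_def)

lemmas code_at_simps = code_at_append code_at_Cons code_at_Nil

definition reaches_within :: "('a \<Rightarrow> 'a \<Rightarrow> bool) \<Rightarrow> nat \<Rightarrow> 'a \<Rightarrow> 'a \<Rightarrow> bool" where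
  "reaches_within R b x y \<longleftrightarrow> (\<exists>t \<le> b. (R ^^ t) x y)"

lemma reaches_within_refl: "reaches_within R 0 x x"
  by (simp add: reaches_within_def)

lemma reaches_within_single: "R x y \<Longrightarrow> reaches_within R 1 x y"
  unfolding reaches_within_def by (metis order_refl relpowp_1)

lemma reaches_within_trans:
  "reaches_within R a x y \<Longrightarrow> reaches_within R b y z \<Longrightarrow> reaches_within R (a + b) x z"
  unfolding reaches_within_def by (metis add_mono relcomppI relpowp_add)

lemma reaches_within_mono: "reaches_within R a x y \<Longrightarrow> a \<le> b \<Longrightarrow> reaches_within R b x y"
  unfolding reaches_within_def using order_trans by blast

context
  fixes k :: nat and P :: "instr list"
begin

abbreviation reach :: "nat \<Rightarrow> nat \<Rightarrow> store \<Rightarrow> nat \<Rightarrow> store \<Rightarrow> bool" where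
  "reach b pc \<sigma> pc' \<sigma>' \<equiv> reaches_within (tm_step (machine k P)) b (cfg k pc \<sigma>) (cfg k pc' \<sigma>')"

lemma reach_Branch_eq:
  "pc < length P \<Longrightarrow> P ! pc = IBranch j s n \<Longrightarrow> j < k \<Longrightarrow> read_tape (\<sigma> j) = s \<Longrightarrow> reach 1 pc \<sigma> n \<sigma>"
  by (rule reaches_within_single) (use machine_step_Branch[of pc P j s n k \<sigma>] in simp)

lemma reach_Branch_neq:
  "pc < length P \<Longrightarrow> P ! pc = IBranch j s n \<Longrightarrow> j < k \<Longrightarrow> read_tape (\<sigma> j) \<noteq> s \<Longrightarrow> reach 1 pc \<sigma> (pc + 1) \<sigma>"
  by (rule reaches_within_single) (use machine_step_Branch[of pc P j s n k \<sigma>] in simp)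

lemma reach_Jump: "pc < length P \<Longrightarrow> P ! pc = IJump n \<Longrightarrow> reach 1 pc \<sigma> n \<sigma>"
  by (rule reaches_within_single) (use machine_step_Jump[of pc P n k \<sigma>] in simp)

lemma reach_IfSym_eq:
  assumes code: "code_at P pc (compile (IfSym j s c d) pc)" and "j < k" "read_tape (\<sigma> j) = s"
    and c: "\<And>pc. code_at P pc (compile c pc) \<Longrightarrow> reach b pc \<sigma> (pc + code_len c) \<sigma>'"
  shows "reach (1 + b) pc \<sigma> (pc + code_len (IfSym j s c d)) \<sigma>'"
proof -
  let ?pc = "pc + 1 + code_len d + 1"
  have "reach 1 pc \<sigma> ?pc \<sigma>"
    by (rule reach_Branch_eq[of _ j s]) (use assms in \<open>simp_all add: code_at_simps\<close>)
  moreover have "reach b ?pc \<sigma> (?pc + code_len c) \<sigma>'"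
    by (rule c) (use code in \<open>simp add: code_at_simps\<close>)
  ultimately have "reach (1 + b) pc \<sigma> (?pc + code_len c) \<sigma>'" by (rule reaches_within_trans)
  then show ?thesis by (simp add: ac_simps)
qed

lemma reach_IfSym_neq:
  assumes code: "code_at P pc (compile (IfSym j s c d) pc)" and "j < k" "read_tape (\<sigma> j) \<noteq> s"
    and d: "\<And>pc. code_at P pc (compile d pc) \<Longrightarrow> reach b pc \<sigma> (pc + code_len d) \<sigma>'"
  shows "reach (1 + (b + 1)) pc \<sigma> (pc + code_len (IfSym j s c d)) \<sigma>'"
proof -
  let ?pc = "pc + 1 + code_len d"
  have "reach 1 pc \<sigma> (pc + 1) \<sigma>"
    by (rule reach_Branch_neq[of _ j s]) (use assms in \<open>simp_all add: code_at_simps\<close>)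
  moreover have "reach b (pc + 1) \<sigma> ?pc \<sigma>'"
    by (rule d) (use code in \<open>simp add: code_at_simps\<close>)
  moreover have "reach 1 ?pc \<sigma>' (?pc + 1 + code_len c) \<sigma>'"
    by (rule reach_Jump) (use code in \<open>simp_all add: code_at_simps\<close>)
  ultimately have "reach (1 + (b + 1)) pc \<sigma> (?pc + 1 + code_len c) \<sigma>'"
    by (intro reaches_within_trans)
  then show ?thesis by (simp add: ac_simps)
qed

lemma reach_While_nonblank:
  assumes code: "code_at P pc (compile (While j c) pc)" and "j < k" "read_tape (\<sigma> j) \<noteq> 0"
    and c: "\<And>pc. code_at P pc (compile c pc) \<Longrightarrow> reach a pc \<sigma> (pc + code_len c) \<sigma>'"
    and loop: "reach b pc \<sigma>' (pc + code_len (While j c)) \<sigma>''"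
  shows "reach (1 + (a + (1 + b))) pc \<sigma> (pc + code_len (While j c)) \<sigma>''"
proof -
  let ?pc = "pc + 1 + code_len c"
  have "reach 1 pc \<sigma> (pc + 1) \<sigma>"
    by (rule reach_Branch_neq[of _ j 0]) (use assms in \<open>simp_all add: code_at_simps\<close>)
  moreover have "reach a (pc + 1) \<sigma> ?pc \<sigma>'"
    by (rule c) (use code in \<open>simp add: code_at_simps\<close>)
  moreover have "reach 1 ?pc \<sigma>' pc \<sigma>'"
    by (rule reach_Jump) (use code in \<open>simp_all add: code_at_simps\<close>)
  ultimately show ?thesis using loop by (intro reaches_within_trans)
qed

theorem compile_correct:
  "runs c \<sigma> b \<sigma>' \<Longrightarrow> code_at P pc (compile c pc) \<Longrightarrow> uses_tapes k c \<Longrightarrow>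
    reach b pc \<sigma> (pc + code_len c) \<sigma>'"
proof (induction arbitrary: pc rule: runs.induct)
  case (runs_Skip \<sigma>)
  then show ?case by (simp add: reaches_within_refl)
next
  case (runs_Write j s \<sigma>)
  then have "tm_step (machine k P) (cfg k pc \<sigma>)
      (cfg k (pc + code_len (Write j s)) (\<sigma>(j := write_tape s (\<sigma> j))))"
    using machine_step_Write[of pc P j s k \<sigma>] by (simp add: code_at_simps)
  then show ?case by (rule reaches_within_single)
next
  case (runs_Move j d \<sigma>)
  then have "tm_step (machine k P) (cfg k pc \<sigma>)
      (cfg k (pc + code_len (Move j d)) (\<sigma>(j := move_tape d (\<sigma> j))))"
    using machine_step_Move[of pc P j d k \<sigma>] by (simp add: code_at_simps)
  then show ?case by (rule reaches_within_single)
next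
  case (runs_Seq c \<sigma> a \<sigma>' d b \<sigma>'')
  then have "reach a pc \<sigma> (pc + code_len c) \<sigma>'"
    "reach b (pc + code_len c) \<sigma>' (pc + code_len c + code_len d) \<sigma>''"
    by (simp_all add: code_at_simps)
  then show ?case unfolding code_len.simps add.assoc[symmetric] by (rule reaches_within_trans)
next
  case (runs_IfSym_eq \<sigma> j s c b \<sigma>' d)
  then show ?case by (intro reach_IfSym_eq) simp_all
next
  case (runs_IfSym_neq \<sigma> j s d b \<sigma>' c)
  then show ?case by (intro reach_IfSym_neq) simp_all
next
  case (runs_While_blank \<sigma> j c)
  then have "reach 1 pc \<sigma> (pc + 1 + code_len c + 1) \<sigma>"
    by (intro reach_Branch_eq[of _ j 0]) (simp_all add: code_at_simps)
  then show ?case by simp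
next
  case (runs_While_nonblank \<sigma> j c a \<sigma>' b \<sigma>'')
  then show ?case by (intro reach_While_nonblank) simp_all
next
  case (runs_weaken_time c \<sigma> b \<sigma>' b')
  then show ?case by (blast intro: reaches_within_mono)
qed

end

definition init_store :: "bool list \<Rightarrow> store" where
  "init_store x = (\<lambda>_. (contents [], 0))(0 := (contents x, 0))"

lemma cfg_init_store:
  assumes "k \<ge> 1"
  shows "cfg k 0 (init_store x) = tm_init (machine k P) x"
proof -
  have "[0..<k] = 0 # [1..<k]" using assms by (simp add: upt_conv_Cons)
  moreover have "map (init_store x) [1..<k] = replicate (k - 1) (contents [], 0)"
    by (rule nth_equalityI) (auto simp: init_store_def)
  ultimately show ?thesis by (simp add: cfg_def tm_init_def machine_def init_store_def)
qed

theorem poly_time_computableI: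
  fixes p :: "nat poly"
  assumes k: "k \<ge> 1" and c: "uses_tapes k c"
    and runs: "\<And>x. \<exists>\<sigma>. runs c (init_store x) (poly p (length x)) \<sigma> \<and>
      fst (\<sigma> (k - 1)) = contents (f x)"
  shows "poly_time_computable f"
  unfolding poly_time_computable_def
proof (intro exI[of _ "machine k (compile c 0)"] exI[of _ p] conjI allI)
  let ?P = "compile c 0"
  let ?M = "machine k ?P"
  show "tm_wf ?M" "tm_deterministic ?M"
    using k by (auto simp: tm_wf_machine tm_deterministic_machine)
  fix x
  obtain \<sigma> where run: "runs c (init_store x) (poly p (length x)) \<sigma>"
    and out: "fst (\<sigma> (k - 1)) = contents (f x)"
    using runs[of x] by blast
  let ?final = "cfg k (code_len c) \<sigma>"
  have "reaches_within (tm_step ?M) (poly p (length x)) (tm_init ?M x) ?final"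
    using compile_correct[OF run _ c, of ?P 0] cfg_init_store[OF k] by (simp add: code_at_def)
  then obtain t where "t \<le> poly p (length x)" "(tm_step ?M ^^ t) (tm_init ?M x) ?final"
    by (auto simp: reaches_within_def)
  moreover have "tm_halted ?M ?final"
    by (auto simp: tm_halted_iff machine_def cfg_def)
  moreover have "last (snd ?final) = \<sigma> (k - 1)"
    using k by (simp add: cfg_def last_map)
  ultimately show "\<exists>t c'. t \<le> poly p (length x) \<and> (tm_step ?M ^^ t) (tm_init ?M x) c' \<and>
      tm_halted ?M c' \<and> fst (last (snd c')) = contents (f x)"
    using out by metis
qed

section \<open>Programs on list tapes\<close>

definition list_tape :: "nat list \<Rightarrow> int \<Rightarrow> nat" where
  "list_tape xs i = (if 0 \<le> i \<and> i < int (length xs) then xs ! nat i else 0)"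

abbreviation at_start :: "nat list \<Rightarrow> tape" where
  "at_start xs \<equiv> (list_tape xs, 0)"

abbreviation at_end :: "nat list \<Rightarrow> tape" where
  "at_end xs \<equiv> (list_tape xs, int (length xs))"

abbreviation unary :: "nat \<Rightarrow> nat list" where
  "unary n \<equiv> replicate n 1"

lemma list_tape_snoc: "(list_tape xs)(int (length xs) := s) = list_tape (xs @ [s])"
  by (rule ext) (auto simp: list_tape_def nth_append)

lemma list_tape_nth: "i < length xs \<Longrightarrow> list_tape xs (int i) = xs ! i"
  by (simp add: list_tape_def)

lemma contents_eq: "contents x = list_tape (map (\<lambda>b. if b then 2 else 1) x)"
  by (rule ext) (auto simp: contents_def list_tape_def)

lemma move_head_eq: "move_head d i = i + move_head d 0"
  by (cases d) auto

lemma runs_weaken: "runs c \<sigma> b \<sigma>' \<Longrightarrow> b \<le> b' \<Longrightarrow> \<sigma>' = \<sigma>'' \<Longrightarrow> runs c \<sigma> b' \<sigma>''"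
  using runs_weaken_time by blast

lemma runs_Move_at:
  "runs (Move j d) (\<sigma>(j := (w, p))) 1 (\<sigma>(j := (w, p + move_head d 0)))"
  by (rule runs_weaken[OF runs_Move]) (simp_all add: move_head_eq[of d p])

lemma runs_Write_at: "runs (Write j s) (\<sigma>(j := (w, p))) 1 (\<sigma>(j := (w(p := s), p)))"
  by (rule runs_weaken[OF runs_Write]) simp_all

declare runs_Seq [trans]

primrec repeat :: "nat \<Rightarrow> (nat \<Rightarrow> com) \<Rightarrow> com" where
  "repeat 0 c = Skip"
| "repeat (Suc n) c = repeat n c ;; c n"

primrec switch :: "nat \<Rightarrow> nat \<Rightarrow> (nat \<Rightarrow> com) \<Rightarrow> com" where
  "switch j 0 f = Skip"
| "switch j (Suc n) f = IfSym j n (f n) (switch j n f)"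

definition append_sym :: "nat \<Rightarrow> nat \<Rightarrow> com" where
  "append_sym j s = Write j s ;; Move j Right"

definition rewind :: "nat \<Rightarrow> com" where
  "rewind j = Move j Left ;; While j (Move j Left) ;; Move j Right"

definition foreach :: "nat \<Rightarrow> com \<Rightarrow> com" where
  "foreach j c = While j (c ;; Move j Right) ;; rewind j"

definition foreach_time :: "nat \<Rightarrow> nat \<Rightarrow> nat" where
  "foreach_time n b = n * (b + 6) + 4"

lemma uses_tapes_repeat [intro!]:
  "(\<And>i. i < n \<Longrightarrow> uses_tapes k (c i)) \<Longrightarrow> uses_tapes k (repeat n c)"
  by (induction n) auto

lemma uses_tapes_switch [intro!]:
  "j < k \<Longrightarrow> (\<And>i. i < n \<Longrightarrow> uses_tapes k (f i)) \<Longrightarrow> uses_tapes k (switch j n f)"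
  by (induction n) auto

lemma uses_tapes_macros [simp]:
  "uses_tapes k (append_sym j s) \<longleftrightarrow> j < k" "uses_tapes k (rewind j) \<longleftrightarrow> j < k"
  "uses_tapes k (foreach j c) \<longleftrightarrow> j < k \<and> uses_tapes k c"
  by (auto simp: append_sym_def rewind_def foreach_def)

lemma runs_repeat:
  assumes "\<And>i. i < n \<Longrightarrow> runs (c i) (F i) b (F (Suc i))"
  shows "runs (repeat n c) (F 0) (n * b) (F n)"
  using assms
proof (induction n)
  case 0
  then show ?case by (simp add: runs_Skip)
next
  case (Suc n)
  then have "runs (repeat n c) (F 0) (n * b) (F n)" "runs (c n) (F n) b (F (Suc n))" by auto
  from runs_Seq[OF this] show ?case by (simp add: add.commute)
qed

lemma runs_switch:
  assumes "read_tape (\<sigma> j) < n" "runs (f (read_tape (\<sigma> j))) \<sigma> b \<sigma>'"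
  shows "runs (switch j n f) \<sigma> (b + 2 * n) \<sigma>'"
  using assms(1)
proof (induction n)
  case (Suc n)
  show ?case
  proof (cases "read_tape (\<sigma> j) = n")
    case True
    moreover from this have "runs (f n) \<sigma> b \<sigma>'" using assms(2) by simp
    ultimately have "runs (switch j (Suc n) f) \<sigma> (1 + b) \<sigma>'"
      unfolding switch.simps by (rule runs_IfSym_eq)
    then show ?thesis by (rule runs_weaken_time) simp
  next
    case False
    then have "runs (switch j n f) \<sigma> (b + 2 * n) \<sigma>'" using Suc by simp
    with False have "runs (switch j (Suc n) f) \<sigma> (1 + (b + 2 * n + 1)) \<sigma>'"
      unfolding switch.simps by (rule runs_IfSym_neq)
    then show ?thesis by (rule runs_weaken_time) simp
  qed
qed simp

lemma runs_append_sym: "runs (append_sym j s) (\<sigma>(j := at_end xs)) 2 (\<sigma>(j := at_end (xs @ [s])))"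
proof -
  have "runs (append_sym j s) (\<sigma>(j := at_end xs)) (1 + 1)
      (\<sigma>(j := ((list_tape xs)(int (length xs) := s), int (length xs) + move_head Right 0)))"
    unfolding append_sym_def by (rule runs_Seq[OF runs_Write_at runs_Move_at])
  then show ?thesis by (rule runs_weaken) (simp_all add: list_tape_snoc add.commute)
qed

lemma runs_scan_left:
  assumes "0 \<notin> set xs" "p \<le> length xs"
  shows "runs (While j (Move j Left)) (\<sigma>(j := (list_tape xs, int p - 1))) (3 * p + 1)
    (\<sigma>(j := (list_tape xs, -1)))"
  using assms(2)
proof (induction p)
  case 0
  have "runs (While j (Move j Left)) (\<sigma>(j := (list_tape xs, -1))) 1 (\<sigma>(j := (list_tape xs, -1)))"
    by (rule runs_While_blank) (simp add: list_tape_def)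
  then show ?case by (simp only: of_nat_0 mult_0_right add_0 diff_0)
next
  case (Suc p)
  let ?\<sigma> = "\<lambda>p. \<sigma>(j := (list_tape xs, int p - 1))"
  have "xs ! p \<noteq> 0" using assms(1) Suc.prems nth_mem[of p xs] by (metis Suc_le_eq)
  then have "read_tape (?\<sigma> (Suc p) j) \<noteq> 0" using Suc.prems by (simp add: list_tape_nth)
  moreover have "runs (Move j Left) (?\<sigma> (Suc p)) 1 (?\<sigma> p)"
    using runs_Move_at[of j Left \<sigma> "list_tape xs" "int (Suc p) - 1"] by simp
  moreover have "runs (While j (Move j Left)) (?\<sigma> p) (3 * p + 1) (\<sigma>(j := (list_tape xs, -1)))"
    by (rule Suc.IH) (use Suc.prems in simp)
  ultimately have "runs (While j (Move j Left)) (?\<sigma> (Suc p)) (1 + (1 + (1 + (3 * p + 1))))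
      (\<sigma>(j := (list_tape xs, -1)))" by (rule runs_While_nonblank)
  then show ?case by (rule runs_weaken_time) simp
qed

lemma runs_rewind:
  assumes "0 \<notin> set xs" "p \<le> length xs"
  shows "runs (rewind j) (\<sigma>(j := (list_tape xs, int p))) (3 * p + 3) (\<sigma>(j := at_start xs))"
proof -
  have "runs (Move j Left) (\<sigma>(j := (list_tape xs, int p))) 1 (\<sigma>(j := (list_tape xs, int p - 1)))"
    using runs_Move_at[of j Left \<sigma> "list_tape xs" "int p"] by simp
  also have "runs (While j (Move j Left)) \<dots> (3 * p + 1) (\<sigma>(j := (list_tape xs, -1)))"
    using assms by (rule runs_scan_left)
  also have "runs (Move j Right) \<dots> 1 (\<sigma>(j := at_start xs))"
    using runs_Move_at[of j Right \<sigma> "list_tape xs" "-1"] by simp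
  finally show ?thesis unfolding rewind_def by (rule runs_weaken_time) simp
qed

lemma runs_scan_right:
  assumes nz: "0 \<notin> set xs" and "i \<le> length xs"
    and body: "\<And>i. i < length xs \<Longrightarrow>
      runs c ((F i)(j := (list_tape xs, int i))) b ((F (Suc i))(j := (list_tape xs, int i)))"
  shows "runs (While j (c ;; Move j Right)) ((F i)(j := (list_tape xs, int i)))
    ((length xs - i) * (b + 3) + 1) ((F (length xs))(j := at_end xs))"
  using assms(2)
proof (induction i rule: inc_induct)
  case base
  have "runs (While j (c ;; Move j Right)) ((F (length xs))(j := at_end xs)) 1
      ((F (length xs))(j := at_end xs))"
    by (rule runs_While_blank) (simp add: list_tape_def)
  then show ?case by (rule runs_weaken_time) simp
next
  case (step i)
  let ?at = "\<lambda>i. (F i)(j := (list_tape xs, int i))"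
  have "xs ! i \<noteq> 0" using nz step.hyps nth_mem[of i xs] by metis
  then have "read_tape (?at i j) \<noteq> 0" using step.hyps by (simp add: list_tape_nth)
  moreover have "runs (Move j Right) ((F (Suc i))(j := (list_tape xs, int i))) 1 (?at (Suc i))"
    using runs_Move_at[of j Right "F (Suc i)" "list_tape xs" "int i"] by (simp add: add.commute)
  with body[OF step.hyps(2)] have "runs (c ;; Move j Right) (?at i) (b + 1) (?at (Suc i))"
    by (rule runs_Seq)
  ultimately have "runs (While j (c ;; Move j Right)) (?at i)
      (1 + (b + 1 + (1 + ((length xs - Suc i) * (b + 3) + 1)))) ((F (length xs))(j := at_end xs))"
    using step.IH by (rule runs_While_nonblank)
  moreover have "length xs - i = Suc (length xs - Suc i)" using step.hyps by simp
  ultimately show ?case by (elim runs_weaken_time) simp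
qed

lemma runs_foreach:
  assumes nz: "0 \<notin> set xs"
    and start: "F 0 j = at_start xs" "F (length xs) j = at_start xs"
    and body: "\<And>i. i < length xs \<Longrightarrow>
      runs c ((F i)(j := (list_tape xs, int i))) b ((F (Suc i))(j := (list_tape xs, int i)))"
  shows "runs (foreach j c) (F 0) (foreach_time (length xs) b) (F (length xs))"
proof -
  have "(F 0)(j := (list_tape xs, int 0)) = F 0" using start(1) by (simp add: fun_upd_idem)
  with runs_scan_right[OF nz _ body, of 0]
  have "runs (While j (c ;; Move j Right)) (F 0) (length xs * (b + 3) + 1)
      ((F (length xs))(j := at_end xs))"
    by simp
  moreover have "(F (length xs))(j := at_start xs) = F (length xs)"
    using start(2) by (simp add: fun_upd_idem)
  with runs_rewind[OF nz order_refl]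
  have "runs (rewind j) ((F (length xs))(j := at_end xs)) (3 * length xs + 3) (F (length xs))"
    by metis
  ultimately have "runs (foreach j c) (F 0) ((length xs * (b + 3) + 1) + (3 * length xs + 3))
      (F (length xs))"
    unfolding foreach_def by (rule runs_Seq)
  then show ?thesis by (rule runs_weaken_time) (simp add: foreach_time_def algebra_simps)
qed

lemma runs_foreach_Move:
  assumes "0 \<notin> set xs" "\<sigma> j = at_start xs" "j \<noteq> r"
  shows "runs (foreach j (Move r d)) (\<sigma>(r := (w, p))) (foreach_time (length xs) 1)
    (\<sigma>(r := (w, p + int (length xs) * move_head d 0)))"
proof -
  define F where "F i = \<sigma>(r := (w, p + int i * move_head d 0))" for i
  have "runs (foreach j (Move r d)) (F 0) (foreach_time (length xs) 1) (F (length xs))"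
  proof (rule runs_foreach[OF assms(1)])
    show "F 0 j = at_start xs" "F (length xs) j = at_start xs"
      using assms(2,3) by (simp_all add: F_def)
    show "runs (Move r d) ((F i)(j := (list_tape xs, int i))) 1
        ((F (Suc i))(j := (list_tape xs, int i)))" for i
      using runs_Move_at[of r d "\<sigma>(j := (list_tape xs, int i))" w "p + int i * move_head d 0"]
        assms(3)
      by (simp add: F_def fun_upd_twist algebra_simps)
  qed
  then show ?thesis by (simp add: F_def)
qed

section \<open>Programs that append to a tape\<close>

definition emits :: "nat \<Rightarrow> com \<Rightarrow> store \<Rightarrow> nat \<Rightarrow> nat list \<Rightarrow> store \<Rightarrow> bool" where
  "emits j c \<sigma> b zs \<sigma>' \<longleftrightarrow> (\<forall>ys. runs c (\<sigma>(j := at_end ys)) b (\<sigma>'(j := at_end (ys @ zs))))"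

lemma emits_weaken:
  "emits j c \<sigma> b zs \<sigma>' \<Longrightarrow> b \<le> b' \<Longrightarrow> zs = zs' \<Longrightarrow> \<sigma>' = \<sigma>'' \<Longrightarrow> emits j c \<sigma> b' zs' \<sigma>''"
  unfolding emits_def using runs_weaken_time by blast

lemma emits_append_sym: "emits j (append_sym j s) \<sigma> 2 [s] \<sigma>"
  unfolding emits_def using runs_append_sym by blast

lemma emits_Seq:
  "emits j c \<sigma> a ys \<sigma>' \<Longrightarrow> emits j d \<sigma>' b zs \<sigma>'' \<Longrightarrow> emits j (c ;; d) \<sigma> (a + b) (ys @ zs) \<sigma>''"
  unfolding emits_def using runs_Seq by (metis append.assoc)

declare emits_Seq [trans]

lemma emits_if_runs: "(\<And>tp. runs c (\<sigma>(j := tp)) b (\<sigma>'(j := tp))) \<Longrightarrow> emits j c \<sigma> b [] \<sigma>'"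
  by (simp add: emits_def)

lemma emits_Move: "i \<noteq> j \<Longrightarrow> emits j (Move i d) \<sigma> 1 [] (\<sigma>(i := move_tape d (\<sigma> i)))"
  by (rule emits_if_runs, rule runs_weaken[OF runs_Move]) auto

lemma emits_switch:
  assumes "i \<noteq> j" "read_tape (\<sigma> i) < n" "emits j (f (read_tape (\<sigma> i))) \<sigma> b zs \<sigma>'"
  shows "emits j (switch i n f) \<sigma> (b + 2 * n) zs \<sigma>'"
  unfolding emits_def
proof
  fix ys
  show "runs (switch i n f) (\<sigma>(j := at_end ys)) (b + 2 * n) (\<sigma>'(j := at_end (ys @ zs)))"
    using assms by (intro runs_switch) (simp_all add: emits_def)
qed

lemma emits_repeat:
  assumes "\<And>i. i < n \<Longrightarrow> emits j (c i) \<sigma> b (g i) \<sigma>"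
  shows "emits j (repeat n c) \<sigma> (n * b) (concat (map g [0..<n])) \<sigma>"
  unfolding emits_def
proof
  fix ys
  define F where "F i = \<sigma>(j := at_end (ys @ concat (map g [0..<i])))" for i
  have "runs (repeat n c) (F 0) (n * b) (F n)"
  proof (rule runs_repeat)
    fix i assume "i < n"
    then have "runs (c i) (F i) b (\<sigma>(j := at_end ((ys @ concat (map g [0..<i])) @ g i)))"
      using assms unfolding emits_def F_def by blast
    then show "runs (c i) (F i) b (F (Suc i))" by (simp add: F_def)
  qed
  then show "runs (repeat n c) (\<sigma>(j := at_end ys)) (n * b)
      (\<sigma>(j := at_end (ys @ concat (map g [0..<n]))))"
    by (simp add: F_def)
qed

lemma emits_foreach:
  assumes nz: "0 \<notin> set xs" and "i \<noteq> j"
    and start: "F 0 i = at_start xs" "F (length xs) i = at_start xs"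
    and body: "\<And>k. k < length xs \<Longrightarrow>
      emits j c ((F k)(i := (list_tape xs, int k))) b (g k)
        ((F (Suc k))(i := (list_tape xs, int k)))"
  shows "emits j (foreach i c) (F 0) (foreach_time (length xs) b)
    (concat (map g [0..<length xs])) (F (length xs))"
  unfolding emits_def
proof
  fix ys
  define H where "H k = (F k)(j := at_end (ys @ concat (map g [0..<k])))" for k
  have "runs (foreach i c) (H 0) (foreach_time (length xs) b) (H (length xs))"
  proof (rule runs_foreach[OF nz])
    show "H 0 i = at_start xs" "H (length xs) i = at_start xs"
      using start \<open>i \<noteq> j\<close> by (simp_all add: H_def)
    fix k assume "k < length xs"
    then have "runs c
        ((F k)(i := (list_tape xs, int k), j := at_end (ys @ concat (map g [0..<k])))) b
        ((F (Suc k))(i := (list_tape xs, int k), j := at_end ((ys @ concat (map g [0..<k])) @ g k)))"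
      using body unfolding emits_def by blast
    then show "runs c ((H k)(i := (list_tape xs, int k))) b
        ((H (Suc k))(i := (list_tape xs, int k)))"
      using \<open>i \<noteq> j\<close> by (simp add: H_def fun_upd_twist)
  qed
  then show "runs (foreach i c) ((F 0)(j := at_end ys)) (foreach_time (length xs) b)
      ((F (length xs))(j := at_end (ys @ concat (map g [0..<length xs]))))"
    by (simp add: H_def)
qed

lemma concat_map_const: "concat (map (\<lambda>_. replicate n x) [0..<k]) = replicate (k * n) x"
  by (induction k) (simp_all add: replicate_add[symmetric] add.commute)

lemma emits_foreach_const:
  assumes "0 \<notin> set xs" "i \<noteq> j" "\<sigma> i = at_start xs"
    and "\<And>k. k < length xs \<Longrightarrow>
      emits j c (\<sigma>(i := (list_tape xs, int k))) b (g k) (\<sigma>(i := (list_tape xs, int k)))"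
  shows "emits j (foreach i c) \<sigma> (foreach_time (length xs) b) (concat (map g [0..<length xs])) \<sigma>"
  using emits_foreach[of xs i j "\<lambda>_. \<sigma>"] assms by blast

lemma emits_foreach_append_sym:
  assumes "0 \<notin> set xs" "i \<noteq> j" "\<sigma> i = at_start xs"
  shows "emits j (foreach i (append_sym j s)) \<sigma> (foreach_time (length xs) 2)
      (replicate (length xs) s) \<sigma>"
  using emits_foreach_const[of xs i j \<sigma> "append_sym j s" 2 "\<lambda>_. [s]"] assms emits_append_sym
    concat_map_const[of 1 s]
  by simp

definition build :: "nat \<Rightarrow> com \<Rightarrow> com" where
  "build j c = c ;; rewind j"

lemma uses_tapes_build [simp]: "uses_tapes k (build j c) \<longleftrightarrow> j < k \<and> uses_tapes k c"
  by (auto simp: build_def)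

lemma runs_build:
  assumes c: "emits j c \<sigma> b zs \<sigma>'" and "0 \<notin> set zs" "\<sigma> j = at_start []"
  shows "runs (build j c) \<sigma> (b + (3 * length zs + 3)) (\<sigma>'(j := at_start zs))"
proof -
  have "\<sigma>(j := at_end []) = \<sigma>" using assms(3) by (simp add: fun_upd_idem)
  then have "runs c \<sigma> b (\<sigma>'(j := at_end zs))" using c unfolding emits_def by (metis append_Nil)
  then show ?thesis
    unfolding build_def using runs_rewind[OF assms(2) order_refl] by (rule runs_Seq)
qed

lemma runs_build_copy:
  assumes "0 \<notin> set xs" "i \<noteq> j" "\<sigma> i = at_start xs" "\<sigma> j = at_start []" "s \<noteq> 0"
  shows "runs (build j (foreach i (append_sym j s))) \<sigma>
      (foreach_time (length xs) 2 + (3 * length xs + 3))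
    (\<sigma>(j := at_start (replicate (length xs) s)))"
proof -
  have "emits j (foreach i (append_sym j s)) \<sigma> (foreach_time (length xs) 2)
      (replicate (length xs) s) \<sigma>"
    using assms(1-3) by (rule emits_foreach_append_sym)
  from runs_build[OF this _ assms(4)] show ?thesis using assms(5) by simp
qed

section \<open>The tapes of the reduction\<close>

abbreviation (input) input_tape :: nat where "input_tape \<equiv> 0"
abbreviation (input) class_tape :: nat where "class_tape \<equiv> 1"
abbreviation (input) count_tape :: nat where "count_tape \<equiv> 2"
abbreviation (input) ruler_tape :: nat where "ruler_tape \<equiv> 3"
abbreviation (input) rows_tape :: nat where "rows_tape \<equiv> 4"
abbreviation (input) power_tape :: "nat \<Rightarrow> nat" where "power_tape d \<equiv> 5 + d"

subsection \<open>Powers in unary\<close>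

definition multiply :: "nat \<Rightarrow> nat \<Rightarrow> nat \<Rightarrow> com" where
  "multiply c i j = build j
    (foreach i (foreach input_tape (append_sym j 1) ;; repeat c (\<lambda>_. append_sym j 1)))"

definition multiply_time :: "nat \<Rightarrow> nat \<Rightarrow> nat \<Rightarrow> nat" where
  "multiply_time c n a = foreach_time a (foreach_time n 2 + c * 2) + (3 * (a * (n + c)) + 3)"

lemma runs_multiply:
  assumes xs: "0 \<notin> set xs" "\<sigma> input_tape = at_start xs"
    and tapes: "\<sigma> i = at_start (unary a)" "\<sigma> j = at_start []" "distinct [i, j, input_tape]"
  shows "runs (multiply c i j) \<sigma> (multiply_time c (length xs) a)
    (\<sigma>(j := at_start (unary (a * (length xs + c)))))"
proof -
  let ?n = "length xs"
  have factor: "emits j (foreach input_tape (append_sym j 1) ;; repeat c (\<lambda>_. append_sym j 1)) \<tau>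
      (foreach_time ?n 2 + c * 2) (unary (?n + c)) \<tau>" if "\<tau> input_tape = at_start xs" for \<tau>
  proof -
    have "emits j (foreach input_tape (append_sym j 1)) \<tau> (foreach_time ?n 2) (unary ?n) \<tau>"
      using xs(1) tapes(3) that by (intro emits_foreach_append_sym) auto
    also have "emits j (repeat c (\<lambda>_. append_sym j 1)) \<tau> (c * 2) (concat (map (\<lambda>_. [1]) [0..<c])) \<tau>"
      by (rule emits_repeat) (rule emits_append_sym)
    finally show ?thesis
      by (rule emits_weaken) (simp_all add: replicate_add map_replicate_const)
  qed
  have "emits j (foreach i (foreach input_tape (append_sym j 1) ;; repeat c (\<lambda>_. append_sym j 1))) \<sigma>
      (foreach_time (length (unary a)) (foreach_time ?n 2 + c * 2))
      (concat (map (\<lambda>_. unary (?n + c)) [0..<length (unary a)])) \<sigma>"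
  proof (rule emits_foreach_const)
    show "emits j (foreach input_tape (append_sym j 1) ;; repeat c (\<lambda>_. append_sym j 1))
        (\<sigma>(i := (list_tape (unary a), int k))) (foreach_time ?n 2 + c * 2) (unary (?n + c))
        (\<sigma>(i := (list_tape (unary a), int k)))" for k
      using xs(2) tapes(3) by (intro factor) simp
  qed (use tapes in simp_all)
  from runs_build[OF this _ tapes(2)] show ?thesis
    by (simp add: multiply_def multiply_time_def concat_map_const)
qed

primrec power_prog :: "nat \<Rightarrow> nat \<Rightarrow> com" where
  "power_prog c 0 = build (power_tape 0) (append_sym (power_tape 0) 1)"
| "power_prog c (Suc d) = power_prog c d ;; multiply c (power_tape d) (power_tape (Suc d))"

primrec power_time :: "nat \<Rightarrow> nat \<Rightarrow> nat \<Rightarrow> nat" where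
  "power_time c 0 n = 8"
| "power_time c (Suc d) n = power_time c d n + multiply_time c n ((n + c) ^ d)"

definition power_store :: "nat \<Rightarrow> nat \<Rightarrow> nat list \<Rightarrow> store" where
  "power_store c d xs j = at_start (if j = input_tape then xs
    else if 5 \<le> j \<and> j \<le> power_tape d then unary ((length xs + c) ^ (j - 5)) else [])"

lemma runs_power_prog:
  assumes "0 \<notin> set xs"
  shows "runs (power_prog c d) ((\<lambda>_. at_start [])(input_tape := at_start xs))
    (power_time c d (length xs)) (power_store c d xs)"
proof (induction d)
  case 0
  let ?\<sigma> = "(\<lambda>_. at_start [])(input_tape := at_start xs)"
  have "runs (power_prog c 0) ?\<sigma> (2 + (3 * length [1 :: nat] + 3))
      (?\<sigma>(power_tape 0 := at_start [1]))"
    unfolding power_prog.simps by (rule runs_build[OF emits_append_sym]) simp_all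
  then show ?case by (rule runs_weaken) (auto simp: power_store_def fun_eq_iff)
next
  case (Suc d)
  have "runs (multiply c (power_tape d) (power_tape (Suc d))) (power_store c d xs)
      (multiply_time c (length xs) ((length xs + c) ^ d))
      ((power_store c d xs)(power_tape (Suc d) :=
        at_start (unary ((length xs + c) ^ d * (length xs + c)))))"
    by (rule runs_multiply) (simp_all add: assms power_store_def)
  moreover have "(power_store c d xs)(power_tape (Suc d) :=
      at_start (unary ((length xs + c) ^ d * (length xs + c)))) =
      power_store c (Suc d) xs"
    by (auto simp: power_store_def fun_eq_iff mult.commute le_Suc_eq)
  ultimately show ?case
    using runs_Seq[OF Suc] by simp
qed

lemma uses_tapes_power_prog: "power_tape d < k \<Longrightarrow> uses_tapes k (power_prog c d)"
  by (induction d) (auto simp: multiply_def)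

subsection \<open>The cell classes\<close>

fun class_sym :: "cell_class \<Rightarrow> nat" where
  "class_sym Border = 1"
| "class_sym Inner = 2"
| "class_sym Final = 3"
| "class_sym (Initial a h) = (if h then 7 else 4) + a"

definition sym_class :: "nat \<Rightarrow> cell_class" where
  "sym_class s = (if s = 1 then Border else if s = 2 then Inner else if s = 3 then Final
    else Initial ((s - 4) mod 3) (7 \<le> s))"

lemma contents_less_3: "contents x p < 3"
  by (simp add: contents_def)

definition valid_class :: "cell_class \<Rightarrow> bool" where
  "valid_class c \<longleftrightarrow> (\<forall>a h. c = Initial a h \<longrightarrow> a < 3)"

lemma sym_class_class_sym: "valid_class c \<Longrightarrow> sym_class (class_sym c) = c"
  by (cases c) (auto simp: sym_class_def valid_class_def)

lemma class_sym_bounds: "valid_class c \<Longrightarrow> 0 < class_sym c \<and> class_sym c < 10"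
  by (cases c) (auto simp: valid_class_def)

lemma valid_class_cell_classes: "c \<in> set (cell_classes N x) \<Longrightarrow> valid_class c"
  by (auto simp: cell_classes_def class_at_def valid_class_def contents_less_3
      simp del: upt_Suc split: if_splits)

lemma first_row_classes:
  "map (class_at N x 0) [- int N..int N] =
    replicate N (Initial 0 False) @ [Initial (contents x 0) True] @
    map (\<lambda>i. Initial (contents x (1 + int i)) False) [0..<N]"
proof (rule nth_equalityI)
  show "length (map (class_at N x 0) [- int N..int N]) = length (replicate N (Initial 0 False) @
      [Initial (contents x 0) True] @ map (\<lambda>i. Initial (contents x (1 + int i)) False) [0..<N])"
    by simp
  fix i assume "i < length (map (class_at N x 0) [- int N..int N])"
  then have i: "i < 2 * N + 1" by simp
  then have "map (class_at N x 0) [- int N..int N] ! i = class_at N x 0 (int i - int N)" by simp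
  also have "\<dots> = (replicate N (Initial 0 False) @ [Initial (contents x 0) True] @
      map (\<lambda>i. Initial (contents x (1 + int i)) False) [0..<N]) ! i"
  proof -
    consider "i < N" | "i = N" | j where "i = Suc (N + j)" "j < N"
      using i less_imp_Suc_add[of N i] by force
    then show ?thesis
      by cases (auto simp: class_at_def contents_def nth_append)
  qed
  finally show "map (class_at N x 0) [- int N..int N] ! i = (replicate N (Initial 0 False) @
      [Initial (contents x 0) True] @
      map (\<lambda>i. Initial (contents x (1 + int i)) False) [0..<N]) ! i" .
qed

lemma cell_classes_rows:
  "cell_classes N x = Border # map (class_at N x 0) [- int N..int N] @
    concat (replicate N (Border # replicate (2 * N + 1) Inner)) @
    Border # replicate (2 * N + 1) Final"
proof -
  have "length [- int N..int N] = 2 * N + 1" by simp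
  then have "map (class_at N x t) [- int N..int N] =
      replicate (2 * N + 1) (if t = N + 1 then Final else Inner)"
    if "t \<noteq> 0" for t
    using that by (intro replicate_eqI) (auto simp: class_at_def)
  moreover have "[0..<N + 2] = 0 # [1..<N + 1] @ [N + 1]" by (simp add: upt_conv_Cons)
  moreover have "map (\<lambda>t. Border # map (class_at N x t) [- int N..int N]) [1..<N + 1] =
      replicate N (Border # replicate (2 * N + 1) Inner)"
    using calculation(1) by (intro replicate_eqI) (auto simp del: replicate.simps)
  ultimately show ?thesis unfolding cell_classes_def by (simp del: upt_Suc replicate.simps)
qed

definition append_class :: "cell_class \<Rightarrow> com" where
  "append_class c = append_sym class_tape (class_sym c)"

definition row_prog :: "nat \<Rightarrow> cell_class \<Rightarrow> com" where
  "row_prog U c = append_class Border ;; append_class c ;; foreach U (append_class c) ;;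
    foreach U (append_class c)"

definition row_time :: "nat \<Rightarrow> nat" where
  "row_time N = 2 + 2 + foreach_time N 2 + foreach_time N 2"

definition read_class :: "bool \<Rightarrow> com" where
  "read_class h = switch input_tape 3 (\<lambda>a. append_class (Initial a h)) ;; Move input_tape Right"

definition first_row_prog :: "nat \<Rightarrow> com" where
  "first_row_prog U = append_class Border ;; foreach U (append_class (Initial 0 False)) ;;
    read_class True ;; foreach U (read_class False)"

definition first_row_time :: "nat \<Rightarrow> nat" where
  "first_row_time N = 2 + foreach_time N 2 + 9 + foreach_time N 9"

definition cells_prog :: "nat \<Rightarrow> com" where
  "cells_prog U =
    first_row_prog U ;; foreach rows_tape (row_prog U Inner) ;; row_prog U Final"

definition cells_time :: "nat \<Rightarrow> nat" where
  "cells_time N = first_row_time N + foreach_time N (row_time N) + row_time N"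

definition classes_prog :: "nat \<Rightarrow> com" where
  "classes_prog U = build class_tape (cells_prog U) ;;
    build count_tape (foreach class_tape (append_sym count_tape 1))"

definition classes_time :: "nat \<Rightarrow> nat" where
  "classes_time N = (let S = (N + 2) * (2 * N + 2) in
    cells_time N + (3 * S + 3) + (foreach_time S 2 + (3 * S + 3)))"

lemma emits_append_class: "emits class_tape (append_class c) \<sigma> 2 (map class_sym [c]) \<sigma>"
  unfolding append_class_def using emits_append_sym by simp

lemma emits_foreach_append_class:
  assumes "\<sigma> U = at_start (unary N)" "U \<noteq> class_tape"
  shows "emits class_tape (foreach U (append_class c)) \<sigma> (foreach_time N 2)
    (map class_sym (replicate N c)) \<sigma>"
  using emits_foreach_append_sym[of "unary N" U class_tape \<sigma>] assms by (simp add: append_class_def)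

lemma emits_row_prog:
  assumes "\<sigma> U = at_start (unary N)" "U \<noteq> class_tape"
  shows "emits class_tape (row_prog U c) \<sigma> (row_time N)
    (map class_sym (Border # replicate (2 * N + 1) c)) \<sigma>"
proof -
  have "emits class_tape (append_class Border) \<sigma> 2 (map class_sym [Border]) \<sigma>"
    by (rule emits_append_class)
  also have "emits class_tape (append_class c) \<sigma> 2 (map class_sym [c]) \<sigma>"
    by (rule emits_append_class)
  also have "emits class_tape (foreach U (append_class c)) \<sigma> (foreach_time N 2)
      (map class_sym (replicate N c)) \<sigma>"
    using assms by (rule emits_foreach_append_class)
  also have "emits class_tape (foreach U (append_class c)) \<sigma> (foreach_time N 2)
      (map class_sym (replicate N c)) \<sigma>"
    using assms by (rule emits_foreach_append_class)
  finally have "emits class_tape (row_prog U c) \<sigma> (row_time N)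
      (((map class_sym [Border] @ map class_sym [c]) @ map class_sym (replicate N c)) @
        map class_sym (replicate N c)) \<sigma>"
    unfolding row_prog_def row_time_def .
  moreover have "replicate (2 * N + 1) c = c # replicate N c @ replicate N c"
    by (simp flip: replicate_add add: mult_2)
  ultimately show ?thesis by simp
qed

lemma emits_read_class:
  assumes "\<sigma> input_tape = (contents x, p)"
  shows "emits class_tape (read_class h) \<sigma> 9 (map class_sym [Initial (contents x p) h])
    (\<sigma>(input_tape := (contents x, p + 1)))"
proof -
  have "emits class_tape (switch input_tape 3 (\<lambda>a. append_class (Initial a h))) \<sigma> (2 + 2 * 3)
      (map class_sym [Initial (contents x p) h]) \<sigma>"
    by (rule emits_switch)
      (use assms contents_less_3 emits_append_class[of "Initial (contents x p) h"] in simp_all)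
  also have "emits class_tape (Move input_tape Right) \<sigma> 1 [] (\<sigma>(input_tape := (contents x, p + 1)))"
    using emits_Move[of input_tape class_tape Right \<sigma>] assms by simp
  finally show ?thesis unfolding read_class_def by (rule emits_weaken) simp_all
qed

lemma emits_first_row_prog:
  assumes \<sigma>: "\<sigma> U = at_start (unary N)" "\<sigma> input_tape = (contents x, 0)"
    and U: "U \<noteq> class_tape" "U \<noteq> input_tape"
  shows "emits class_tape (first_row_prog U) \<sigma> (first_row_time N)
    (map class_sym (Border # map (class_at N x 0) [- int N..int N]))
    (\<sigma>(input_tape := (contents x, int N + 1)))"
proof -
  define F where "F i = \<sigma>(input_tape := (contents x, 1 + int i))" for i
  have "emits class_tape (append_class Border) \<sigma> 2 (map class_sym [Border]) \<sigma>"
    by (rule emits_append_class)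
  also have "emits class_tape (foreach U (append_class (Initial 0 False))) \<sigma> (foreach_time N 2)
      (map class_sym (replicate N (Initial 0 False))) \<sigma>"
    using \<sigma>(1) U(1) by (rule emits_foreach_append_class)
  also have "emits class_tape (read_class True) \<sigma> 9 (map class_sym [Initial (contents x 0) True])
      (F 0)"
    using emits_read_class[of \<sigma> x 0 True] \<sigma>(2) by (simp add: F_def)
  also have "emits class_tape (foreach U (read_class False)) (F 0)
      (foreach_time (length (unary N)) 9)
      (concat (map (\<lambda>i. map class_sym [Initial (contents x (1 + int i)) False])
        [0..<length (unary N)]))
      (F (length (unary N)))"
  proof (rule emits_foreach)
    show "F 0 U = at_start (unary N)" "F (length (unary N)) U = at_start (unary N)"
      using \<sigma> U by (simp_all add: F_def)
    show "emits class_tape (read_class False) ((F i)(U := (list_tape (unary N), int i))) 9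
        (map class_sym [Initial (contents x (1 + int i)) False])
        ((F (Suc i))(U := (list_tape (unary N), int i)))" for i
      using emits_read_class[of "(F i)(U := (list_tape (unary N), int i))" x "1 + int i" False] U
      by (simp add: F_def fun_upd_twist)
  qed (use U in auto)
  finally show ?thesis
    unfolding first_row_prog_def first_row_time_def
    by (rule emits_weaken) (simp_all add: F_def first_row_classes comp_def add.commute)
qed

lemma emits_cells_prog:
  assumes \<sigma>: "\<sigma> U = at_start (unary N)" "\<sigma> rows_tape = at_start (unary N)"
      "\<sigma> input_tape = (contents x, 0)" and U: "rows_tape < U"
  shows "emits class_tape (cells_prog U) \<sigma> (cells_time N) (map class_sym (cell_classes N x))
    (\<sigma>(input_tape := (contents x, int N + 1)))"
proof -
  define \<sigma>' where "\<sigma>' = \<sigma>(input_tape := (contents x, int N + 1))"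
  have \<sigma>': "\<sigma>' U = at_start (unary N)" "\<sigma>' rows_tape = at_start (unary N)"
    using \<sigma> U by (simp_all add: \<sigma>'_def)
  let ?row = "\<lambda>c. map class_sym (Border # replicate (2 * N + 1) c)"
  have "emits class_tape (first_row_prog U) \<sigma> (first_row_time N)
      (map class_sym (Border # map (class_at N x 0) [- int N..int N])) \<sigma>'"
    unfolding \<sigma>'_def by (rule emits_first_row_prog) (use \<sigma> U in auto)
  also have "emits class_tape (foreach rows_tape (row_prog U Inner)) \<sigma>'
      (foreach_time (length (unary N)) (row_time N))
      (concat (map (\<lambda>_. ?row Inner) [0..<length (unary N)])) \<sigma>'"
  proof (rule emits_foreach_const)
    show "emits class_tape (row_prog U Inner) (\<sigma>'(rows_tape := (list_tape (unary N), int k)))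
        (row_time N) (?row Inner) (\<sigma>'(rows_tape := (list_tape (unary N), int k)))" for k
      using \<sigma>' U by (intro emits_row_prog) auto
  qed (use \<sigma>' in auto)
  also have "emits class_tape (row_prog U Final) \<sigma>' (row_time N) (?row Final) \<sigma>'"
    by (rule emits_row_prog) (use \<sigma>' U in auto)
  finally show ?thesis
    unfolding cells_prog_def cells_time_def
    by (rule emits_weaken)
      (simp_all add: \<sigma>'_def cell_classes_rows map_concat map_replicate_const del: replicate.simps)
qed

lemma runs_classes_prog:
  assumes \<sigma>: "\<sigma> U = at_start (unary N)" "\<sigma> rows_tape = at_start (unary N)"
      "\<sigma> input_tape = (contents x, 0)" "\<sigma> class_tape = at_start []" "\<sigma> count_tape = at_start []"
    and U: "rows_tape < U"
  defines "cs \<equiv> map class_sym (cell_classes N x)"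
  shows "runs (classes_prog U) \<sigma> (classes_time N) (\<sigma>(input_tape := (contents x, int N + 1),
    class_tape := at_start cs, count_tape := at_start (unary (length cs))))"
proof -
  have nonzero: "0 \<notin> set cs"
    using class_sym_bounds valid_class_cell_classes by (fastforce simp: cs_def)
  let ?\<sigma> = "\<sigma>(input_tape := (contents x, int N + 1), class_tape := at_start cs)"
  have "emits class_tape (cells_prog U) \<sigma> (cells_time N) cs
      (\<sigma>(input_tape := (contents x, int N + 1)))"
    unfolding cs_def using \<sigma>(1-3) U by (rule emits_cells_prog)
  then have "runs (build class_tape (cells_prog U)) \<sigma> (cells_time N + (3 * length cs + 3)) ?\<sigma>"
    using nonzero \<sigma>(4) by (rule runs_build)
  also have "runs (build count_tape (foreach class_tape (append_sym count_tape 1))) ?\<sigma>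
      (foreach_time (length cs) 2 + (3 * length cs + 3))
      (?\<sigma>(count_tape := at_start (unary (length cs))))"
    by (rule runs_build_copy[OF nonzero]) (use \<sigma> in simp_all)
  finally show ?thesis
    unfolding classes_prog_def classes_time_def Let_def
    by (rule runs_weaken_time) (simp add: cs_def length_cell_classes)
qed

lemma uses_tapes_classes_prog: "rows_tape < U \<Longrightarrow> U < k \<Longrightarrow> uses_tapes k (classes_prog U)"
  by (auto simp: classes_prog_def cells_prog_def first_row_prog_def row_prog_def read_class_def
    append_class_def)

subsection \<open>The ruler\<close>

abbreviation (input) mark_same :: nat where "mark_same \<equiv> 1"
abbreviation (input) mark_right :: nat where "mark_right \<equiv> 2"
abbreviation (input) mark_left :: nat where "mark_left \<equiv> 3"
abbreviation (input) mark_above :: nat where "mark_above \<equiv> 4"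
abbreviation (input) mark_below :: nat where "mark_below \<equiv> 5"

definition ruler :: "nat \<Rightarrow> int \<Rightarrow> nat" where
  "ruler W = (\<lambda>_. 0)(0 := mark_same, 1 := mark_right, - 1 := mark_left,
    int W := mark_above, - int W := mark_below)"

lemma ruler_less: "ruler W i < 6"
  by (simp add: ruler_def)

lemma ruler_eq_iff:
  assumes "W \<ge> 2"
  shows "ruler W (int t - int s) = mark_same \<longleftrightarrow> t = s"
    "ruler W (int t - int s) = mark_right \<longleftrightarrow> t = s + 1"
    "ruler W (int t - int s) = mark_left \<longleftrightarrow> s = t + 1"
    "ruler W (int t - int s) = mark_above \<longleftrightarrow> t = s + W"
    "ruler W (int t - int s) = mark_below \<longleftrightarrow> s = t + W"
  using assms by (auto simp: ruler_def)

definition shift_prog :: "nat \<Rightarrow> move \<Rightarrow> com" where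
  "shift_prog U d =
    Move ruler_tape d ;; foreach U (Move ruler_tape d) ;; foreach U (Move ruler_tape d)"

definition shift_time :: "nat \<Rightarrow> nat" where
  "shift_time N = 1 + foreach_time N 1 + foreach_time N 1"

definition ruler_prog :: "nat \<Rightarrow> com" where
  "ruler_prog U = Write ruler_tape mark_same ;;
    Move ruler_tape Right ;; Write ruler_tape mark_right ;;
    shift_prog U Right ;; Write ruler_tape mark_above ;;
    shift_prog U Left ;; Move ruler_tape Left ;; Move ruler_tape Left ;;
    Write ruler_tape mark_left ;;
    shift_prog U Left ;; Write ruler_tape mark_below ;;
    shift_prog U Right ;; Move ruler_tape Right"

definition ruler_time :: "nat \<Rightarrow> nat" where
  "ruler_time N = 9 + 4 * shift_time N"

lemma runs_shift_prog:
  assumes "\<sigma> U = at_start (unary N)" "U \<noteq> ruler_tape"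
  shows "runs (shift_prog U d) (\<sigma>(ruler_tape := (w, p))) (shift_time N)
    (\<sigma>(ruler_tape := (w, p + (2 * int N + 1) * move_head d 0)))"
proof -
  let ?o = "move_head d 0"
  have loop: "runs (foreach U (Move ruler_tape d)) (\<sigma>(ruler_tape := (w, p))) (foreach_time N 1)
      (\<sigma>(ruler_tape := (w, p + int N * ?o)))" for p
    using runs_foreach_Move[of "unary N" \<sigma> U ruler_tape d w p] assms by simp
  have "runs (Move ruler_tape d) (\<sigma>(ruler_tape := (w, p))) 1 (\<sigma>(ruler_tape := (w, p + ?o)))"
    by (rule runs_Move_at)
  also have "runs (foreach U (Move ruler_tape d)) \<dots> (foreach_time N 1)
      (\<sigma>(ruler_tape := (w, p + ?o + int N * ?o)))"
    by (rule loop)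
  also have "runs (foreach U (Move ruler_tape d)) \<dots> (foreach_time N 1)
      (\<sigma>(ruler_tape := (w, p + ?o + int N * ?o + int N * ?o)))"
    by (rule loop)
  finally show ?thesis
    unfolding shift_prog_def shift_time_def by (rule runs_weaken) (simp_all add: algebra_simps)
qed

lemma runs_ruler_prog:
  assumes "\<sigma> U = at_start (unary N)" "U \<noteq> ruler_tape" "\<sigma> ruler_tape = at_start []"
  shows "runs (ruler_prog U) \<sigma> (ruler_time N) (\<sigma>(ruler_tape := (ruler (2 * N + 2), 0)))"
proof -
  define place :: "int \<Rightarrow> (int \<Rightarrow> nat) \<Rightarrow> store" where "place p w = \<sigma>(ruler_tape := (w, p))" for p w
  have start: "\<sigma> = place 0 (\<lambda>_. 0)"
    using assms(3) by (auto simp: place_def fun_eq_iff list_tape_def)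
  have move: "runs (Move ruler_tape d) (place p w) 1 (place (p + move_head d 0) w)" for d p w
    unfolding place_def by (rule runs_Move_at)
  have mark: "runs (Write ruler_tape s) (place p w) 1 (place p (w(p := s)))" for s p w
    unfolding place_def by (rule runs_Write_at)
  have shift: "runs (shift_prog U d) (place p w) (shift_time N)
      (place (p + (2 * int N + 1) * move_head d 0) w)"
    for d p w
    unfolding place_def using assms(1,2) by (rule runs_shift_prog)
  note mark[of mark_same 0 "\<lambda>_. 0"]
  also note move[of Right]
  also note mark[of mark_right]
  also note shift[of Right]
  also note mark[of mark_above]
  also note shift[of Left]
  also note move[of Left]
  also note move[of Left]
  also note mark[of mark_left]
  also note shift[of Left]
  also note mark[of mark_below]
  also note shift[of Right]
  also note move[of Right]
  finally have "runs (ruler_prog U) \<sigma> (ruler_time N)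
      (place 0 ((\<lambda>_. 0)(0 := mark_same, 1 := mark_right, 2 * int N + 2 := mark_above,
        - 1 := mark_left, - (2 * int N + 2) := mark_below)))"
    unfolding ruler_prog_def start[symmetric]
    by (rule runs_weaken) (simp_all add: ruler_time_def algebra_simps)
  moreover have "(\<lambda>_. 0)(0 := mark_same, 1 := mark_right, 2 * int N + 2 := mark_above,
        - 1 := mark_left, - (2 * int N + 2) := mark_below) = ruler (2 * N + 2)"
    by (auto simp: ruler_def fun_eq_iff)
  ultimately show ?thesis by (simp add: place_def)
qed

lemma uses_tapes_ruler_prog: "ruler_tape < k \<Longrightarrow> U < k \<Longrightarrow> uses_tapes k (ruler_prog U)"
  by (simp add: ruler_prog_def shift_prog_def)

subsection \<open>The matrix\<close>

text \<open>
  The entry \<open>f s r k k'\<close> depends on the symbol \<open>s\<close> of the cell of the row, the mark \<open>r\<close> at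
  the distance to the cell of the column and the positions \<open>k\<close>, \<open>k'\<close> of row and column
  within their cells.
\<close>

definition block_prog :: "nat \<Rightarrow> nat \<Rightarrow> (nat \<Rightarrow> nat \<Rightarrow> nat \<Rightarrow> nat \<Rightarrow> nat) \<Rightarrow> nat \<Rightarrow> com" where
  "block_prog out K f k = repeat K (\<lambda>k'. switch class_tape 10 (\<lambda>s. switch ruler_tape 6 (\<lambda>r.
    append_sym out (f s r k k'))))"

definition line_prog :: "nat \<Rightarrow> nat \<Rightarrow> (nat \<Rightarrow> nat \<Rightarrow> nat \<Rightarrow> nat \<Rightarrow> nat) \<Rightarrow> nat \<Rightarrow> com" where
  "line_prog out K f k = foreach count_tape (block_prog out K f k ;; Move ruler_tape Right) ;;
    foreach count_tape (Move ruler_tape Left)"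

definition matrix_prog :: "nat \<Rightarrow> nat \<Rightarrow> (nat \<Rightarrow> nat \<Rightarrow> nat \<Rightarrow> nat \<Rightarrow> nat) \<Rightarrow> com" where
  "matrix_prog out K f = foreach class_tape (repeat K (line_prog out K f) ;; Move ruler_tape Left)"

definition line_time :: "nat \<Rightarrow> nat \<Rightarrow> nat" where
  "line_time K S = foreach_time S (K * 34 + 1) + foreach_time S 1"

definition matrix_time :: "nat \<Rightarrow> nat \<Rightarrow> nat" where
  "matrix_time K S = foreach_time S (K * line_time K S + 1)"

definition block :: "nat \<Rightarrow> (nat \<Rightarrow> nat \<Rightarrow> nat \<Rightarrow> nat \<Rightarrow> nat) \<Rightarrow> nat \<Rightarrow> nat \<Rightarrow> nat \<Rightarrow> nat list" where
  "block K f s r k = map (f s r k) [0..<K]"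

definition line ::
  "nat \<Rightarrow> (nat \<Rightarrow> nat \<Rightarrow> nat \<Rightarrow> nat \<Rightarrow> nat) \<Rightarrow> (int \<Rightarrow> nat) \<Rightarrow> nat list \<Rightarrow> nat \<Rightarrow> nat \<Rightarrow> nat list" where
  "line K f w xs i k = concat (map (\<lambda>i'. block K f (xs ! i) (w (int i' - int i)) k)
      [0..<length xs])"

definition matrix ::
  "nat \<Rightarrow> (nat \<Rightarrow> nat \<Rightarrow> nat \<Rightarrow> nat \<Rightarrow> nat) \<Rightarrow> (int \<Rightarrow> nat) \<Rightarrow> nat list \<Rightarrow> nat list" where
  "matrix K f w xs = concat (map (\<lambda>i. concat (map (line K f w xs i) [0..<K])) [0..<length xs])"

context
  fixes out :: nat and w :: "int \<Rightarrow> nat" and xs :: "nat list"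
  assumes out: "out \<notin> {class_tape, count_tape, ruler_tape}"
    and w_less: "\<And>i. w i < 6" and xs_less: "\<And>s. s \<in> set xs \<Longrightarrow> 0 < s \<and> s < 10"
begin

lemma nonzero: "0 \<notin> set xs"
  using xs_less by blast

lemma emits_block_prog:
  assumes "\<sigma> class_tape = (list_tape xs, int i)" "i < length xs" "\<sigma> ruler_tape = (w, p)"
  shows "emits out (block_prog out K f k) \<sigma> (K * 34) (block K f (xs ! i) (w p) k) \<sigma>"
proof -
  have read: "read_tape (\<sigma> class_tape) = xs ! i" "read_tape (\<sigma> ruler_tape) = w p"
    using assms by (simp_all add: list_tape_nth)
  have mark: "emits out (switch ruler_tape 6 (\<lambda>r. append_sym out (f (xs ! i) r k k'))) \<sigma> (2 + 2 * 6)
      [f (xs ! i) (w p) k k'] \<sigma>" for k'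
    using out w_less by (intro emits_switch) (simp_all add: read emits_append_sym)
  have "emits out
      (switch class_tape 10 (\<lambda>s. switch ruler_tape 6 (\<lambda>r. append_sym out (f s r k k')))) \<sigma>
      (2 + 2 * 6 + 2 * 10) [f (xs ! i) (w p) k k'] \<sigma>" for k'
    using out xs_less[OF nth_mem[OF assms(2)]] mark[of k']
    by (intro emits_switch[where i = class_tape]) (simp_all add: read del: One_nat_def)
  then have "emits out (block_prog out K f k) \<sigma> (K * (2 + 2 * 6 + 2 * 10))
      (concat (map (\<lambda>k'. [f (xs ! i) (w p) k k']) [0..<K])) \<sigma>"
    unfolding block_prog_def by (rule emits_repeat)
  then show ?thesis by (simp add: block_def)
qed

lemma emits_line_prog:
  assumes \<sigma>: "\<sigma> class_tape = (list_tape xs, int i)" "\<sigma> count_tape = at_start (unary (length xs))"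
      "\<sigma> ruler_tape = (w, - int i)" and i: "i < length xs"
  shows "emits out (line_prog out K f k) \<sigma> (line_time K (length xs)) (line K f w xs i k) \<sigma>"
proof -
  define F where "F n = \<sigma>(ruler_tape := (w, int n - int i))" for n
  have F0: "\<sigma> = F 0" using \<sigma>(3) by (simp add: F_def fun_upd_idem)
  let ?units = "unary (length xs)"
  have "emits out (foreach count_tape (block_prog out K f k ;; Move ruler_tape Right)) (F 0)
      (foreach_time (length ?units) (K * 34 + 1))
      (concat (map (\<lambda>i'. block K f (xs ! i) (w (int i' - int i)) k) [0..<length ?units]))
      (F (length ?units))"
  proof (rule emits_foreach)
    show "F 0 count_tape = at_start ?units" "F (length ?units) count_tape = at_start ?units"
      using \<sigma>(2) by (simp_all add: F_def)
    fix n
    let ?F = "\<lambda>m. (F m)(count_tape := (list_tape ?units, int n))"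
    have "emits out (block_prog out K f k) (?F n) (K * 34)
        (block K f (xs ! i) (w (int n - int i)) k) (?F n)"
      using \<sigma>(1) i by (intro emits_block_prog) (simp_all add: F_def)
    also have "emits out (Move ruler_tape Right) (?F n) 1 [] (?F (Suc n))"
      using emits_Move[of ruler_tape out Right "?F n"] out
      by (simp add: F_def fun_upd_twist algebra_simps)
    finally show "emits out (block_prog out K f k ;; Move ruler_tape Right) (?F n) (K * 34 + 1)
        (block K f (xs ! i) (w (int n - int i)) k) (?F (Suc n))" by simp
  qed (use out in auto)
  also have "emits out (foreach count_tape (Move ruler_tape Left)) (F (length ?units))
      (foreach_time (length ?units) 1) [] (F 0)"
  proof (rule emits_if_runs)
    show "runs (foreach count_tape (Move ruler_tape Left)) ((F (length ?units))(out := tp))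
        (foreach_time (length ?units) 1) ((F 0)(out := tp))" for tp
      using runs_foreach_Move[of ?units "\<sigma>(out := tp)" count_tape ruler_tape Left w
          "int (length xs) - int i"] \<sigma>(2) out
      by (simp add: F_def fun_upd_twist)
  qed
  finally show ?thesis
    unfolding F0[symmetric] line_prog_def
    by (rule emits_weaken) (simp_all add: line_time_def line_def)
qed

lemma runs_matrix_prog:
  assumes \<sigma>: "\<sigma> class_tape = at_start xs" "\<sigma> count_tape = at_start (unary (length xs))"
      "\<sigma> ruler_tape = (w, 0)" "\<sigma> out = at_end []"
  shows "runs (matrix_prog out K f) \<sigma> (matrix_time K (length xs))
    (\<sigma>(ruler_tape := (w, - int (length xs)), out := at_end (matrix K f w xs)))"
proof -
  define F where "F i = \<sigma>(ruler_tape := (w, - int i))" for i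
  have "emits out (matrix_prog out K f) (F 0)
      (foreach_time (length xs) (K * line_time K (length xs) + 1))
      (concat (map (\<lambda>i. concat (map (line K f w xs i) [0..<K])) [0..<length xs])) (F (length xs))"
    unfolding matrix_prog_def
  proof (rule emits_foreach)
    show "F 0 class_tape = at_start xs" "F (length xs) class_tape = at_start xs"
      using \<sigma>(1) by (simp_all add: F_def)
    fix i assume i: "i < length xs"
    let ?F = "\<lambda>m. (F m)(class_tape := (list_tape xs, int i))"
    have "emits out (repeat K (line_prog out K f)) (?F i) (K * line_time K (length xs))
        (concat (map (line K f w xs i) [0..<K])) (?F i)"
      using \<sigma>(2) i by (intro emits_repeat emits_line_prog) (simp_all add: F_def)
    also have "emits out (Move ruler_tape Left) (?F i) 1 [] (?F (Suc i))"
      by (rule emits_weaken[OF emits_Move]) (use out in \<open>auto simp: F_def fun_eq_iff\<close>)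
    finally show "emits out (repeat K (line_prog out K f) ;; Move ruler_tape Left) (?F i)
        (K * line_time K (length xs) + 1) (concat (map (line K f w xs i) [0..<K])) (?F (Suc i))"
      by simp
  qed (use out nonzero in auto)
  then have "runs (matrix_prog out K f) ((F 0)(out := at_end [])) (matrix_time K (length xs))
      ((F (length xs))(out := at_end ([] @ matrix K f w xs)))"
    unfolding emits_def matrix_time_def matrix_def by blast
  moreover have "(F 0)(out := at_end []) = \<sigma>" using \<sigma>(3,4) by (simp add: F_def fun_upd_idem)
  ultimately show ?thesis by (simp add: F_def)
qed

end

lemma uses_tapes_matrix_prog: "ruler_tape < k \<Longrightarrow> out < k \<Longrightarrow> uses_tapes k (matrix_prog out K f)"
  by (auto simp: matrix_prog_def line_prog_def block_prog_def)

subsection \<open>The entries of the adjacency matrix\<close>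

definition path_link :: "nat \<Rightarrow> nat \<Rightarrow> nat \<Rightarrow> nat \<Rightarrow> bool" where
  "path_link b j b' j' \<longleftrightarrow> b' = b \<and> j' = Suc j"

definition side_link :: "nat \<Rightarrow> nat \<Rightarrow> nat \<Rightarrow> nat \<Rightarrow> nat \<Rightarrow> nat \<Rightarrow> bool" where
  "side_link m g b j b' j' \<longleftrightarrow>
    j = path_len m - 1 \<and> j' = 0 \<and> (\<exists>i < m. b = (g + 1) * m + i \<and> b' = g * m + i)"

definition clause_link :: "nat \<Rightarrow> ((nat \<Rightarrow> bool) \<Rightarrow> bool) \<Rightarrow> nat \<Rightarrow> nat \<Rightarrow> nat \<Rightarrow> nat \<Rightarrow> bool" where
  "clause_link m p b j b' j' \<longleftrightarrow> b' = Suc b mod (4 * m) \<and>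
    (\<exists>a < 2 ^ (4 * m). \<not> p (bit a) \<and> j = clause_pos a b \<and> j' = clause_pos a b')"

definition cell_arc :: "nat \<Rightarrow> ((nat \<Rightarrow> bool) \<Rightarrow> bool) \<Rightarrow> nat \<Rightarrow> nat \<Rightarrow> nat \<Rightarrow> nat \<Rightarrow> nat \<Rightarrow> bool" where
  "cell_arc m p r b j b' j' \<longleftrightarrow>
    r = mark_same \<and> (path_link b j b' j' \<or> path_link b' j' b j \<or> clause_link m p b j b' j') \<or>
    r = mark_right \<and> side_link m 0 b j b' j' \<or> r = mark_left \<and> side_link m 0 b' j' b j \<or>
    r = mark_above \<and> side_link m 2 b j b' j' \<or> r = mark_below \<and> side_link m 2 b' j' b j"

lemma vertex_in_digons_iff:
  assumes "b < 4 * m" "j < path_len m" "b' < 4 * m" "j' < path_len m"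
  shows "(vertex m s b j, vertex m s' b' j') \<in> digons m W \<longleftrightarrow>
    s' = s \<and> path_link b j b' j' \<or> s' = s + 1 \<and> side_link m 0 b j b' j' \<or>
    s' = s + W \<and> side_link m 2 b j b' j'" (is "_ \<longleftrightarrow> ?link")
proof
  assume "(vertex m s b j, vertex m s' b' j') \<in> digons m W"
  then show ?link
    using assms path_len_pos[of m]
    by (cases rule: digonsE) (auto simp: vertex_eq_iff path_link_def side_link_def)
next
  assume ?link
  then show "(vertex m s b j, vertex m s' b' j') \<in> digons m W"
    using assms digons_pathI digons_rightI digons_topI
    by (auto simp: path_link_def side_link_def)
qed

lemma vertex_in_clause_arcs_iff:
  assumes "b < 4 * m" "j < path_len m" "b' < 4 * m" "j' < path_len m"
  shows "(vertex m s b j, vertex m s' b' j') \<in> clause_arcs m ok cs \<longleftrightarrow>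
    s' = s \<and> clause_link m (ok (cs ! s)) b j b' j'" (is "_ \<longleftrightarrow> ?link")
proof
  assume "(vertex m s b j, vertex m s' b' j') \<in> clause_arcs m ok cs"
  then obtain t a c where "\<not> ok (cs ! t) (bit a)" "a < 2 ^ (4 * m)" "c < 4 * m"
    "vertex m s b j = vertex m t c (clause_pos a c)"
    "vertex m s' b' j' = vertex m t (Suc c mod (4 * m)) (clause_pos a (Suc c mod (4 * m)))"
    by (rule clause_arcsE)
  moreover from this have "Suc c mod (4 * m) < 4 * m" by simp
  ultimately show ?link
    using assms
    by (auto simp: vertex_eq_iff clause_pos_less clause_link_def simp del: mod_less_divisor)
next
  assume ?link
  then show "(vertex m s b j, vertex m s' b' j') \<in> clause_arcs m ok cs"
    using assms(1) by (auto simp: clause_link_def intro: clause_arcsI)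
qed

lemma parcs_grid_digraph_iff:
  assumes "W \<ge> 2" "s < length cs" "s' < length cs"
    and less: "b < 4 * m" "j < path_len m" "b' < 4 * m" "j' < path_len m"
  shows "(vertex m s b j, vertex m s' b' j') \<in> parcs (grid_digraph m ok W cs) \<longleftrightarrow>
    cell_arc m (ok (cs ! s)) (ruler W (int s' - int s)) b j b' j'"
  unfolding cell_arc_def ruler_eq_iff[OF assms(1)]
  using assms(2,3) vertex_less_iff[OF less(1,2), of s "length cs"]
    vertex_less_iff[OF less(3,4), of s' "length cs"]
    vertex_in_digons_iff[OF less, of s s' W]
    vertex_in_digons_iff[OF less(3,4,1,2), of s' s W]
    vertex_in_clause_arcs_iff[OF less, of s s' ok cs]
  by (auto simp: parcs_grid_digraph)

definition entry :: "nat \<Rightarrow> (cell_class \<Rightarrow> (nat \<Rightarrow> bool) \<Rightarrow> bool) \<Rightarrow> nat \<Rightarrow> nat \<Rightarrow> nat \<Rightarrow> nat \<Rightarrow> nat" where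
  "entry m ok s r k k' = (if cell_arc m (ok (sym_class s)) r
    (k div path_len m) (k mod path_len m) (k' div path_len m) (k' mod path_len m) then 2 else 1)"

lemma entry_eq:
  assumes "W \<ge> 2" "s < length cs" "s' < length cs" "k < cell_size m" "k' < cell_size m"
    and valid: "\<And>c. c \<in> set cs \<Longrightarrow> valid_class c"
  shows "entry m ok (map class_sym cs ! s) (ruler W (int s' - int s)) k k' =
    (if (s * cell_size m + k, s' * cell_size m + k') \<in> parcs (grid_digraph m ok W cs)
     then 2 else 1)"
proof -
  have "s * cell_size m + k = vertex m s (k div path_len m) (k mod path_len m)" for s k
    by (simp add: vertex_def)
  moreover have "k div path_len m < 4 * m" if "k < cell_size m" for k
    using that unfolding cell_size_def by (rule less_mult_imp_div_less)
  ultimately show ?thesis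
    using assms path_len_pos
    by (simp add: entry_def sym_class_class_sym parcs_grid_digraph_iff)
qed

lemma upt_mult: "[0..<n * k] = concat (map (\<lambda>s. map (\<lambda>i. s * k + i) [0..<k]) [0..<n])"
proof (induction n)
  case (Suc n)
  have "[0..<Suc n * k] = [0..<n * k] @ [n * k..<n * k + k]"
    using upt_add_eq_append[of 0 "n * k" k] by (simp add: add.commute)
  also have "[n * k..<n * k + k] = map (\<lambda>i. n * k + i) [0..<k]"
    using map_add_upt[of "n * k" k] by (simp add: add.commute)
  finally show ?case using Suc by simp
qed simp

lemma concat_concat: "concat (concat xsss) = concat (map concat xsss)"
  by (induction xsss) simp_all

lemma matrix_eq_adjacency_string:
  assumes "W \<ge> 2" and valid: "\<And>c. c \<in> set cs \<Longrightarrow> valid_class c"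
  shows "matrix (cell_size m) (entry m ok) (ruler W) (map class_sym cs) =
    map (\<lambda>b. if b then 2 else 1) (adjacency_string (grid_digraph m ok W cs))"
proof -
  let ?K = "cell_size m" and ?G = "grid_digraph m ok W cs" and ?S = "length cs"
  define e :: "nat \<Rightarrow> nat \<Rightarrow> nat" where "e = (\<lambda>v w. if (v, w) \<in> parcs ?G then 2 else 1)"
  have e_eq: "e (s * ?K + k) (s' * ?K + k') =
      entry m ok (class_sym (cs ! s)) (ruler W (int s' - int s)) k k'"
    if "s < ?S" "s' < ?S" "k < ?K" "k' < ?K" for s s' k k'
    using entry_eq[OF assms(1) that valid, where ok = ok] that by (simp add: e_def)
  have "map (\<lambda>b. if b then 2 else 1) (adjacency_string ?G) =
      concat (map (\<lambda>v. map (e v) [0..<?S * ?K]) [0..<?S * ?K])"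
    by (simp add: adjacency_string_def Let_def pverts_grid_digraph product_concat_map map_concat
      comp_def e_def)
  also have "\<dots> = concat (map (\<lambda>s. concat (map (\<lambda>k. concat (map (\<lambda>s'.
      map (\<lambda>k'. e (s * ?K + k) (s' * ?K + k')) [0..<?K]) [0..<?S])) [0..<?K])) [0..<?S])"
    by (simp add: upt_mult concat_concat map_concat comp_def)
  also have "\<dots> = matrix ?K (entry m ok) (ruler W) (map class_sym cs)"
    unfolding matrix_def line_def block_def length_map
    by (intro arg_cong[where f = concat] map_cong refl) (simp add: e_eq)
  finally show ?thesis by simp
qed

section \<open>Polynomial time\<close>

definition poly_fun :: "(nat \<Rightarrow> nat) \<Rightarrow> bool" where
  "poly_fun f \<longleftrightarrow> (\<exists>p. \<forall>n. f n = poly p n)"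

lemma poly_fun_const: "poly_fun (\<lambda>_. c)"
  unfolding poly_fun_def by (rule exI[of _ "[:c:]"]) simp

lemma poly_fun_id: "poly_fun (\<lambda>n. n)"
  unfolding poly_fun_def by (rule exI[of _ "[:0, 1:]"]) simp

lemma poly_fun_add: "poly_fun f \<Longrightarrow> poly_fun g \<Longrightarrow> poly_fun (\<lambda>n. f n + g n)"
  unfolding poly_fun_def by (metis poly_add)

lemma poly_fun_mult: "poly_fun f \<Longrightarrow> poly_fun g \<Longrightarrow> poly_fun (\<lambda>n. f n * g n)"
  unfolding poly_fun_def by (metis poly_mult)

lemma poly_fun_power: "poly_fun f \<Longrightarrow> poly_fun (\<lambda>n. f n ^ d)"
  unfolding poly_fun_def by (metis poly_power)

lemmas poly_fun_intros = poly_fun_const poly_fun_id poly_fun_add poly_fun_mult poly_fun_power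

lemma poly_fun_power_time: "poly_fun (power_time c d)"
proof (induction d)
  case 0
  then show ?case using poly_fun_const[of 8] by (simp add: poly_fun_def)
next
  case (Suc d)
  have "poly_fun (\<lambda>n. power_time c d n + multiply_time c n ((n + c) ^ d))"
    unfolding multiply_time_def foreach_time_def by (intro poly_fun_intros Suc)
  then show ?case by (simp add: poly_fun_def)
qed

lemma poly_less_power: "\<exists>c d. c \<ge> 1 \<and> (\<forall>n. poly p n < (n + c) ^ d)" for p :: "nat poly"
proof (induction p)
  case 0
  show ?case by (rule exI[of _ 1]) (auto intro: exI[of _ 0])
next
  case (pCons a p)
  then obtain c d where c: "c \<ge> 1" "\<And>n. poly p n < (n + c) ^ d" by blast
  have "poly (pCons a p) n < (n + (a + c)) ^ Suc d" for n
  proof -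
    let ?Y = "(n + (a + c)) ^ d"
    have "(n + c) ^ d \<le> ?Y" by (rule power_mono) auto
    then have "poly p n \<le> ?Y" using c(2)[of n] by linarith
    moreover have pos: "?Y \<ge> 1" using c(1) by simp
    ultimately have "poly (pCons a p) n \<le> a * ?Y + n * ?Y"
      by (auto intro!: add_mono mult_le_mono2)
    also have "\<dots> < a * ?Y + n * ?Y + c * ?Y" using c(1) pos by simp
    also have "\<dots> = (n + (a + c)) ^ Suc d" by (simp add: algebra_simps)
    finally show ?thesis .
  qed
  then show ?case using c(1) by (intro exI[of _ "a + c"] exI[of _ "Suc d"]) auto
qed

definition setup_prog :: "nat \<Rightarrow> nat \<Rightarrow> com" where
  "setup_prog c d = power_prog c d ;;
    build rows_tape (foreach (power_tape d) (append_sym rows_tape 1)) ;;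
    classes_prog (power_tape d) ;; ruler_prog (power_tape d)"

definition setup_time :: "nat \<Rightarrow> nat \<Rightarrow> nat \<Rightarrow> nat" where
  "setup_time c d n = (let N = (n + c) ^ d in
    power_time c d n + (foreach_time N 2 + (3 * N + 3)) + classes_time N + ruler_time N)"

lemma runs_setup_prog:
  fixes x :: "bool list" and c d :: nat
  defines "N \<equiv> (length x + c) ^ d"
  defines "cs \<equiv> map class_sym (cell_classes N x)"
  shows "\<exists>\<sigma>. runs (setup_prog c d) (init_store x) (setup_time c d (length x)) \<sigma> \<and>
    \<sigma> class_tape = at_start cs \<and> \<sigma> count_tape = at_start (unary (length cs)) \<and>
    \<sigma> ruler_tape = (ruler (2 * N + 2), 0) \<and> \<sigma> (power_tape (Suc d)) = at_end []"
proof -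
  define xs :: "nat list" where "xs = map (\<lambda>b. if b then 2 else 1) x"
  have xs: "0 \<notin> set xs" "length xs = length x" "list_tape xs = contents x"
    by (auto simp: xs_def contents_eq)
  define \<sigma>1 where "\<sigma>1 = power_store c d xs"
  define \<sigma>2 where "\<sigma>2 = \<sigma>1(rows_tape := at_start (unary N))"
  define \<sigma>3 where "\<sigma>3 = \<sigma>2(input_tape := (contents x, int N + 1), class_tape := at_start cs,
    count_tape := at_start (unary (length cs)))"
  define \<sigma>4 where "\<sigma>4 = \<sigma>3(ruler_tape := (ruler (2 * N + 2), 0))"
  note \<sigma>_defs = \<sigma>1_def \<sigma>2_def \<sigma>3_def \<sigma>4_def power_store_def xs N_def
  have "init_store x = (\<lambda>_. at_start [])(input_tape := at_start xs)"
    by (simp add: init_store_def contents_eq xs_def)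
  then have "runs (power_prog c d) (init_store x) (power_time c d (length x)) \<sigma>1"
    using runs_power_prog[OF xs(1), of c d] by (simp add: \<sigma>1_def xs(2))
  also have "runs (build rows_tape (foreach (power_tape d) (append_sym rows_tape 1))) \<sigma>1
      (foreach_time N 2 + (3 * N + 3)) \<sigma>2"
    using runs_build_copy[of "unary N" "power_tape d" rows_tape \<sigma>1 1] by (simp add: \<sigma>_defs)
  also have "runs (classes_prog (power_tape d)) \<sigma>2 (classes_time N) \<sigma>3"
    unfolding \<sigma>3_def cs_def by (rule runs_classes_prog) (simp_all add: \<sigma>_defs)
  also have "runs (ruler_prog (power_tape d)) \<sigma>3 (ruler_time N) \<sigma>4"
    unfolding \<sigma>4_def by (rule runs_ruler_prog) (simp_all add: \<sigma>_defs)
  finally have "runs (setup_prog c d) (init_store x) (setup_time c d (length x)) \<sigma>4"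
    unfolding setup_prog_def setup_time_def Let_def N_def .
  then show ?thesis by (intro exI[of _ \<sigma>4]) (simp add: \<sigma>_defs)
qed

definition reduction_prog :: "nat \<Rightarrow> (cell_class \<Rightarrow> (nat \<Rightarrow> bool) \<Rightarrow> bool) \<Rightarrow> nat \<Rightarrow> nat \<Rightarrow> com" where
  "reduction_prog m ok c d =
    setup_prog c d ;; matrix_prog (power_tape (Suc d)) (cell_size m) (entry m ok)"

definition reduction_time :: "nat \<Rightarrow> nat \<Rightarrow> nat \<Rightarrow> nat \<Rightarrow> nat" where
  "reduction_time m c d n = (let N = (n + c) ^ d in
    setup_time c d n + matrix_time (cell_size m) ((N + 2) * (2 * N + 2)))"

lemma poly_fun_reduction_time: "poly_fun (reduction_time m c d)"
  unfolding reduction_time_def setup_time_def Let_def classes_time_def first_row_time_def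
    cells_time_def row_time_def ruler_time_def shift_time_def matrix_time_def line_time_def
    foreach_time_def
  by (intro poly_fun_intros poly_fun_power_time)

lemma uses_tapes_reduction_prog: "uses_tapes (power_tape (Suc (Suc d))) (reduction_prog m ok c d)"
  by (simp add: reduction_prog_def setup_prog_def uses_tapes_power_prog uses_tapes_classes_prog
      uses_tapes_ruler_prog uses_tapes_matrix_prog)

lemma runs_reduction_prog:
  fixes x :: "bool list" and c d :: nat
  defines "N \<equiv> (length x + c) ^ d"
  shows "\<exists>\<sigma>. runs (reduction_prog m ok c d) (init_store x) (reduction_time m c d (length x)) \<sigma> \<and>
    fst (\<sigma> (power_tape (Suc d))) =
      contents (adjacency_string (grid_digraph m ok (2 * N + 2) (cell_classes N x)))"
proof -
  define cs where "cs = map class_sym (cell_classes N x)"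
  define out where "out = matrix (cell_size m) (entry m ok) (ruler (2 * N + 2)) cs"
  obtain \<sigma> where "runs (setup_prog c d) (init_store x) (setup_time c d (length x)) \<sigma>"
    and \<sigma>: "\<sigma> class_tape = at_start cs" "\<sigma> count_tape = at_start (unary (length cs))"
      "\<sigma> ruler_tape = (ruler (2 * N + 2), 0)" "\<sigma> (power_tape (Suc d)) = at_end []"
    using runs_setup_prog[of c d x] unfolding cs_def N_def by blast
  note this(1)
  also have "runs (matrix_prog (power_tape (Suc d)) (cell_size m) (entry m ok)) \<sigma>
      (matrix_time (cell_size m) (length cs))
      (\<sigma>(ruler_tape := (ruler (2 * N + 2), - int (length cs)), power_tape (Suc d) := at_end out))"
    unfolding out_def
  proof (rule runs_matrix_prog[OF _ _ _ \<sigma>])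
    show "0 < s \<and> s < 10" if "s \<in> set cs" for s
      using that class_sym_bounds valid_class_cell_classes by (auto simp: cs_def)
  qed (simp_all add: ruler_less)
  finally have "runs (reduction_prog m ok c d) (init_store x) (reduction_time m c d (length x))
      (\<sigma>(ruler_tape := (ruler (2 * N + 2), - int (length cs)), power_tape (Suc d) := at_end out))"
    by (simp add: reduction_prog_def reduction_time_def Let_def cs_def length_cell_classes N_def)
  moreover have "list_tape out =
      contents (adjacency_string (grid_digraph m ok (2 * N + 2) (cell_classes N x)))"
    using matrix_eq_adjacency_string[of "2 * N + 2" "cell_classes N x" m ok]
      valid_class_cell_classes
    by (simp add: out_def cs_def contents_eq)
  ultimately show ?thesis by (metis fst_conv fun_upd_same)
qed

theorem poly_time_computable_grid_digraph:
  "poly_time_computable (\<lambda>x. adjacency_string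
    (grid_digraph m ok (2 * (length x + c) ^ d + 2) (cell_classes ((length x + c) ^ d) x)))"
proof -
  obtain p where p: "\<And>n. reduction_time m c d n = poly p n"
    using poly_fun_reduction_time unfolding poly_fun_def by blast
  show ?thesis
  proof (rule poly_time_computableI[OF _ uses_tapes_reduction_prog])
    show "\<exists>\<sigma>. runs (reduction_prog m ok c d) (init_store x) (poly p (length x)) \<sigma> \<and>
        fst (\<sigma> (power_tape (Suc (Suc d)) - 1)) = contents (adjacency_string
          (grid_digraph m ok (2 * (length x + c) ^ d + 2) (cell_classes ((length x + c) ^ d) x)))"
      for x
      using runs_reduction_prog[of m ok c d x] by (simp add: p)
  qed simp
qed

lemma halts_before_powerE:
  assumes "L \<in> NP"
  obtains M c d where "tm_wf M" "\<And>x. halts_before M x ((length x + c) ^ d)"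
    "\<And>x. x \<in> L \<longleftrightarrow> accepts M x"
proof -
  obtain M and p :: "nat poly" where M: "tm_wf M" "\<And>x. x \<in> L \<longleftrightarrow> accepts M x"
    and time: "\<And>x c t. (tm_step M ^^ t) (tm_init M x) c \<Longrightarrow> t \<le> poly p (length x)"
    using assms unfolding NP_def accepts_def by blast
  obtain c d where "\<And>n. poly p n < (n + c) ^ d" using poly_less_power by blast
  then have "halts_before M x ((length x + c) ^ d)" for x
    using time unfolding halts_before_def by (meson le_less_trans)
  with M show thesis using that by blast
qed

theorem theorem11:
  shows "NP_hard adjacency_string
    {G \<in> input_digraphs. max_degree (with_proj G) = 6}
    (\<lambda>G. colorable 2 (with_proj G))"
  unfolding NP_hard_def
proof
  fix L assume "L \<in> NP"
  then obtain M c d where wf: "tm_wf M" and halts: "\<And>x. halts_before M x ((length x + c) ^ d)"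
    and L: "\<And>x. x \<in> L \<longleftrightarrow> accepts M x"
    by (rule halts_before_powerE) blast
  obtain m where m: "tile_encoding (tile M) m" using exists_tile_encoding_machine by blast
  define G where "G x = computation_digraph M m ((length x + c) ^ d) x" for x
  have "poly_time_computable (\<lambda>x. adjacency_string (G x))"
    unfolding G_def computation_digraph_def by (rule poly_time_computable_grid_digraph)
  moreover have "G x \<in> {G \<in> input_digraphs. max_degree (with_proj G) = 6}" for x
    unfolding G_def using m by (rule computation_digraph_degree_6)
  moreover have "x \<in> L \<longleftrightarrow> colorable 2 (with_proj (G x))" for x
    unfolding L G_def colorable_2_computation_digraph_iff[OF m wf halts] ..
  ultimately show "\<exists>f. poly_time_computable f \<and>
      (\<forall>x. \<exists>G \<in> {G \<in> input_digraphs. max_degree (with_proj G) = 6}.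
        f x = adjacency_string G \<and> (x \<in> L \<longleftrightarrow> colorable 2 (with_proj G)))"
    by blast
qed

end
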